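(* Let $(R,\mathfrak{m})$ be a complete local ring of dimension $n$ and let $I,J$ be two ideals of $R$. Let $M$ be a finitely generated $R$-module and let $t=\mathrm{depth}(I,J,M)$. Then there is a natural isomorphism $$\mathrm{Hom}_R(H^t_{I,J}(M),H^t_{I,J}(M))\cong \mathrm{Hom}_R(D(H^t_{I,J}(M)),D(H^t_{I,J}(M))).$$
   Context: All rings are commutative Noetherian with non-zero identity. For a local ring $(R,\mathfrak{m})$ with residue field $k=R/\mathfrak{m}$, let $E=E_R(k)$ be the injective hull of $k$ and $D(-)=\mathrm{Hom}_R(-,E)$ the Matlis dual functor. For ideals $I,J$ of $R$ and an $R$-module $M$, the $(I,J)$-torsion part of $M$ is $\Gamma_{I,J}(M)=\{x\in M \mid I^n x\subseteq Jx \text{ for } n\gg 1\}$. The functor $\Gamma_{I,J}(-)$ is left exact, additive and covariant on the category of $R$-modules; its $i$-th right derived functor is denoted $H^i_{I,J}(-)$. The depth of $(I,J)$ on $M$ is $\mathrm{depth}(I,J,M)=\inf\{i\in\mathbb{N}_0 \mid H^i_{I,J}(M)\neq 0\}$ if this infimum exists, and $\infty$ otherwise; writing $\mathrm{depth}(I,J,M)=t$ with $H^t_{I,J}(M)$ means that $t$ is finite. *)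

theory Defs
  imports "HOL-Algebra.Module" "HOL-Algebra.Ideal_Product" "HOL-Algebra.Ring_Divisibility"
    "HOL-Library.Extended_Nat"
begin

locale local_ring = cring R for R (structure) and \<mm> +
  assumes maximalideal: "maximalideal \<mm> R"
    and maximalideal_unique: "maximalideal \<nn> R \<Longrightarrow> \<nn> = \<mm>"

abbreviation ideal_pow :: "('r, 'q) ring_scheme \<Rightarrow> 'r set \<Rightarrow> nat \<Rightarrow> 'r set"
  where "ideal_pow R I n \<equiv> I [^]\<^bsub>ideals_set R\<^esub> n"

text \<open>Completeness includes separatedness, i.e. the canonical map from \<open>R\<close> to the inverse limit
  of the \<open>R/I\<^sup>n\<close> is bijective.\<close>

definition adic_complete :: "('r, 'q) ring_scheme \<Rightarrow> 'r set \<Rightarrow> bool"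
  where "adic_complete R I \<longleftrightarrow>
    (\<Inter>n. ideal_pow R I n) = {\<zero>\<^bsub>R\<^esub>} \<and>
    (\<forall>x :: nat \<Rightarrow> 'r.
       (\<forall>i. x i \<in> carrier R) \<and>
       (\<forall>n. \<exists>N. \<forall>i\<ge>N. \<forall>j\<ge>N. x i \<ominus>\<^bsub>R\<^esub> x j \<in> ideal_pow R I n) \<longrightarrow>
       (\<exists>y\<in>carrier R. \<forall>n. \<exists>N. \<forall>i\<ge>N. x i \<ominus>\<^bsub>R\<^esub> y \<in> ideal_pow R I n))"

definition krull_dim :: "('r, 'q) ring_scheme \<Rightarrow> enat"
  where "krull_dim R =
    Sup {enat n | n. \<exists>P. (\<forall>i\<le>n. primeideal (P i) R) \<and> (\<forall>i<n. P i \<subset> P (Suc i))}"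

text \<open>The fields \<^const>\<open>monoid.mult\<close> and \<^const>\<open>one\<close> of a module record play no role in the locale
  \<^locale>\<open>module\<close>; they are left \<^const>\<open>undefined\<close> where a module has no natural choice.\<close>

definition regular_module :: "('r, 'q) ring_scheme \<Rightarrow> ('r, 'r) module"
  where "regular_module R =
    \<lparr>carrier = carrier R, monoid.mult = (\<otimes>\<^bsub>R\<^esub>), one = \<one>\<^bsub>R\<^esub>, ring.zero = \<zero>\<^bsub>R\<^esub>,
     ring.add = (\<oplus>\<^bsub>R\<^esub>), smult = (\<otimes>\<^bsub>R\<^esub>)\<rparr>"

definition finitely_generated :: "('r, 'q) ring_scheme \<Rightarrow> ('r, 'm) module \<Rightarrow> bool"
  where "finitely_generated R M \<longleftrightarrow>
    (\<exists>S \<subseteq> carrier M. finite S \<and> \<Inter>{N. submodule N R M \<and> S \<subseteq> N} = carrier M)"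

definition module_hom ::
    "('r, 'q) ring_scheme \<Rightarrow> ('r, 'm) module \<Rightarrow> ('r, 'n) module \<Rightarrow> ('m \<Rightarrow> 'n) set"
  where "module_hom R M N =
    {f \<in> hom (add_monoid M) (add_monoid N).
       \<forall>a\<in>carrier R. \<forall>x\<in>carrier M. f (a \<odot>\<^bsub>M\<^esub> x) = a \<odot>\<^bsub>N\<^esub> f x}"

definition module_iso ::
    "('r, 'q) ring_scheme \<Rightarrow> ('r, 'm) module \<Rightarrow> ('r, 'n) module \<Rightarrow> ('m \<Rightarrow> 'n) set"
  where "module_iso R M N = {f \<in> module_hom R M N. bij_betw f (carrier M) (carrier N)}"

text \<open>Elements of the Hom module are extensional functions, so that homomorphisms agreeing on the
  carrier are equal.\<close>

definition Hom_module ::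
    "('r, 'q) ring_scheme \<Rightarrow> ('r, 'm) module \<Rightarrow> ('r, 'n) module \<Rightarrow> ('r, 'm \<Rightarrow> 'n) module"
  where "Hom_module R M N =
    \<lparr>carrier = module_hom R M N \<inter> extensional (carrier M),
     monoid.mult = undefined, one = undefined,
     ring.zero = (\<lambda>x\<in>carrier M. \<zero>\<^bsub>N\<^esub>),
     ring.add = (\<lambda>f g. \<lambda>x\<in>carrier M. f x \<oplus>\<^bsub>N\<^esub> g x),
     smult = (\<lambda>a f. \<lambda>x\<in>carrier M. a \<odot>\<^bsub>N\<^esub> f x)\<rparr>"

definition quotient_module :: "('r, 'm) module \<Rightarrow> 'm set \<Rightarrow> ('r, 'm set) module"
  where "quotient_module M N =
    \<lparr>carrier = a_rcosets\<^bsub>M\<^esub> N,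
     monoid.mult = undefined, one = undefined,
     ring.zero = N,
     ring.add = set_add M,
     smult = (\<lambda>a X. \<Union>x\<in>X. N +>\<^bsub>M\<^esub> (a \<odot>\<^bsub>M\<^esub> x))\<rparr>"

text \<open>A definition cannot quantify over all types, so the test modules \<open>A\<close> and \<open>B\<close> are those
  carried by the type of the ring elements. They include \<open>R\<close> and all its ideals, so by Baer's
  criterion the extension property then holds for modules over arbitrary types.\<close>

definition injective_module :: "('r, 'q) ring_scheme \<Rightarrow> ('r, 'm) module \<Rightarrow> bool"
  where "injective_module R Q \<longleftrightarrow>
    module R Q \<and>
    (\<forall>(A :: ('r, 'r) module) (B :: ('r, 'r) module) f g.
       module R A \<and> module R B \<and>
       f \<in> module_hom R A B \<and> inj_on f (carrier A) \<and> g \<in> module_hom R A Q \<longrightarrow>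
       (\<exists>h \<in> module_hom R B Q. \<forall>x\<in>carrier A. h (f x) = g x))"

definition injective_hull ::
    "('r, 'q) ring_scheme \<Rightarrow> ('r, 'm) module \<Rightarrow> ('r, 'e) module \<Rightarrow> ('m \<Rightarrow> 'e) \<Rightarrow> bool"
  where "injective_hull R M E \<iota> \<longleftrightarrow>
    injective_module R E \<and>
    \<iota> \<in> module_hom R M E \<and> inj_on \<iota> (carrier M) \<and>
    (\<forall>N. submodule N R E \<and> N \<noteq> {\<zero>\<^bsub>E\<^esub>} \<longrightarrow> N \<inter> \<iota> ` carrier M \<noteq> {\<zero>\<^bsub>E\<^esub>})"

abbreviation residue_field_module :: "('r, 'q) ring_scheme \<Rightarrow> 'r set \<Rightarrow> ('r, 'r set) module"
  where "residue_field_module R \<mm> \<equiv> quotient_module (regular_module R) \<mm>"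

definition matlis_dual ::
    "('r, 'q) ring_scheme \<Rightarrow> ('r, 'e) module \<Rightarrow> ('r, 'm) module \<Rightarrow> ('r, 'm \<Rightarrow> 'e) module"
  where "matlis_dual R E X = Hom_module R X E"

text \<open>The action of the contravariant functor \<open>D = Hom(-, E)\<close> on \<open>f : X \<rightarrow> Y\<close>, namely
  \<open>D(f) : D(Y) \<rightarrow> D(X)\<close>, \<open>g \<mapsto> g \<circ> f\<close>.\<close>

definition matlis_dual_map ::
    "('r, 'q) ring_scheme \<Rightarrow> ('r, 'e) module \<Rightarrow> ('r, 'm) module \<Rightarrow> ('r, 'n) module
      \<Rightarrow> ('m \<Rightarrow> 'n) \<Rightarrow> (('n \<Rightarrow> 'e) \<Rightarrow> ('m \<Rightarrow> 'e))"
  where "matlis_dual_map R E X Y f =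
    (\<lambda>g\<in>carrier (matlis_dual R E Y). compose (carrier X) g f)"

definition pair_torsion ::
    "('r, 'q) ring_scheme \<Rightarrow> 'r set \<Rightarrow> 'r set \<Rightarrow> ('r, 'm) module \<Rightarrow> ('r, 'm) module"
  where "pair_torsion R I J M = M\<lparr>carrier :=
    {x \<in> carrier M. \<exists>N. \<forall>n\<ge>N.
       (\<lambda>a. a \<odot>\<^bsub>M\<^esub> x) ` ideal_pow R I n \<subseteq> (\<lambda>a. a \<odot>\<^bsub>M\<^esub> x) ` J}\<rparr>"

definition injective_resolution ::
    "('r, 'q) ring_scheme \<Rightarrow> ('r, 'm) module \<Rightarrow> (nat \<Rightarrow> ('r, 'i) module)
      \<Rightarrow> (nat \<Rightarrow> 'i \<Rightarrow> 'i) \<Rightarrow> ('m \<Rightarrow> 'i) \<Rightarrow> bool"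
  where "injective_resolution R M Q d \<epsilon> \<longleftrightarrow>
    (\<forall>i. injective_module R (Q i)) \<and>
    (\<forall>i. d i \<in> module_hom R (Q i) (Q (Suc i))) \<and>
    \<epsilon> \<in> module_hom R M (Q 0) \<and> inj_on \<epsilon> (carrier M) \<and>
    \<epsilon> ` carrier M = a_kernel (Q 0) (Q 1) (d 0) \<and>
    (\<forall>i. d i ` carrier (Q i) = a_kernel (Q (Suc i)) (Q (Suc (Suc i))) (d (Suc i)))"

definition cochain_cohomology ::
    "(nat \<Rightarrow> ('r, 'i) module) \<Rightarrow> (nat \<Rightarrow> 'i \<Rightarrow> 'i) \<Rightarrow> nat \<Rightarrow> ('r, 'i set) module"
  where "cochain_cohomology C d i =
    quotient_module
      ((C i)\<lparr>carrier := a_kernel (C i) (C (Suc i)) (d i)\<rparr>)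
      (case i of 0 \<Rightarrow> {\<zero>\<^bsub>C 0\<^esub>} | Suc j \<Rightarrow> d j ` carrier (C j))"

text \<open>The right derived functor of \<open>\<Gamma>\<^sub>I\<^sub>,\<^sub>J\<close> at \<open>M\<close>, computed from an injective resolution
  \<open>Q\<close>, \<open>d\<close> of \<open>M\<close>. The functor maps a homomorphism to its restriction, so the differentials of
  \<open>\<Gamma>\<^sub>I\<^sub>,\<^sub>J(Q)\<close> are the functions \<open>d\<close> themselves.\<close>

definition pair_local_cohomology ::
    "('r, 'q) ring_scheme \<Rightarrow> 'r set \<Rightarrow> 'r set \<Rightarrow> (nat \<Rightarrow> ('r, 'i) module)
      \<Rightarrow> (nat \<Rightarrow> 'i \<Rightarrow> 'i) \<Rightarrow> nat \<Rightarrow> ('r, 'i set) module"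
  where "pair_local_cohomology R I J Q d =
    cochain_cohomology (\<lambda>i. pair_torsion R I J (Q i)) d"

text \<open>In \<^typ>\<open>enat\<close> the infimum of the empty set is \<open>\<infinity>\<close>.\<close>

definition pair_depth ::
    "('r, 'q) ring_scheme \<Rightarrow> 'r set \<Rightarrow> 'r set \<Rightarrow> (nat \<Rightarrow> ('r, 'i) module)
      \<Rightarrow> (nat \<Rightarrow> 'i \<Rightarrow> 'i) \<Rightarrow> enat"
  where "pair_depth R I J Q d =
    Inf {enat i | i. carrier (pair_local_cohomology R I J Q d i)
                       \<noteq> {\<zero>\<^bsub>pair_local_cohomology R I J Q d i\<^esub>}}"

end

theory Submission
  imports Defs
begin

text \<open>Write \<open>H\<close> for the cohomology module and \<open>D\<close> for its Matlis dual. The map is injective because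
  homomorphisms to \<open>E\<close> separate points. For surjectivity let \<open>\<phi>\<close> be an endomorphism of \<open>D\<close> and
  \<open>x \<in> H\<close> with annihilator \<open>a\<close>. The functional \<open>g \<mapsto> \<phi> g x\<close> is killed by \<open>a\<close>, and since \<open>E\<close> is
  injective it only depends on the restriction of \<open>g\<close> to \<open>0 :\<^sub>H a\<close>. If this submodule is finitely
  generated, it is Matlis reflexive over the complete ring \<open>R\<close>, so the functional is evaluation at a
  point \<open>f x\<close>, and \<open>\<phi>\<close> is the dual of \<open>f\<close>.

  It remains to see that \<open>0 :\<^sub>H a\<close> is finitely generated. As \<open>R/a\<close> is \<open>(I, J)\<close>-torsion and the
  cohomology vanishes below the degree \<open>t\<close> of \<open>H\<close>, it is isomorphic to \<open>Ext\<^sup>t(R/a, M)\<close>. The latter is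
  finitely generated by induction on \<open>t\<close> and on the number of generators of \<open>a\<close>, using the exact
  sequences \<open>0 \<rightarrow> R/(a : x) \<rightarrow> R/a \<rightarrow> R/(a, x) \<rightarrow> 0\<close>.\<close>

section \<open>Submodules, homomorphisms and linear combinations\<close>

text \<open>In general \<open>H\<close> is neither finitely generated nor Artinian, so Matlis
  duality does not apply to it as a whole; finiteness is only available at the submodule that
  belongs to one point \<open>x\<close>. The comparison of \<open>H\<close> with Ext takes place
  inside the given resolution. Ext of R/a is the cohomology of the elements of \<open>Q\<close>
  killed by \<open>a\<close>, and these form a subcomplex of the torsion complex. Only one direction
  is used: every class of \<open>H\<close> killed by \<open>a\<close> has a representative killed by
  \<open>a\<close>. The torsion parts of the \<open>Q i\<close> are not known to be injective, but
  homomorphisms preserve torsion, so an extension with values in \<open>Q i\<close> sends torsion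
  elements to torsion elements. This splits off the coboundaries, and subtracting the split part of
  a representative makes it killed by \<open>a\<close>. Reflexivity of a finitely generated
  submodule N is obtained by constructing the evaluation point modulo \<open>\<mm>\<close>^n N for
  each n. Each passage to the next power goes through simple quotients, where the one-dimensional
  socle of \<open>E\<close> decides the correction, and completeness enters when the corrections are
  summed.\<close>

lemma (in module) submoduleI2:
  assumes sub: "H \<subseteq> carrier M" and zero: "\<zero>\<^bsub>M\<^esub> \<in> H"
    and add: "\<And>a b. a \<in> H \<Longrightarrow> b \<in> H \<Longrightarrow> a \<oplus>\<^bsub>M\<^esub> b \<in> H"
    and smult: "\<And>a x. a \<in> carrier R \<Longrightarrow> x \<in> H \<Longrightarrow> a \<odot>\<^bsub>M\<^esub> x \<in> H"
  shows "submodule H R M"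
proof (rule submoduleI[OF sub zero _ add smult])
  fix a assume a: "a \<in> H"
  then have "(\<ominus> \<one>) \<odot>\<^bsub>M\<^esub> a = \<ominus>\<^bsub>M\<^esub> a"
    using sub by (subst smult_l_minus) auto
  then show "\<ominus>\<^bsub>M\<^esub> a \<in> H"
    using smult[of "\<ominus> \<one>" a] a by simp
qed auto

lemma (in cring) idealI2:
  assumes sub: "H \<subseteq> carrier R" and zero: "\<zero> \<in> H"
    and add: "\<And>a b. a \<in> H \<Longrightarrow> b \<in> H \<Longrightarrow> a \<oplus> b \<in> H"
    and mult: "\<And>a x. a \<in> carrier R \<Longrightarrow> x \<in> H \<Longrightarrow> a \<otimes> x \<in> H"
  shows "ideal H R"
proof (rule idealI)
  show "ring R" by (rule ring_axioms)
  show "subgroup H (add_monoid R)"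
  proof (rule add.subgroupI)
    fix a assume a: "a \<in> H"
    then have "(\<ominus> \<one>) \<otimes> a = \<ominus> a"
      using sub by (subst l_minus) auto
    then show "\<ominus> a \<in> H"
      using mult[of "\<ominus> \<one>" a] a by simp
  qed (use assms in auto)
  fix a x assume "a \<in> H" "x \<in> carrier R"
  then show "x \<otimes> a \<in> H" "a \<otimes> x \<in> H"
    using mult[of x a] m_comm[of a x] sub by auto
qed

lemma idealD:
  fixes R (structure)
  assumes "ideal H R"
  shows "H \<subseteq> carrier R" "\<zero> \<in> H"
    "\<And>a b. a \<in> H \<Longrightarrow> b \<in> H \<Longrightarrow> a \<oplus> b \<in> H"
    "\<And>a b. a \<in> H \<Longrightarrow> b \<in> H \<Longrightarrow> a \<ominus> b \<in> H"
    "\<And>a x. a \<in> carrier R \<Longrightarrow> x \<in> H \<Longrightarrow> a \<otimes> x \<in> H"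
proof -
  interpret ideal H R by fact
  show "H \<subseteq> carrier R" "\<zero> \<in> H"
    "\<And>a b. a \<in> H \<Longrightarrow> b \<in> H \<Longrightarrow> a \<oplus> b \<in> H"
    "\<And>a x. a \<in> carrier R \<Longrightarrow> x \<in> H \<Longrightarrow> a \<otimes> x \<in> H"
    by (auto intro: I_l_closed)
  show "\<And>a b. a \<in> H \<Longrightarrow> b \<in> H \<Longrightarrow> a \<ominus> b \<in> H"
    by (simp add: a_minus_def)
qed

lemma (in module) submoduleD:
  assumes "submodule H R M"
  shows "H \<subseteq> carrier M" "\<And>x. x \<in> H \<Longrightarrow> x \<in> carrier M" "\<zero>\<^bsub>M\<^esub> \<in> H"
    "\<And>a b. a \<in> H \<Longrightarrow> b \<in> H \<Longrightarrow> a \<oplus>\<^bsub>M\<^esub> b \<in> H"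
    "\<And>a b. a \<in> H \<Longrightarrow> b \<in> H \<Longrightarrow> a \<ominus>\<^bsub>M\<^esub> b \<in> H"
    "\<And>a x. a \<in> carrier R \<Longrightarrow> x \<in> H \<Longrightarrow> a \<odot>\<^bsub>M\<^esub> x \<in> H"
proof -
  note E = submoduleE[OF assms]
  show "H \<subseteq> carrier M" "\<And>x. x \<in> H \<Longrightarrow> x \<in> carrier M"
    "\<And>a b. a \<in> H \<Longrightarrow> b \<in> H \<Longrightarrow> a \<oplus>\<^bsub>M\<^esub> b \<in> H"
    "\<And>a x. a \<in> carrier R \<Longrightarrow> x \<in> H \<Longrightarrow> a \<odot>\<^bsub>M\<^esub> x \<in> H"
    using E by auto
  show "\<And>a b. a \<in> H \<Longrightarrow> b \<in> H \<Longrightarrow> a \<ominus>\<^bsub>M\<^esub> b \<in> H"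
    using E by (simp add: a_minus_def)
  obtain x where "x \<in> H" using E(2) by auto
  then have "x \<oplus>\<^bsub>M\<^esub> \<ominus>\<^bsub>M\<^esub> x \<in> H" "x \<in> carrier M" using E(1,3,5) by auto
  then show "\<zero>\<^bsub>M\<^esub> \<in> H" by (simp add: M.r_neg)
qed

lemma (in module) submodule_module:
  "submodule H R M \<Longrightarrow> module R (M\<lparr>carrier := H\<rparr>)"
  using submodule.submodule_is_module module_axioms by blast

lemma (in module) smult_minus_right:
  "a \<in> carrier R \<Longrightarrow> x \<in> carrier M \<Longrightarrow> y \<in> carrier M \<Longrightarrow>
    a \<odot>\<^bsub>M\<^esub> (x \<ominus>\<^bsub>M\<^esub> y) = a \<odot>\<^bsub>M\<^esub> x \<ominus>\<^bsub>M\<^esub> a \<odot>\<^bsub>M\<^esub> y"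
  by (simp add: a_minus_def smult_r_distr smult_r_minus)

lemma (in module) smult_minus_left:
  "a \<in> carrier R \<Longrightarrow> b \<in> carrier R \<Longrightarrow> x \<in> carrier M \<Longrightarrow>
    (a \<ominus> b) \<odot>\<^bsub>M\<^esub> x = a \<odot>\<^bsub>M\<^esub> x \<ominus>\<^bsub>M\<^esub> b \<odot>\<^bsub>M\<^esub> x"
  by (simp add: a_minus_def smult_l_distr smult_l_minus)

lemma (in module) smult_comm:
  "a \<in> carrier R \<Longrightarrow> b \<in> carrier R \<Longrightarrow> x \<in> carrier M \<Longrightarrow>
    a \<odot>\<^bsub>M\<^esub> (b \<odot>\<^bsub>M\<^esub> x) = b \<odot>\<^bsub>M\<^esub> (a \<odot>\<^bsub>M\<^esub> x)"
  using smult_assoc1[of a b x] smult_assoc1[of b a x] by (simp add: R.m_comm)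

lemma (in abelian_group) minus_add_cancel:
  "x \<in> carrier G \<Longrightarrow> y \<in> carrier G \<Longrightarrow> (x \<ominus> y) \<oplus> y = x"
  "x \<in> carrier G \<Longrightarrow> y \<in> carrier G \<Longrightarrow> y \<oplus> (x \<ominus> y) = x"
  by (simp_all add: a_minus_def a_assoc l_neg a_lcomm r_neg)

lemma (in abelian_group) add_minus_cancel:
  "x \<in> carrier G \<Longrightarrow> y \<in> carrier G \<Longrightarrow> (x \<oplus> y) \<ominus> y = x"
  "x \<in> carrier G \<Longrightarrow> y \<in> carrier G \<Longrightarrow> (y \<oplus> x) \<ominus> y = x"
  by (simp_all add: a_minus_def a_assoc r_neg a_lcomm)

lemma (in abelian_group) add_minus_add:
  "x \<in> carrier G \<Longrightarrow> y \<in> carrier G \<Longrightarrow> u \<in> carrier G \<Longrightarrow> v \<in> carrier G \<Longrightarrow>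
    (x \<oplus> y) \<ominus> (u \<oplus> v) = (x \<ominus> u) \<oplus> (y \<ominus> v)"
  by (simp add: a_minus_def minus_add a_ac)

lemma (in abelian_group) minus_eq_zero_iff:
  "x \<in> carrier G \<Longrightarrow> y \<in> carrier G \<Longrightarrow> x \<ominus> y = \<zero> \<longleftrightarrow> x = y"
  by (metis minus_add_cancel(1) l_zero r_neg a_minus_def)

section \<open>Homomorphisms and their factorisation through the image\<close>

lemma module_homI:
  assumes "\<And>x. x \<in> carrier A \<Longrightarrow> f x \<in> carrier B"
    and "\<And>x y. x \<in> carrier A \<Longrightarrow> y \<in> carrier A \<Longrightarrow> f (x \<oplus>\<^bsub>A\<^esub> y) = f x \<oplus>\<^bsub>B\<^esub> f y"
    and "\<And>a x. a \<in> carrier R \<Longrightarrow> x \<in> carrier A \<Longrightarrow> f (a \<odot>\<^bsub>A\<^esub> x) = a \<odot>\<^bsub>B\<^esub> f x"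
  shows "f \<in> module_hom R A B"
  using assms by (auto simp: module_hom_def hom_def)

lemma module_homD:
  assumes "f \<in> module_hom R A B"
  shows "\<And>x. x \<in> carrier A \<Longrightarrow> f x \<in> carrier B"
    and "\<And>x y. x \<in> carrier A \<Longrightarrow> y \<in> carrier A \<Longrightarrow> f (x \<oplus>\<^bsub>A\<^esub> y) = f x \<oplus>\<^bsub>B\<^esub> f y"
    and "\<And>a x. a \<in> carrier R \<Longrightarrow> x \<in> carrier A \<Longrightarrow> f (a \<odot>\<^bsub>A\<^esub> x) = a \<odot>\<^bsub>B\<^esub> f x"
  using assms by (auto simp: module_hom_def hom_def)

lemma module_hom_zero:
  assumes "module R A" "module R B" "f \<in> module_hom R A B"
  shows "f \<zero>\<^bsub>A\<^esub> = \<zero>\<^bsub>B\<^esub>"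
proof -
  interpret A: module R A by fact
  interpret B: module R B by fact
  have "f (\<zero>\<^bsub>R\<^esub> \<odot>\<^bsub>A\<^esub> \<zero>\<^bsub>A\<^esub>) = \<zero>\<^bsub>R\<^esub> \<odot>\<^bsub>B\<^esub> f \<zero>\<^bsub>A\<^esub>"
    by (rule module_homD(3)[OF assms(3)]) auto
  then show ?thesis using module_homD(1)[OF assms(3), of "\<zero>\<^bsub>A\<^esub>"] by simp
qed

lemma module_hom_minus:
  assumes "module R A" "module R B" "f \<in> module_hom R A B"
    and "x \<in> carrier A" "y \<in> carrier A"
  shows "f (x \<ominus>\<^bsub>A\<^esub> y) = f x \<ominus>\<^bsub>B\<^esub> f y"
proof -
  interpret A: module R A by fact
  interpret B: module R B by fact
  have "f ((x \<ominus>\<^bsub>A\<^esub> y) \<oplus>\<^bsub>A\<^esub> y) = f (x \<ominus>\<^bsub>A\<^esub> y) \<oplus>\<^bsub>B\<^esub> f y"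
    using assms by (intro module_homD(2)[OF assms(3)]) auto
  then show ?thesis
    using assms module_homD(1)[OF assms(3)] A.minus_add_cancel B.add_minus_cancel by simp
qed

lemma module_hom_image_submodule:
  assumes "module R A" "module R B" "f \<in> module_hom R A B"
  shows "submodule (f ` carrier A) R B"
proof -
  interpret A: module R A by fact
  interpret B: module R B by fact
  note f = module_homD[OF assms(3)]
  show ?thesis
  proof (rule B.submoduleI2)
    show "f ` carrier A \<subseteq> carrier B" using f by auto
    show "\<zero>\<^bsub>B\<^esub> \<in> f ` carrier A"
      using module_hom_zero[OF assms] by (metis A.zero_closed imageI)
  qed (auto simp flip: f(2) f(3))
qed

lemma module_hom_restrict:
  "f \<in> module_hom R A B \<Longrightarrow> S \<subseteq> carrier A \<Longrightarrow> f \<in> module_hom R (A\<lparr>carrier := S\<rparr>) B"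
  by (rule module_homI) (auto dest: module_homD)

text \<open>The homomorphism theorem for \<open>f\<close> onto its image. The image remains a
  submodule of \<open>B\<close>, so that the factor can afterwards be extended to all of
  \<open>B\<close> when \<open>C\<close> is injective.\<close>

lemma module_hom_factor:
  assumes A: "module R A" and B: "module R B" and C: "module R C"
    and f: "f \<in> module_hom R A B" and g: "g \<in> module_hom R A C"
    and ker: "\<And>x. x \<in> carrier A \<Longrightarrow> f x = \<zero>\<^bsub>B\<^esub> \<Longrightarrow> g x = \<zero>\<^bsub>C\<^esub>"
  shows "\<exists>h\<in>module_hom R (B\<lparr>carrier := f ` carrier A\<rparr>) C. \<forall>x\<in>carrier A. h (f x) = g x"
proof -
  interpret A: module R A by fact
  interpret B: module R B by fact
  interpret C: module R C by fact
  note fD = module_homD[OF f] and gD = module_homD[OF g]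
  have wd: "g x = g y" if x: "x \<in> carrier A" "y \<in> carrier A" "f x = f y" for x y
  proof -
    have "f (x \<ominus>\<^bsub>A\<^esub> y) = \<zero>\<^bsub>B\<^esub>"
      using module_hom_minus[OF A B f x(1,2)] x fD(1) by (simp add: B.M.minus_eq_zero_iff)
    then have "g x \<ominus>\<^bsub>C\<^esub> g y = \<zero>\<^bsub>C\<^esub>"
      using ker[of "x \<ominus>\<^bsub>A\<^esub> y"] module_hom_minus[OF A C g x(1,2)] x(1,2) by simp
    then show ?thesis using x gD(1) by (simp add: C.M.minus_eq_zero_iff)
  qed
  define h where "h y = g (SOME x. x \<in> carrier A \<and> f x = y)" for y
  have h: "h (f x) = g x" if x: "x \<in> carrier A" for x
  proof -
    let ?x = "SOME x'. x' \<in> carrier A \<and> f x' = f x"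
    have "?x \<in> carrier A \<and> f ?x = f x" by (rule someI[of _ x]) (use x in blast)
    then show ?thesis unfolding h_def by (intro wd x) blast+
  qed
  have "h \<in> module_hom R (B\<lparr>carrier := f ` carrier A\<rparr>) C"
  proof (rule module_homI, simp_all)
    fix u assume "u \<in> f ` carrier A"
    then obtain x where x: "x \<in> carrier A" "u = f x" by blast
    show "h u \<in> carrier C" using h gD(1) x by simp
    show "h (u \<oplus>\<^bsub>B\<^esub> v) = h u \<oplus>\<^bsub>C\<^esub> h v" if v: "v \<in> f ` carrier A" for v
    proof -
      obtain y where y: "y \<in> carrier A" "v = f y" using v by blast
      show ?thesis using h[of "x \<oplus>\<^bsub>A\<^esub> y"] h x y fD(2) gD(2) by simp
    qed
    show "h (a \<odot>\<^bsub>B\<^esub> u) = a \<odot>\<^bsub>C\<^esub> h u" if a: "a \<in> carrier R" for a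
      using h[of "a \<odot>\<^bsub>A\<^esub> x"] h x a fD(3) gD(3) by simp
  qed
  with h show ?thesis by blast
qed

text \<open>Restricting the coefficients to \<open>A\<close> lets one notion cover spans, with
  \<open>A\<close> the whole ring, and products of an ideal \<open>A\<close> with a span. With
  powers of \<open>\<mm>\<close> for \<open>A\<close> these products are the steps of the adic
  filtration.\<close>

fun lcomb :: "('r, 'q) ring_scheme \<Rightarrow> ('r, 'm, 'x) module_scheme \<Rightarrow> 'r set \<Rightarrow> 'm list \<Rightarrow> 'm set" where
  "lcomb R M A [] = {\<zero>\<^bsub>M\<^esub>}"
| "lcomb R M A (e # es) = {c \<odot>\<^bsub>M\<^esub> e \<oplus>\<^bsub>M\<^esub> v | c v. c \<in> A \<and> v \<in> lcomb R M A es}"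

lemma lcomb_ConsI:
  "c \<in> A \<Longrightarrow> v \<in> lcomb R M A es \<Longrightarrow> c \<odot>\<^bsub>M\<^esub> e \<oplus>\<^bsub>M\<^esub> v \<in> lcomb R M A (e # es)"
  by auto

context module
begin

lemma lcomb_submodule:
  assumes "ideal A R" "set es \<subseteq> carrier M"
  shows "submodule (lcomb R M A es) R M"
  using assms(2)
proof (induction es)
  case Nil
  show ?case by (rule submoduleI2) auto
next
  case (Cons e es)
  note A = idealD[OF assms(1)]
  have sub: "submodule (lcomb R M A es) R M" using Cons by auto
  note L = submoduleD[OF sub]
  have e: "e \<in> carrier M" using Cons by auto
  show ?case
  proof (rule submoduleI2)
    show "lcomb R M A (e # es) \<subseteq> carrier M" using e A(1) L(1) by (auto simp: subset_iff)
    have "\<zero>\<^bsub>M\<^esub> = \<zero> \<odot>\<^bsub>M\<^esub> e \<oplus>\<^bsub>M\<^esub> \<zero>\<^bsub>M\<^esub>" using e by simp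
    then show "\<zero>\<^bsub>M\<^esub> \<in> lcomb R M A (e # es)" using A(2) L(3) lcomb_ConsI by metis
  next
    fix x y assume "x \<in> lcomb R M A (e # es)" "y \<in> lcomb R M A (e # es)"
    then obtain c v c' v' where *: "x = c \<odot>\<^bsub>M\<^esub> e \<oplus>\<^bsub>M\<^esub> v" "y = c' \<odot>\<^bsub>M\<^esub> e \<oplus>\<^bsub>M\<^esub> v'"
      "c \<in> A" "c' \<in> A" "v \<in> lcomb R M A es" "v' \<in> lcomb R M A es" by auto
    have "x \<oplus>\<^bsub>M\<^esub> y = (c \<oplus> c') \<odot>\<^bsub>M\<^esub> e \<oplus>\<^bsub>M\<^esub> (v \<oplus>\<^bsub>M\<^esub> v')"
      using * A(1) L(1) e by (simp add: smult_l_distr M.a_ac subset_iff)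
    then show "x \<oplus>\<^bsub>M\<^esub> y \<in> lcomb R M A (e # es)"
      using *(3-) A(3) L(4) by (simp only: lcomb_ConsI)
  next
    fix a x assume a: "a \<in> carrier R" and "x \<in> lcomb R M A (e # es)"
    then obtain c v where *: "x = c \<odot>\<^bsub>M\<^esub> e \<oplus>\<^bsub>M\<^esub> v" "c \<in> A" "v \<in> lcomb R M A es" by auto
    have "a \<odot>\<^bsub>M\<^esub> x = (a \<otimes> c) \<odot>\<^bsub>M\<^esub> e \<oplus>\<^bsub>M\<^esub> a \<odot>\<^bsub>M\<^esub> v"
      using * A(1) L(1) e a by (simp add: smult_r_distr smult_assoc1 subset_iff)
    then show "a \<odot>\<^bsub>M\<^esub> x \<in> lcomb R M A (e # es)"
      using *(2-) a A(5) L(6) by (simp only: lcomb_ConsI)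
  qed
qed

abbreviation "lspan es \<equiv> lcomb R M (carrier R) es"

lemma span_submodule: "set es \<subseteq> carrier M \<Longrightarrow> submodule (lspan es) R M"
  by (rule lcomb_submodule[OF R.oneideal])

lemma lcomb_closed:
  "ideal A R \<Longrightarrow> set es \<subseteq> carrier M \<Longrightarrow> x \<in> lcomb R M A es \<Longrightarrow> x \<in> carrier M"
  using lcomb_submodule submoduleD(2) by blast

lemma lcomb_mono: "A \<subseteq> B \<Longrightarrow> lcomb R M A es \<subseteq> lcomb R M B es"
  by (induction es) auto

lemma span_gen: "set es \<subseteq> carrier M \<Longrightarrow> set es \<subseteq> lspan es"
proof (induction es)
  case (Cons e es)
  have e: "e \<in> carrier M" and es: "set es \<subseteq> carrier M" using Cons by auto
  note L = submoduleD[OF span_submodule[OF es]]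
  have "e = \<one> \<odot>\<^bsub>M\<^esub> e \<oplus>\<^bsub>M\<^esub> \<zero>\<^bsub>M\<^esub>" using e by simp
  then have "e \<in> lspan (e # es)" using L(3) lcomb_ConsI by (metis R.one_closed)
  moreover have "x \<in> lspan (e # es)" if "x \<in> set es" for x
  proof -
    have "x = \<zero> \<odot>\<^bsub>M\<^esub> e \<oplus>\<^bsub>M\<^esub> x" using e that es by auto
    moreover have "x \<in> lspan es" using that Cons es by auto
    ultimately show ?thesis using lcomb_ConsI by (metis R.zero_closed)
  qed
  ultimately show ?case by auto
qed simp

lemma span_minimal: "submodule N R M \<Longrightarrow> set es \<subseteq> N \<Longrightarrow> lspan es \<subseteq> N"
proof (induction es)
  case (Cons e es)
  from submoduleD[OF Cons.prems(1)] Cons show ?case by auto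
qed (simp add: submoduleD(3))

lemma span_append:
  assumes "set es \<subseteq> carrier M" "set fs \<subseteq> carrier M" "x \<in> lspan es" "y \<in> lspan fs"
  shows "x \<oplus>\<^bsub>M\<^esub> y \<in> lspan (es @ fs)"
proof -
  have s: "submodule (lspan (es @ fs)) R M" using assms by (intro span_submodule) auto
  have g: "set (es @ fs) \<subseteq> lspan (es @ fs)" using assms by (intro span_gen) auto
  have "x \<in> lspan (es @ fs)" using span_minimal[OF s, of es] g assms by auto
  moreover have "y \<in> lspan (es @ fs)" using span_minimal[OF s, of fs] g assms by auto
  ultimately show ?thesis using submoduleD[OF s] by auto
qed

lemma span_eq_Inter:
  assumes "S \<subseteq> carrier M" "finite S"
  shows "\<exists>es. set es = S \<and> \<Inter>{N. submodule N R M \<and> S \<subseteq> N} = lspan es"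
proof -
  obtain es where es: "set es = S" using assms finite_list by blast
  have "\<Inter>{N. submodule N R M \<and> S \<subseteq> N} = lspan es"
  proof (rule antisym)
    show "\<Inter>{N. submodule N R M \<and> S \<subseteq> N} \<subseteq> lspan es"
      using span_submodule[of es] span_gen[of es] es assms by (intro Inter_lower) auto
    show "lspan es \<subseteq> \<Inter>{N. submodule N R M \<and> S \<subseteq> N}"
      using span_minimal es by (intro Inter_greatest) auto
  qed
  with es show ?thesis by blast
qed

end

lemma finitely_generated_span:
  assumes "module R M" "finitely_generated R M"
  shows "\<exists>es. set es \<subseteq> carrier M \<and> carrier M = lcomb R M (carrier R) es"
proof -
  obtain S where "S \<subseteq> carrier M" "finite S" "\<Inter>{N. submodule N R M \<and> S \<subseteq> N} = carrier M"
    using assms(2) unfolding finitely_generated_def by blast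
  then show ?thesis using module.span_eq_Inter[OF assms(1), of S] by auto
qed

lemma lcomb_map:
  assumes "module R A" "f \<in> module_hom R A B" "ideal X R" "set es \<subseteq> carrier A"
    and that: "module R B"
  shows "\<forall>v\<in>lcomb R A X es. f v \<in> lcomb R B X (map f es)"
    and "\<forall>w\<in>lcomb R B X (map f es). \<exists>v\<in>lcomb R A X es. w = f v"
proof -
  interpret A: module R A by fact
  interpret B: module R B by fact
  note f = module_homD[OF assms(2)]
  note X = idealD[OF assms(3)]
  show "\<forall>v\<in>lcomb R A X es. f v \<in> lcomb R B X (map f es)"
    using assms(4)
  proof (induction es)
    case (Cons e es)
    have cl: "v \<in> lcomb R A X es \<Longrightarrow> v \<in> carrier A" for v
      using A.lcomb_closed Cons assms by auto
    show ?case
    proof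
      fix w assume "w \<in> lcomb R A X (e # es)"
      then obtain c v where *: "w = c \<odot>\<^bsub>A\<^esub> e \<oplus>\<^bsub>A\<^esub> v" "c \<in> X" "v \<in> lcomb R A X es" by auto
      have "f w = c \<odot>\<^bsub>B\<^esub> f e \<oplus>\<^bsub>B\<^esub> f v"
        using * cl X(1) Cons.prems by (simp add: f subset_iff)
      moreover have "f v \<in> lcomb R B X (map f es)" using * Cons by auto
      ultimately show "f w \<in> lcomb R B X (map f (e # es))" using *(2) lcomb_ConsI[of c X] by simp
    qed
  qed (use module_hom_zero[OF assms(1) that assms(2)] in simp)
  show "\<forall>w\<in>lcomb R B X (map f es). \<exists>v\<in>lcomb R A X es. w = f v"
    using assms(4)
  proof (induction es)
    case (Cons e es)
    have cl: "v \<in> lcomb R A X es \<Longrightarrow> v \<in> carrier A" for v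
      using A.lcomb_closed Cons assms by auto
    show ?case
    proof
      fix w assume "w \<in> lcomb R B X (map f (e # es))"
      then obtain c u where *: "w = c \<odot>\<^bsub>B\<^esub> f e \<oplus>\<^bsub>B\<^esub> u" "c \<in> X" "u \<in> lcomb R B X (map f es)"
        by auto
      then obtain v where v: "v \<in> lcomb R A X es" "u = f v" using Cons by auto
      have "w = f (c \<odot>\<^bsub>A\<^esub> e \<oplus>\<^bsub>A\<^esub> v)"
        using * v cl X(1) Cons.prems by (simp add: f subset_iff)
      then show "\<exists>v\<in>lcomb R A X (e # es). w = f v" using lcomb_ConsI[OF *(2) v(1)] by blast
    qed
  qed (use module_hom_zero[OF assms(1) that assms(2)] in simp)
qed

section \<open>Finite generation over Noetherian rings\<close>

context cring
begin

lemma regular_module_sel [simp]: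
  "carrier (regular_module R) = carrier R" "zero (regular_module R) = \<zero>"
  "add (regular_module R) = (\<oplus>)" "smult (regular_module R) = (\<otimes>)"
  by (simp_all add: regular_module_def)

lemma regular_module: "module R (regular_module R)"
proof (rule moduleI)
  show "abelian_group (regular_module R)"
  proof (rule abelian_groupI)
    fix x assume "x \<in> carrier (regular_module R)"
    then show "\<exists>y\<in>carrier (regular_module R). y \<oplus>\<^bsub>regular_module R\<^esub> x = \<zero>\<^bsub>regular_module R\<^esub>"
      by (intro bexI[of _ "\<ominus> x"]) (auto simp: l_neg)
  qed (simp_all add: a_ac)
qed (simp_all add: cring_axioms l_distr r_distr m_assoc)

lemma submodule_regular_iff: "submodule H R (regular_module R) \<longleftrightarrow> ideal H R"
proof -
  interpret reg: module R "regular_module R" by (rule regular_module)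
  show ?thesis
  proof
    assume "submodule H R (regular_module R)"
    from reg.submoduleD[OF this] show "ideal H R" by (intro idealI2) auto
  next
    assume "ideal H R"
    from idealD[OF this] show "submodule H R (regular_module R)"
      by (intro reg.submoduleI2) auto
  qed
qed

lemma noetherian_ideal_span:
  assumes "noetherian_ring R" "ideal b R"
  shows "\<exists>rs. set rs \<subseteq> carrier R \<and> b = lcomb R (regular_module R) (carrier R) rs"
proof -
  interpret reg: module R "regular_module R" by (rule regular_module)
  obtain S where S: "S \<subseteq> carrier R" "finite S" "b = Idl S"
    using noetherian_ring.finetely_gen[OF assms] by blast
  then show ?thesis
    using reg.span_eq_Inter[of S] by (auto simp: genideal_def submodule_regular_iff)
qed

end

section \<open>Sums and intersections of submodules, and the Noetherian property\<close>

lemma (in module) submodule_add: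
  assumes "submodule A R M" "submodule B R M"
  shows "submodule {a \<oplus>\<^bsub>M\<^esub> b | a b. a \<in> A \<and> b \<in> B} R M"
proof (rule submoduleI2)
  note A = submoduleD[OF assms(1)] and B = submoduleD[OF assms(2)]
  let ?S = "{a \<oplus>\<^bsub>M\<^esub> b | a b. a \<in> A \<and> b \<in> B}"
  show "?S \<subseteq> carrier M" using A(2) B(2) by auto
  have "\<zero>\<^bsub>M\<^esub> = \<zero>\<^bsub>M\<^esub> \<oplus>\<^bsub>M\<^esub> \<zero>\<^bsub>M\<^esub>" by simp
  then show "\<zero>\<^bsub>M\<^esub> \<in> ?S" using A(3) B(3) by blast
  fix x assume "x \<in> ?S"
  then obtain a b where x: "x = a \<oplus>\<^bsub>M\<^esub> b" "a \<in> A" "b \<in> B" by auto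
  {
    fix y assume "y \<in> ?S"
    then obtain a' b' where y: "y = a' \<oplus>\<^bsub>M\<^esub> b'" "a' \<in> A" "b' \<in> B" by auto
    have "x \<oplus>\<^bsub>M\<^esub> y = (a \<oplus>\<^bsub>M\<^esub> a') \<oplus>\<^bsub>M\<^esub> (b \<oplus>\<^bsub>M\<^esub> b')"
      using x y A(2) B(2) by (simp add: M.a_ac)
    then show "x \<oplus>\<^bsub>M\<^esub> y \<in> ?S" using x y A(4) B(4) by blast
  }
  fix c assume "c \<in> carrier R"
  then have "c \<odot>\<^bsub>M\<^esub> x = c \<odot>\<^bsub>M\<^esub> a \<oplus>\<^bsub>M\<^esub> c \<odot>\<^bsub>M\<^esub> b" "c \<odot>\<^bsub>M\<^esub> a \<in> A" "c \<odot>\<^bsub>M\<^esub> b \<in> B"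
    using x A(2,6) B(2,6) by (auto simp: smult_r_distr)
  then show "c \<odot>\<^bsub>M\<^esub> x \<in> ?S" by blast
qed

lemma (in module) submodule_Int:
  "submodule A R M \<Longrightarrow> submodule B R M \<Longrightarrow> submodule (A \<inter> B) R M"
  by (rule submoduleI2) (simp_all add: submoduleD(3,4,6) submoduleD(1) le_infI1)

text \<open>With \<open>D = 0\<close> this says that submodules of finitely generated modules over a Noetherian
  ring are finitely generated.\<close>

lemma (in module) noetherian_relative:
  assumes noeth: "noetherian_ring R" and D: "submodule D R M"
    and es: "set es \<subseteq> carrier M" and Z: "submodule Z R M"
    and "\<And>z. z \<in> Z \<Longrightarrow> \<exists>v\<in>lspan es. \<exists>d\<in>D. z = v \<oplus>\<^bsub>M\<^esub> d"
  shows "\<exists>fs. set fs \<subseteq> Z \<and> (\<forall>z\<in>Z. \<exists>v\<in>lspan fs. \<exists>d\<in>D \<inter> Z. z = v \<oplus>\<^bsub>M\<^esub> d)"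
  using es Z assms(5)
proof (induction es arbitrary: Z)
  case Nil
  have "\<forall>z\<in>Z. \<exists>v\<in>lspan []. \<exists>d\<in>D \<inter> Z. z = v \<oplus>\<^bsub>M\<^esub> d"
    using Nil submoduleD[OF D] by (auto simp: Bex_def)
  then show ?case by (intro exI[of _ "[]"]) auto
next
  case (Cons e es)
  have e: "e \<in> carrier M" and es: "set es \<subseteq> carrier M" using Cons by auto
  define W where "W = {v \<oplus>\<^bsub>M\<^esub> d | v d. v \<in> lspan es \<and> d \<in> D}"
  have subW: "submodule W R M"
    unfolding W_def by (rule submodule_add[OF span_submodule[OF es] D])
  note W = submoduleD[OF subW] and Z = submoduleD[OF Cons.prems(2)]
  \<comment> \<open>The coefficients of \<open>e\<close> in elements of \<open>Z\<close>, taken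
    modulo \<open>W\<close>, form an ideal. Finitely many generators of this ideal lift to elements
    of \<open>Z\<close>, and they reduce \<open>Z\<close> to \<open>Z \<inter> W\<close>, where
    \<open>e\<close> no longer occurs.\<close>
  define b where "b = {r \<in> carrier R. \<exists>w\<in>W. r \<odot>\<^bsub>M\<^esub> e \<oplus>\<^bsub>M\<^esub> w \<in> Z}"
  have "ideal b R"
  proof (rule R.idealI2)
    show "\<zero> \<in> b" unfolding b_def using e W(3) Z(3) by (auto intro!: bexI[of _ "\<zero>\<^bsub>M\<^esub>"])
  next
    fix r s assume "r \<in> b" "s \<in> b"
    then obtain v w where *: "r \<in> carrier R" "s \<in> carrier R" "v \<in> W" "w \<in> W"
      "r \<odot>\<^bsub>M\<^esub> e \<oplus>\<^bsub>M\<^esub> v \<in> Z" "s \<odot>\<^bsub>M\<^esub> e \<oplus>\<^bsub>M\<^esub> w \<in> Z" unfolding b_def by auto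
    have "(r \<oplus> s) \<odot>\<^bsub>M\<^esub> e \<oplus>\<^bsub>M\<^esub> (v \<oplus>\<^bsub>M\<^esub> w) =
        (r \<odot>\<^bsub>M\<^esub> e \<oplus>\<^bsub>M\<^esub> v) \<oplus>\<^bsub>M\<^esub> (s \<odot>\<^bsub>M\<^esub> e \<oplus>\<^bsub>M\<^esub> w)"
      using * e W(2) by (simp add: smult_l_distr M.a_ac)
    then show "r \<oplus> s \<in> b" unfolding b_def using * W(4) Z(4) by (auto intro!: bexI[of _ "v \<oplus>\<^bsub>M\<^esub> w"])
  next
    fix a r assume "a \<in> carrier R" "r \<in> b"
    then obtain v where *: "a \<in> carrier R" "r \<in> carrier R" "v \<in> W"
      "r \<odot>\<^bsub>M\<^esub> e \<oplus>\<^bsub>M\<^esub> v \<in> Z" unfolding b_def by auto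
    have "(a \<otimes> r) \<odot>\<^bsub>M\<^esub> e \<oplus>\<^bsub>M\<^esub> a \<odot>\<^bsub>M\<^esub> v = a \<odot>\<^bsub>M\<^esub> (r \<odot>\<^bsub>M\<^esub> e \<oplus>\<^bsub>M\<^esub> v)"
      using * e W(2) by (simp add: smult_r_distr smult_assoc1)
    then show "a \<otimes> r \<in> b" unfolding b_def using * W(6) Z(6)
      by (auto intro!: bexI[of _ "a \<odot>\<^bsub>M\<^esub> v"])
  qed (auto simp: b_def)
  interpret reg: module R "regular_module R" by (rule R.regular_module)
  obtain rs where rs: "set rs \<subseteq> carrier R" "b = reg.lspan rs"
    using R.noetherian_ideal_span[OF noeth \<open>ideal b R\<close>] by blast
  have "set rs \<subseteq> b" using reg.span_gen[of rs] rs by auto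
  then have "\<forall>r\<in>set rs. \<exists>w. w \<in> W \<and> r \<odot>\<^bsub>M\<^esub> e \<oplus>\<^bsub>M\<^esub> w \<in> Z" unfolding b_def by auto
  then obtain w where w: "\<And>r. r \<in> set rs \<Longrightarrow> w r \<in> W \<and> r \<odot>\<^bsub>M\<^esub> e \<oplus>\<^bsub>M\<^esub> w r \<in> Z" by metis
  define \<zeta> where "\<zeta> r = r \<odot>\<^bsub>M\<^esub> e \<oplus>\<^bsub>M\<^esub> w r" for r
  have comb: "\<exists>u\<in>lspan (map \<zeta> rs). \<exists>y\<in>W. u = s \<odot>\<^bsub>M\<^esub> e \<oplus>\<^bsub>M\<^esub> y" if "s \<in> reg.lspan rs" for s
    using that w rs(1)
  proof (induction rs arbitrary: s)
    case Nil
    then show ?case using e W(3) by (auto intro!: bexI[of _ "\<zero>\<^bsub>M\<^esub>"])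
  next
    case (Cons r rs)
    then obtain c s' where s: "s = c \<otimes> r \<oplus> s'" "c \<in> carrier R" "s' \<in> reg.lspan rs" by auto
    have s'c: "s' \<in> carrier R" using reg.lcomb_closed[OF R.oneideal, of rs s'] s Cons.prems by auto
    obtain u y where u: "u \<in> lspan (map \<zeta> rs)" "y \<in> W" "u = s' \<odot>\<^bsub>M\<^esub> e \<oplus>\<^bsub>M\<^esub> y"
      using Cons.IH[OF s(3)] Cons.prems by auto
    have wr: "w r \<in> W" "w r \<in> carrier M" "y \<in> carrier M" "r \<in> carrier R"
      using Cons.prems W(2) u by auto
    have "c \<odot>\<^bsub>M\<^esub> \<zeta> r \<oplus>\<^bsub>M\<^esub> u = s \<odot>\<^bsub>M\<^esub> e \<oplus>\<^bsub>M\<^esub> (c \<odot>\<^bsub>M\<^esub> w r \<oplus>\<^bsub>M\<^esub> y)"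
      unfolding \<zeta>_def u s using wr s'c s(2) e
      by (simp add: smult_l_distr smult_r_distr smult_assoc1 M.a_ac)
    moreover have "c \<odot>\<^bsub>M\<^esub> \<zeta> r \<oplus>\<^bsub>M\<^esub> u \<in> lspan (map \<zeta> (r # rs))" using lcomb_ConsI[OF s(2) u(1), of "\<zeta> r"] by simp
    moreover have "c \<odot>\<^bsub>M\<^esub> w r \<oplus>\<^bsub>M\<^esub> y \<in> W" using wr(1) u(2) s(2) by (intro W)
    ultimately show ?case by blast
  qed
  obtain gs where gs: "set gs \<subseteq> Z \<inter> W"
    "\<And>z. z \<in> Z \<inter> W \<Longrightarrow> \<exists>v\<in>lspan gs. \<exists>d\<in>D \<inter> (Z \<inter> W). z = v \<oplus>\<^bsub>M\<^esub> d"
    using Cons.IH[OF es submodule_Int[OF Cons.prems(2) subW]] unfolding W_def by blast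
  have \<zeta>Z: "set (map \<zeta> rs) \<subseteq> Z" using w by (auto simp: \<zeta>_def)
  show ?case
  proof (intro exI[of _ "map \<zeta> rs @ gs"] conjI ballI)
    show "set (map \<zeta> rs @ gs) \<subseteq> Z" using \<zeta>Z gs by auto
  next
    fix z assume z: "z \<in> Z"
    then obtain v d where vd: "v \<in> lspan (e # es)" "d \<in> D" "z = v \<oplus>\<^bsub>M\<^esub> d" using Cons.prems(3) by blast
    then obtain s v' where v: "v = s \<odot>\<^bsub>M\<^esub> e \<oplus>\<^bsub>M\<^esub> v'" "s \<in> carrier R" "v' \<in> lspan es" by auto
    have v'c: "v' \<in> carrier M" using lcomb_closed[OF R.oneideal es v(3)] .
    have dc: "d \<in> carrier M" using submoduleD(2)[OF D vd(2)] .
    have zs: "z = s \<odot>\<^bsub>M\<^esub> e \<oplus>\<^bsub>M\<^esub> (v' \<oplus>\<^bsub>M\<^esub> d)" using vd v v'c dc e by (simp add: M.a_ac)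
    have vW: "v' \<oplus>\<^bsub>M\<^esub> d \<in> W" unfolding W_def using v vd by blast
    have "s \<in> b" unfolding b_def using v(2) vW z zs by auto
    then obtain u y where u: "u \<in> lspan (map \<zeta> rs)" "y \<in> W" "u = s \<odot>\<^bsub>M\<^esub> e \<oplus>\<^bsub>M\<^esub> y"
      using comb rs(2) by blast
    \<comment> \<open>Both \<open>z\<close> and \<open>u\<close> have the coefficient
      \<open>s\<close> at \<open>e\<close>, so it cancels in the difference, which therefore lies in
      \<open>Z \<inter> W\<close>.\<close>
    have uZ: "u \<in> Z" using span_minimal[OF Cons.prems(2) \<zeta>Z] u by auto
    have "z \<ominus>\<^bsub>M\<^esub> u = (v' \<oplus>\<^bsub>M\<^esub> d) \<ominus>\<^bsub>M\<^esub> y"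
      unfolding zs u using W(2)[OF u(2)] v'c dc e v(2)
      by (subst M.add_minus_add) (auto simp: M.r_neg a_minus_def)
    then have "z \<ominus>\<^bsub>M\<^esub> u \<in> Z \<inter> W" using Z(5)[OF z uZ] W(5)[OF vW u(2)] by simp
    from gs(2)[OF this] obtain v2 d2 where 2: "v2 \<in> lspan gs" "d2 \<in> D \<inter> (Z \<inter> W)"
      "z \<ominus>\<^bsub>M\<^esub> u = v2 \<oplus>\<^bsub>M\<^esub> d2" by blast
    have c: "u \<in> carrier M" "z \<in> carrier M" "v2 \<in> carrier M" "d2 \<in> carrier M"
      using uZ z Z(2) 2 lcomb_closed[OF R.oneideal _ 2(1)] gs(1) by auto
    have "z = (u \<oplus>\<^bsub>M\<^esub> v2) \<oplus>\<^bsub>M\<^esub> d2"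
      using M.minus_add_cancel(2)[of z u] 2(3) c by (simp add: M.a_assoc)
    moreover have "u \<oplus>\<^bsub>M\<^esub> v2 \<in> lspan (map \<zeta> rs @ gs)"
      using \<zeta>Z gs Z(1) u 2 by (intro span_append) auto
    ultimately show "\<exists>v\<in>lspan (map \<zeta> rs @ gs). \<exists>d\<in>D \<inter> Z. z = v \<oplus>\<^bsub>M\<^esub> d"
      using 2 by blast
  qed
qed

section \<open>Injective modules\<close>

text \<open>The element is the value at 1 of an extension of \<open>\<phi>\<close> to the whole
  ring. Ideals and the ring are carried by the type of the ring elements, so the definition of
  injectivity supplies this extension.\<close>

lemma injective_module_ideal:
  fixes R :: "('r, 'q) ring_scheme" (structure)
  assumes inj: "injective_module R Q" and b: "ideal b R"
    and \<phi>: "\<phi> \<in> module_hom R ((regular_module R)\<lparr>carrier := b\<rparr>) Q"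
  shows "\<exists>q\<in>carrier Q. \<forall>r\<in>b. \<phi> r = r \<odot>\<^bsub>Q\<^esub> q"
proof -
  interpret Q: module R Q using inj by (simp add: injective_module_def)
  let ?B = "regular_module R"
  interpret B: module R ?B by (rule Q.R.regular_module)
  let ?A = "?B\<lparr>carrier := b\<rparr>"
  have A: "module R ?A"
    by (rule B.submodule_module) (simp add: Q.R.submodule_regular_iff b)
  have id: "(\<lambda>x. x) \<in> module_hom R ?A ?B"
    by (rule module_homI) (use idealD(1)[OF b] in auto)
  have ext: "\<forall>(A :: ('r, 'r) module) (B :: ('r, 'r) module) f g.
       module R A \<and> module R B \<and>
       f \<in> module_hom R A B \<and> inj_on f (carrier A) \<and> g \<in> module_hom R A Q \<longrightarrow>
       (\<exists>h \<in> module_hom R B Q. \<forall>x\<in>carrier A. h (f x) = g x)"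
    using inj unfolding injective_module_def by (rule conjunct2)
  have "\<exists>h \<in> module_hom R ?B Q. \<forall>x\<in>carrier ?A. h x = \<phi> x"
    using ext[rule_format, of ?A ?B "\<lambda>x. x" \<phi>] A B.module_axioms id \<phi> by simp
  then obtain h where h: "h \<in> module_hom R ?B Q" "\<And>x. x \<in> b \<Longrightarrow> h x = \<phi> x" by auto
  have "\<phi> r = r \<odot>\<^bsub>Q\<^esub> h \<one>" if r: "r \<in> b" for r
  proof -
    have rc: "r \<in> carrier R" using idealD(1)[OF b] r by auto
    have "h (r \<otimes> \<one>) = r \<odot>\<^bsub>Q\<^esub> h \<one>" using module_homD(3)[OF h(1), of r \<one>] rc by simp
    then show ?thesis using h(2)[OF r] rc by simp
  qed
  moreover have "h \<one> \<in> carrier Q" using module_homD(1)[OF h(1)] by simp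
  ultimately show ?thesis by blast
qed

text \<open>Encoding partial homomorphisms by graphs turns extension into inclusion, so that the
  union of a chain is an upper bound for Zorn's lemma. Single-valuedness is demanded at zero alone;
  additivity spreads it to every point.\<close>

definition partial_hom_graph ::
    "('r, 'q) ring_scheme \<Rightarrow> ('r, 'p) module \<Rightarrow> ('r, 'm) module \<Rightarrow> ('p \<times> 'm) set \<Rightarrow> bool"
  where "partial_hom_graph R P Q G \<longleftrightarrow>
    G \<subseteq> carrier P \<times> carrier Q \<and>
    (\<forall>p y p' y'. (p, y) \<in> G \<longrightarrow> (p', y') \<in> G \<longrightarrow> (p \<oplus>\<^bsub>P\<^esub> p', y \<oplus>\<^bsub>Q\<^esub> y') \<in> G) \<and>
    (\<forall>a p y. a \<in> carrier R \<longrightarrow> (p, y) \<in> G \<longrightarrow> (a \<odot>\<^bsub>P\<^esub> p, a \<odot>\<^bsub>Q\<^esub> y) \<in> G) \<and>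
    (\<forall>y. (\<zero>\<^bsub>P\<^esub>, y) \<in> G \<longrightarrow> y = \<zero>\<^bsub>Q\<^esub>)"

lemma partial_hom_graphD:
  assumes "partial_hom_graph R P Q G"
  shows "\<And>p y. (p, y) \<in> G \<Longrightarrow> p \<in> carrier P" "\<And>p y. (p, y) \<in> G \<Longrightarrow> y \<in> carrier Q"
    "\<And>p y p' y'. (p, y) \<in> G \<Longrightarrow> (p', y') \<in> G \<Longrightarrow> (p \<oplus>\<^bsub>P\<^esub> p', y \<oplus>\<^bsub>Q\<^esub> y') \<in> G"
    "\<And>a p y. a \<in> carrier R \<Longrightarrow> (p, y) \<in> G \<Longrightarrow> (a \<odot>\<^bsub>P\<^esub> p, a \<odot>\<^bsub>Q\<^esub> y) \<in> G"
    "\<And>y. (\<zero>\<^bsub>P\<^esub>, y) \<in> G \<Longrightarrow> y = \<zero>\<^bsub>Q\<^esub>"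
  using assms unfolding partial_hom_graph_def by blast+

lemma partial_hom_graph_neg:
  assumes "module R P" "module R Q" "partial_hom_graph R P Q G" "(p, y) \<in> G"
  shows "(\<ominus>\<^bsub>P\<^esub> p, \<ominus>\<^bsub>Q\<^esub> y) \<in> G"
proof -
  interpret P: module R P by fact
  interpret Q: module R Q by fact
  note G = partial_hom_graphD[OF assms(3)]
  have "((\<ominus>\<^bsub>R\<^esub> \<one>\<^bsub>R\<^esub>) \<odot>\<^bsub>P\<^esub> p, (\<ominus>\<^bsub>R\<^esub> \<one>\<^bsub>R\<^esub>) \<odot>\<^bsub>Q\<^esub> y) \<in> G" by (rule G(4)) (use assms in auto)
  then show ?thesis using G(1,2)[OF assms(4)] by (simp add: P.smult_l_minus Q.smult_l_minus)
qed

lemma partial_hom_graph_unique: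
  assumes "module R P" "module R Q" "partial_hom_graph R P Q G" "(p, y) \<in> G" "(p, y') \<in> G"
  shows "y = y'"
proof -
  interpret P: module R P by fact
  interpret Q: module R Q by fact
  note G = partial_hom_graphD[OF assms(3)]
  have "(p \<oplus>\<^bsub>P\<^esub> \<ominus>\<^bsub>P\<^esub> p, y \<oplus>\<^bsub>Q\<^esub> \<ominus>\<^bsub>Q\<^esub> y') \<in> G"
    by (rule G(3)[OF assms(4) partial_hom_graph_neg[OF assms(1,2,3,5)]])
  then have "y \<ominus>\<^bsub>Q\<^esub> y' = \<zero>\<^bsub>Q\<^esub>" using G(1)[OF assms(4)] G(5) by (simp add: P.M.r_neg a_minus_def)
  then show ?thesis using G(2) assms by (simp add: Q.M.minus_eq_zero_iff)
qed

text \<open>The ring elements that multiply \<open>x\<close> into the domain of \<open>G\<close>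
  form an ideal \<open>b\<close>, and \<open>G\<close> induces a homomorphism on \<open>b\<close>.
  By injectivity this is multiplication by some \<open>q\<close>, so sending \<open>x\<close> to
  \<open>q\<close> agrees with \<open>G\<close>.\<close>

lemma partial_hom_graph_adjoin:
  fixes R :: "('r, 'q) ring_scheme" (structure)
  assumes inj: "injective_module R Q" and P: "module R P"
    and G: "partial_hom_graph R P Q G" and zero: "(\<zero>\<^bsub>P\<^esub>, \<zero>\<^bsub>Q\<^esub>) \<in> G" and x: "x \<in> carrier P"
  shows "\<exists>G' q. partial_hom_graph R P Q G' \<and> G \<subseteq> G' \<and> (x, q) \<in> G'"
proof -
  interpret P: module R P by fact
  interpret Q: module R Q using inj by (simp add: injective_module_def)
  note uniq = partial_hom_graph_unique[OF P Q.module_axioms G]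
  note neg = partial_hom_graph_neg[OF P Q.module_axioms G]
  note G = partial_hom_graphD[OF G]
  define b where "b = {r \<in> carrier R. \<exists>y. (r \<odot>\<^bsub>P\<^esub> x, y) \<in> G}"
  define \<phi> where "\<phi> r = (THE y. (r \<odot>\<^bsub>P\<^esub> x, y) \<in> G)" for r
  have bD: "r \<in> carrier R" "(r \<odot>\<^bsub>P\<^esub> x, \<phi> r) \<in> G" if "r \<in> b" for r
    using that theI[of "\<lambda>y. (r \<odot>\<^bsub>P\<^esub> x, y) \<in> G"] uniq unfolding b_def \<phi>_def by blast+
  have bI: "r \<in> b" "\<phi> r = y" if "r \<in> carrier R" "(r \<odot>\<^bsub>P\<^esub> x, y) \<in> G" for r y
  proof -
    show r: "r \<in> b" unfolding b_def using that by blast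
    show "\<phi> r = y" using uniq[OF bD(2)[OF r] that(2)] .
  qed
  have plus: "((r \<oplus> s) \<odot>\<^bsub>P\<^esub> x, \<phi> r \<oplus>\<^bsub>Q\<^esub> \<phi> s) \<in> G" if "r \<in> b" "s \<in> b" for r s
    using G(3)[OF bD(2)[OF that(1)] bD(2)[OF that(2)]] bD(1)[OF that(1)] bD(1)[OF that(2)] x
    by (simp add: P.smult_l_distr)
  have times: "((a \<otimes> r) \<odot>\<^bsub>P\<^esub> x, a \<odot>\<^bsub>Q\<^esub> \<phi> r) \<in> G" if "a \<in> carrier R" "r \<in> b" for a r
    using G(4)[OF that(1) bD(2)[OF that(2)]] that(1) bD(1)[OF that(2)] x by (simp add: P.smult_assoc1)
  have b: "ideal b R"
  proof (rule P.R.idealI2)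
    show "b \<subseteq> carrier R" unfolding b_def by auto
    show "\<zero> \<in> b" using zero x by (intro bI) auto
    show "r \<oplus> s \<in> b" if "r \<in> b" "s \<in> b" for r s
      using plus[OF that] bD(1) that by (intro bI) auto
    show "a \<otimes> r \<in> b" if "a \<in> carrier R" "r \<in> b" for a r
      using times[OF that] bD(1) that by (intro bI) auto
  qed
  have "\<phi> \<in> module_hom R ((regular_module R)\<lparr>carrier := b\<rparr>) Q"
  proof (rule module_homI, simp_all)
    show "\<phi> r \<in> carrier Q" if "r \<in> b" for r using G(2)[OF bD(2)[OF that]] .
    show "\<phi> (r \<oplus> s) = \<phi> r \<oplus>\<^bsub>Q\<^esub> \<phi> s" if "r \<in> b" "s \<in> b" for r s
      using plus[OF that] bD(1) that by (intro bI) auto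
    show "\<phi> (a \<otimes> r) = a \<odot>\<^bsub>Q\<^esub> \<phi> r" if "a \<in> carrier R" "r \<in> b" for a r
      using times[OF that] bD(1) that by (intro bI) auto
  qed
  then obtain q where q: "q \<in> carrier Q" "\<And>r. r \<in> b \<Longrightarrow> \<phi> r = r \<odot>\<^bsub>Q\<^esub> q"
    using injective_module_ideal[OF inj b] by blast
  define G' where "G' = {(p \<oplus>\<^bsub>P\<^esub> r \<odot>\<^bsub>P\<^esub> x, y \<oplus>\<^bsub>Q\<^esub> r \<odot>\<^bsub>Q\<^esub> q) | p y r. (p, y) \<in> G \<and> r \<in> carrier R}"
  have G'I: "(p \<oplus>\<^bsub>P\<^esub> r \<odot>\<^bsub>P\<^esub> x, y \<oplus>\<^bsub>Q\<^esub> r \<odot>\<^bsub>Q\<^esub> q) \<in> G'" if "(p, y) \<in> G" "r \<in> carrier R" for p y r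
    unfolding G'_def using that by blast
  have G'E: "\<exists>p y r. (p, y) \<in> G \<and> r \<in> carrier R \<and> u = p \<oplus>\<^bsub>P\<^esub> r \<odot>\<^bsub>P\<^esub> x \<and> v = y \<oplus>\<^bsub>Q\<^esub> r \<odot>\<^bsub>Q\<^esub> q"
    if "(u, v) \<in> G'" for u v
    using that unfolding G'_def by blast
  have "partial_hom_graph R P Q G'"
    unfolding partial_hom_graph_def
  proof (intro conjI allI impI subsetI)
    fix u assume "u \<in> G'"
    then show "u \<in> carrier P \<times> carrier Q"
      unfolding G'_def using G(1,2) x q(1) by auto
  next
    fix u v u' v' assume "(u, v) \<in> G'" "(u', v') \<in> G'"
    then obtain p y r p' y' r' where *: "(p, y) \<in> G" "r \<in> carrier R" "(p', y') \<in> G" "r' \<in> carrier R"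
      "u = p \<oplus>\<^bsub>P\<^esub> r \<odot>\<^bsub>P\<^esub> x" "v = y \<oplus>\<^bsub>Q\<^esub> r \<odot>\<^bsub>Q\<^esub> q"
      "u' = p' \<oplus>\<^bsub>P\<^esub> r' \<odot>\<^bsub>P\<^esub> x" "v' = y' \<oplus>\<^bsub>Q\<^esub> r' \<odot>\<^bsub>Q\<^esub> q" using G'E by meson
    note c = G(1,2)[OF *(1)] G(1,2)[OF *(3)]
    have "u \<oplus>\<^bsub>P\<^esub> u' = (p \<oplus>\<^bsub>P\<^esub> p') \<oplus>\<^bsub>P\<^esub> (r \<oplus> r') \<odot>\<^bsub>P\<^esub> x"
      "v \<oplus>\<^bsub>Q\<^esub> v' = (y \<oplus>\<^bsub>Q\<^esub> y') \<oplus>\<^bsub>Q\<^esub> (r \<oplus> r') \<odot>\<^bsub>Q\<^esub> q"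
      unfolding * using c *(2,4) x q(1)
      by (simp_all add: P.smult_l_distr P.M.a_ac Q.smult_l_distr Q.M.a_ac)
    then show "(u \<oplus>\<^bsub>P\<^esub> u', v \<oplus>\<^bsub>Q\<^esub> v') \<in> G'"
      using G'I[OF G(3)[OF *(1,3)], of "r \<oplus> r'"] *(2,4) by simp
  next
    fix a u v assume a: "a \<in> carrier R" and "(u, v) \<in> G'"
    then obtain p y r where *: "(p, y) \<in> G" "r \<in> carrier R"
      "u = p \<oplus>\<^bsub>P\<^esub> r \<odot>\<^bsub>P\<^esub> x" "v = y \<oplus>\<^bsub>Q\<^esub> r \<odot>\<^bsub>Q\<^esub> q" using G'E by meson
    note c = G(1,2)[OF *(1)]
    have "a \<odot>\<^bsub>P\<^esub> u = a \<odot>\<^bsub>P\<^esub> p \<oplus>\<^bsub>P\<^esub> (a \<otimes> r) \<odot>\<^bsub>P\<^esub> x"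
      "a \<odot>\<^bsub>Q\<^esub> v = a \<odot>\<^bsub>Q\<^esub> y \<oplus>\<^bsub>Q\<^esub> (a \<otimes> r) \<odot>\<^bsub>Q\<^esub> q"
      unfolding * using c *(2) a x q(1)
      by (simp_all add: P.smult_r_distr P.smult_assoc1 Q.smult_r_distr Q.smult_assoc1)
    then show "(a \<odot>\<^bsub>P\<^esub> u, a \<odot>\<^bsub>Q\<^esub> v) \<in> G'"
      using G'I[OF G(4)[OF a *(1)], of "a \<otimes> r"] *(2) a by simp
  next
    fix v assume "(\<zero>\<^bsub>P\<^esub>, v) \<in> G'"
    then obtain p y r where *: "(p, y) \<in> G" "r \<in> carrier R"
      "\<zero>\<^bsub>P\<^esub> = p \<oplus>\<^bsub>P\<^esub> r \<odot>\<^bsub>P\<^esub> x" "v = y \<oplus>\<^bsub>Q\<^esub> r \<odot>\<^bsub>Q\<^esub> q" using G'E by meson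
    note c = G(1,2)[OF *(1)]
    \<comment> \<open>The only place where the choice of \<open>q\<close> matters: the two
      contributions to zero meet in the domain of \<open>G\<close>, hence \<open>r\<close> lies in
      \<open>b\<close> and \<open>q\<close> prescribes the matching value.\<close>
    have "r \<odot>\<^bsub>P\<^esub> x = \<ominus>\<^bsub>P\<^esub> p"
      using *(2,3) c x by (metis P.M.minus_equality P.M.a_comm P.M.minus_minus P.smult_closed)
    then have "(r \<odot>\<^bsub>P\<^esub> x, \<ominus>\<^bsub>Q\<^esub> y) \<in> G" using neg[OF *(1)] by simp
    from bI[OF *(2) this] have "r \<odot>\<^bsub>Q\<^esub> q = \<ominus>\<^bsub>Q\<^esub> y" using q(2) by simp
    then show "v = \<zero>\<^bsub>Q\<^esub>" using * c by (simp add: Q.M.r_neg)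
  qed
  moreover have "G \<subseteq> G'"
  proof
    fix z assume "z \<in> G"
    then obtain p y where z: "z = (p, y)" "(p, y) \<in> G" by (cases z) auto
    then show "z \<in> G'" using G'I[OF z(2), of \<zero>] G(1,2)[OF z(2)] x q(1) by simp
  qed
  moreover have "(x, q) \<in> G'"
    using G'I[OF zero, of \<one>] x q(1) by simp
  ultimately show ?thesis by blast
qed

text \<open>Baer's criterion: \<^const>\<open>injective_module\<close> only mentions test modules over the type of
  the ring elements, but it gives extensions from submodules of modules over any type.\<close>

lemma injective_module_extend:
  fixes R :: "('r, 'q) ring_scheme" (structure) and P :: "('r, 'p) module"
  assumes inj: "injective_module R Q" and P: "module R P" and S: "submodule S R P"
    and f: "f \<in> module_hom R (P\<lparr>carrier := S\<rparr>) Q"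
  shows "\<exists>h\<in>module_hom R P Q. \<forall>x\<in>S. h x = f x"
proof -
  interpret P: module R P by fact
  interpret Q: module R Q using inj by (simp add: injective_module_def)
  note S' = P.submoduleD[OF S]
  note f' = module_homD[OF f, simplified]
  define G0 where "G0 = (\<lambda>x. (x, f x)) ` S"
  have f0: "f \<zero>\<^bsub>P\<^esub> = \<zero>\<^bsub>Q\<^esub>"
    using module_hom_zero[OF P.submodule_module[OF S] Q.module_axioms f] by simp
  have G0: "partial_hom_graph R P Q G0"
    unfolding partial_hom_graph_def G0_def using S'(2,4,6) f' f0
    by auto
  define X where "X = {G. partial_hom_graph R P Q G \<and> G0 \<subseteq> G}"
  have "\<exists>G\<in>X. \<forall>G'\<in>X. G \<subseteq> G' \<longrightarrow> G' = G"
  proof (rule subset_Zorn_nonempty)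
    show "X \<noteq> {}" using G0 by (auto simp: X_def)
  next
    fix C assume C: "C \<noteq> {}" "subset.chain X C"
    have CX: "partial_hom_graph R P Q G" "G0 \<subseteq> G" if "G \<in> C" for G
      using C that by (auto simp: subset.chain_def X_def)
    have lin: "G \<subseteq> G' \<or> G' \<subseteq> G" if "G \<in> C" "G' \<in> C" for G G'
      using C that by (auto simp: subset.chain_def)
    have "partial_hom_graph R P Q (\<Union>C)"
      unfolding partial_hom_graph_def
    proof (intro conjI allI impI subsetI)
      fix p y p' y' assume "(p, y) \<in> \<Union>C" "(p', y') \<in> \<Union>C"
      then obtain G G' where *: "G \<in> C" "G' \<in> C" "(p, y) \<in> G" "(p', y') \<in> G'" by auto
      then obtain G'' where **: "G'' \<in> C" "(p, y) \<in> G''" "(p', y') \<in> G''"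
        using lin[OF *(1,2)] by blast
      then show "(p \<oplus>\<^bsub>P\<^esub> p', y \<oplus>\<^bsub>Q\<^esub> y') \<in> \<Union>C"
        using partial_hom_graphD(3)[OF CX(1)[OF **(1)] **(2,3)] by blast
    next
      fix u assume "u \<in> \<Union>C"
      then obtain G where *: "G \<in> C" "u \<in> G" by blast
      then show "u \<in> carrier P \<times> carrier Q"
        using partial_hom_graphD(1,2)[OF CX(1)[OF *(1)]] by (cases u) auto
    next
      fix a p y assume a: "a \<in> carrier R" and "(p, y) \<in> \<Union>C"
      then obtain G where *: "G \<in> C" "(p, y) \<in> G" by blast
      then show "(a \<odot>\<^bsub>P\<^esub> p, a \<odot>\<^bsub>Q\<^esub> y) \<in> \<Union>C"
        using partial_hom_graphD(4)[OF CX(1)[OF *(1)] a *(2)] by blast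
    next
      fix y assume "(\<zero>\<^bsub>P\<^esub>, y) \<in> \<Union>C"
      then obtain G where *: "G \<in> C" "(\<zero>\<^bsub>P\<^esub>, y) \<in> G" by blast
      show "y = \<zero>\<^bsub>Q\<^esub>" by (rule partial_hom_graphD(5)[OF CX(1)[OF *(1)] *(2)])
    qed
    moreover have "G0 \<subseteq> \<Union>C" using C(1) CX(2) by blast
    ultimately show "\<Union>C \<in> X" by (simp add: X_def)
  qed
  then obtain G where GX: "G \<in> X" and GX_max: "\<And>G'. G' \<in> X \<Longrightarrow> G \<subseteq> G' \<Longrightarrow> G' = G"
    by meson
  have G: "partial_hom_graph R P Q G" "G0 \<subseteq> G"
    using GX by (simp_all add: X_def)
  have max: "G' = G" if "partial_hom_graph R P Q G'" "G \<subseteq> G'" for G'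
    by (rule GX_max[OF _ that(2)]) (use that G(2) in \<open>auto simp: X_def\<close>)
  have zero: "(\<zero>\<^bsub>P\<^esub>, \<zero>\<^bsub>Q\<^esub>) \<in> G" using G(2) S'(3) f0 unfolding G0_def by force
  \<comment> \<open>Adjoining \<open>x\<close> cannot enlarge a maximal graph, so the graph is
    already total.\<close>
  have "\<exists>y. (x, y) \<in> G" if "x \<in> carrier P" for x
    using partial_hom_graph_adjoin[OF inj P G(1) zero that] max by blast
  then obtain h where h: "\<And>x. x \<in> carrier P \<Longrightarrow> (x, h x) \<in> G" by metis
  note GD = partial_hom_graphD[OF G(1)]
  note uniq = partial_hom_graph_unique[OF P Q.module_axioms G(1)]
  have "h \<in> module_hom R P Q"
  proof (rule module_homI)
    show "h x \<in> carrier Q" if "x \<in> carrier P" for x using GD(2)[OF h[OF that]] .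
    show "h (x \<oplus>\<^bsub>P\<^esub> y) = h x \<oplus>\<^bsub>Q\<^esub> h y" if "x \<in> carrier P" "y \<in> carrier P" for x y
      by (rule uniq[OF h GD(3)[OF h h]]) (use that in auto)
    show "h (a \<odot>\<^bsub>P\<^esub> x) = a \<odot>\<^bsub>Q\<^esub> h x" if "a \<in> carrier R" "x \<in> carrier P" for a x
      by (rule uniq[OF h GD(4)[OF _ h]]) (use that in auto)
  qed
  moreover have "h x = f x" if "x \<in> S" for x
  proof (rule uniq[OF h])
    show "(x, f x) \<in> G" using G(2) that unfolding G0_def by blast
    show "x \<in> carrier P" using S'(2) that .
  qed
  ultimately show ?thesis by blast
qed

section \<open>Finiteness of \<open>Ext\<close> of cyclic modules\<close>

text \<open>For an ideal \<open>A\<close> this is Hom(R/A, M), a homomorphism being given by the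
  image of 1. Arbitrary sets are allowed so that a list of generators can take the place of its
  ideal.\<close>

definition annihilated ::
    "('r, 'q) ring_scheme \<Rightarrow> ('r, 'm, 'x) module_scheme \<Rightarrow> 'r set \<Rightarrow> 'm set"
  where "annihilated R M A = {x \<in> carrier M. \<forall>a\<in>A. a \<odot>\<^bsub>M\<^esub> x = \<zero>\<^bsub>M\<^esub>}"

lemma annihilatedI:
  "x \<in> carrier M \<Longrightarrow> (\<And>a. a \<in> A \<Longrightarrow> a \<odot>\<^bsub>M\<^esub> x = \<zero>\<^bsub>M\<^esub>) \<Longrightarrow> x \<in> annihilated R M A"
  by (simp add: annihilated_def)

lemma annihilatedD:
  "x \<in> annihilated R M A \<Longrightarrow> x \<in> carrier M"
  "x \<in> annihilated R M A \<Longrightarrow> a \<in> A \<Longrightarrow> a \<odot>\<^bsub>M\<^esub> x = \<zero>\<^bsub>M\<^esub>"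
  by (auto simp: annihilated_def)

lemma (in module) submodule_annihilated:
  assumes "A \<subseteq> carrier R"
  shows "submodule (annihilated R M A) R M"
proof (rule submoduleI2)
  show "annihilated R M A \<subseteq> carrier M" by (auto simp: annihilated_def)
  show "\<zero>\<^bsub>M\<^esub> \<in> annihilated R M A" using assms by (auto simp: annihilated_def subset_iff)
  show "x \<oplus>\<^bsub>M\<^esub> y \<in> annihilated R M A" if "x \<in> annihilated R M A" "y \<in> annihilated R M A" for x y
    using assms that by (auto simp: annihilated_def subset_iff smult_r_distr)
  show "c \<odot>\<^bsub>M\<^esub> x \<in> annihilated R M A" if "c \<in> carrier R" "x \<in> annihilated R M A" for c x
    using assms that by (auto simp: annihilated_def subset_iff smult_comm[of _ c x])
qed

lemma (in module) annihilator_ideal: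
  assumes "x \<in> carrier M"
  shows "ideal {a \<in> carrier R. a \<odot>\<^bsub>M\<^esub> x = \<zero>\<^bsub>M\<^esub>} R"
  by (rule R.idealI2) (use assms in \<open>auto simp: smult_l_distr smult_assoc1\<close>)

lemma annihilated_antimono: "A \<subseteq> B \<Longrightarrow> annihilated R M B \<subseteq> annihilated R M A"
  by (auto simp: annihilated_def)

text \<open>The scalars killing a fixed element form an ideal, so they contain the ideal as soon as
  they contain its generators. Inductions can then run over generating lists.\<close>

lemma (in module) annihilated_span:
  assumes "set rs \<subseteq> carrier R"
  shows "annihilated R M (lcomb R (regular_module R) (carrier R) rs) = annihilated R M (set rs)"
proof
  interpret reg: module R "regular_module R" by (rule R.regular_module)
  show "annihilated R M (reg.lspan rs) \<subseteq> annihilated R M (set rs)"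
    using reg.span_gen[of rs] assms by (intro annihilated_antimono) simp
  show "annihilated R M (set rs) \<subseteq> annihilated R M (reg.lspan rs)"
  proof
    fix x assume x: "x \<in> annihilated R M (set rs)"
    note xc = annihilatedD(1)[OF x]
    let ?I = "{a \<in> carrier R. a \<odot>\<^bsub>M\<^esub> x = \<zero>\<^bsub>M\<^esub>}"
    have "submodule ?I R (regular_module R)"
      using annihilator_ideal[OF xc] by (simp add: R.submodule_regular_iff)
    then have "reg.lspan rs \<subseteq> ?I"
      using assms annihilatedD(2)[OF x] by (intro reg.span_minimal) auto
    then show "x \<in> annihilated R M (reg.lspan rs)"
      using xc by (intro annihilatedI) auto
  qed
qed

lemma module_hom_annihilated:
  assumes "module R A" "module R B" "f \<in> module_hom R A B" "X \<subseteq> carrier R" "x \<in> annihilated R A X"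
  shows "f x \<in> annihilated R B X"
proof (rule annihilatedI)
  show "f x \<in> carrier B" using assms annihilatedD(1) module_homD(1) by metis
  fix a assume a: "a \<in> X"
  have "f (a \<odot>\<^bsub>A\<^esub> x) = a \<odot>\<^bsub>B\<^esub> f x"
    using assms a annihilatedD(1)[OF assms(5)] by (intro module_homD(3)) auto
  then show "a \<odot>\<^bsub>B\<^esub> f x = \<zero>\<^bsub>B\<^esub>"
    using annihilatedD(2)[OF assms(5) a] module_hom_zero[OF assms(1-3)] by simp
qed

text \<open>The map \<open>Hom(R/(rs), Q) \<rightarrow> Hom(R/((rs) : x), Q)\<close> induced by multiplication by \<open>x\<close> is
  surjective when \<open>Q\<close> is injective.\<close>

lemma injective_module_colon:
  fixes R :: "('r, 'q) ring_scheme" (structure) and Q :: "('r, 'm) module"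
  assumes inj: "injective_module R Q" and rs: "set rs \<subseteq> carrier R" and x: "x \<in> carrier R"
    and u: "u \<in> annihilated R Q
      {r \<in> carrier R. r \<otimes> x \<in> lcomb R (regular_module R) (carrier R) rs}"
  shows "\<exists>w\<in>annihilated R Q (set rs). x \<odot>\<^bsub>Q\<^esub> w = u"
proof -
  interpret Q: module R Q using inj by (simp add: injective_module_def)
  interpret reg: module R "regular_module R" by (rule Q.R.regular_module)
  note uc = annihilatedD(1)[OF u]
  define a where "a = reg.lspan rs"
  define c where "c = reg.lspan (x # rs)"
  have a: "ideal a R" and c: "ideal c R"
    unfolding a_def c_def Q.R.submodule_regular_iff[symmetric]
    using rs x by (intro reg.span_submodule; simp)+
  note aD = idealD[OF a] and cD = idealD[OF c]
  have cE: "\<exists>r y. r \<in> carrier R \<and> y \<in> a \<and> s = r \<otimes> x \<oplus> y" if "s \<in> c" for s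
    using that unfolding c_def a_def by auto
  have cI: "r \<otimes> x \<oplus> y \<in> c" if "r \<in> carrier R" "y \<in> a" for r y
    using that unfolding c_def a_def by auto
  \<comment> \<open>A homomorphism on the ideal generated by \<open>x\<close> and \<open>rs\<close>
    that kills \<open>rs\<close> and sends \<open>x\<close> to \<open>u\<close>. It is well defined
    because two choices of \<open>r\<close> differ by an element of the colon ideal, which kills
    \<open>u\<close>.\<close>
  define \<phi> where "\<phi> s = (THE z. \<exists>r y. r \<in> carrier R \<and> y \<in> a \<and> s = r \<otimes> x \<oplus> y \<and> z = r \<odot>\<^bsub>Q\<^esub> u)" for s
  have \<phi>: "\<phi> (r \<otimes> x \<oplus> y) = r \<odot>\<^bsub>Q\<^esub> u" if r: "r \<in> carrier R" "y \<in> a" for r y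
    unfolding \<phi>_def
  proof (rule the_equality)
    show "\<exists>ra ya. ra \<in> carrier R \<and> ya \<in> a \<and> r \<otimes> x \<oplus> y = ra \<otimes> x \<oplus> ya \<and> r \<odot>\<^bsub>Q\<^esub> u = ra \<odot>\<^bsub>Q\<^esub> u"
      using r by blast
    fix z assume "\<exists>ra ya. ra \<in> carrier R \<and> ya \<in> a \<and> r \<otimes> x \<oplus> y = ra \<otimes> x \<oplus> ya \<and> z = ra \<odot>\<^bsub>Q\<^esub> u"
    then obtain r' y' where r': "r' \<in> carrier R" "y' \<in> a" "r \<otimes> x \<oplus> y = r' \<otimes> x \<oplus> y'" "z = r' \<odot>\<^bsub>Q\<^esub> u"
      by blast
    have yc: "y \<in> carrier R" "y' \<in> carrier R" using aD(1) r r' by auto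
    have "(r' \<ominus> r) \<otimes> x = (r' \<otimes> x \<oplus> y') \<ominus> (r \<otimes> x \<oplus> y')"
      using r r' yc x by algebra
    also have "\<dots> = (r \<otimes> x \<oplus> y) \<ominus> (r \<otimes> x \<oplus> y')" using r'(3) by simp
    also have "\<dots> = y \<ominus> y'" using r yc x by algebra
    finally have "(r' \<ominus> r) \<otimes> x \<in> a" using aD(4)[OF r(2) r'(2)] by simp
    then have "(r' \<ominus> r) \<odot>\<^bsub>Q\<^esub> u = \<zero>\<^bsub>Q\<^esub>"
      using r r' annihilatedD(2)[OF u] unfolding a_def by simp
    then have "r' \<odot>\<^bsub>Q\<^esub> u \<ominus>\<^bsub>Q\<^esub> r \<odot>\<^bsub>Q\<^esub> u = \<zero>\<^bsub>Q\<^esub>"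
      using r r' uc by (simp add: Q.smult_minus_left)
    then show "z = r \<odot>\<^bsub>Q\<^esub> u" using r r' uc by (simp add: Q.M.minus_eq_zero_iff)
  qed
  have "\<phi> \<in> module_hom R ((regular_module R)\<lparr>carrier := c\<rparr>) Q"
  proof (rule module_homI, simp_all)
    fix s assume "s \<in> c"
    then obtain r y where s: "r \<in> carrier R" "y \<in> a" "s = r \<otimes> x \<oplus> y" using cE by blast
    have yc: "y \<in> carrier R" using aD(1) s by auto
    show "\<phi> s \<in> carrier Q" using s \<phi> uc by simp
    {
      fix s' assume "s' \<in> c"
      then obtain r' y' where s': "r' \<in> carrier R" "y' \<in> a" "s' = r' \<otimes> x \<oplus> y'" using cE by blast
      have yc': "y' \<in> carrier R" using aD(1) s' by auto
      have "s \<oplus> s' = (r \<oplus> r') \<otimes> x \<oplus> (y \<oplus> y')"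
        unfolding s s' using s(1) s'(1) yc yc' x by algebra
      then show "\<phi> (s \<oplus> s') = \<phi> s \<oplus>\<^bsub>Q\<^esub> \<phi> s'"
        using \<phi>[of "r \<oplus> r'" "y \<oplus> y'"] aD(3)[OF s(2) s'(2)] s s' \<phi> uc by (simp add: Q.smult_l_distr)
    }
    fix k assume k: "k \<in> carrier R"
    have "k \<otimes> s = (k \<otimes> r) \<otimes> x \<oplus> (k \<otimes> y)"
      unfolding s using s(1) yc x k by algebra
    then show "\<phi> (k \<otimes> s) = k \<odot>\<^bsub>Q\<^esub> \<phi> s"
      using \<phi>[of "k \<otimes> r" "k \<otimes> y"] aD(5)[OF k s(2)] s k \<phi> uc by (simp add: Q.smult_assoc1)
  qed
  then obtain q where q: "q \<in> carrier Q" "\<And>s. s \<in> c \<Longrightarrow> \<phi> s = s \<odot>\<^bsub>Q\<^esub> q"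
    using injective_module_ideal[OF inj c] by blast
  have "y \<odot>\<^bsub>Q\<^esub> q = \<zero>\<^bsub>Q\<^esub>" if y: "y \<in> set rs" for y
  proof -
    have ya: "y \<in> a" using reg.span_gen[of rs] rs y unfolding a_def by auto
    have "y = \<zero> \<otimes> x \<oplus> y" using y rs x by auto
    then show ?thesis using \<phi>[OF _ ya, of \<zero>] q(2)[OF cI[OF _ ya, of \<zero>]] uc by simp
  qed
  moreover have "x \<odot>\<^bsub>Q\<^esub> q = u"
  proof -
    have "x = \<one> \<otimes> x \<oplus> \<zero>" using x by simp
    then show ?thesis using \<phi>[OF _ aD(2), of \<one>] q(2)[OF cI[OF _ aD(2), of \<one>]] uc by simp
  qed
  ultimately show ?thesis using q(1) by (blast intro: annihilatedI)
qed

text \<open>The module \<open>M\<close> is present only through \<open>finite_kernel\<close>: the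
  kernel of \<open>d 0\<close> is its image. The listed elements need only span a module containing
  the kernel, since the ring is Noetherian.\<close>

locale injective_complex =
  fixes R :: "('r, 'q) ring_scheme" (structure)
    and Q :: "nat \<Rightarrow> ('r, 'i) module" and d :: "nat \<Rightarrow> 'i \<Rightarrow> 'i"
  assumes noetherian: "noetherian_ring R"
    and inj: "\<And>i. injective_module R (Q i)"
    and d_hom: "\<And>i. d i \<in> module_hom R (Q i) (Q (Suc i))"
    and d_d: "\<And>i w. w \<in> carrier (Q i) \<Longrightarrow> d (Suc i) (d i w) = \<zero>\<^bsub>Q (Suc (Suc i))\<^esub>"
    and exact: "\<And>i z. z \<in> carrier (Q (Suc i)) \<Longrightarrow> d (Suc i) z = \<zero>\<^bsub>Q (Suc (Suc i))\<^esub> \<Longrightarrow>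
      \<exists>w\<in>carrier (Q i). z = d i w"
    and finite_kernel: "\<exists>es. set es \<subseteq> carrier (Q 0) \<and>
      {x \<in> carrier (Q 0). d 0 x = \<zero>\<^bsub>Q 1\<^esub>} \<subseteq> lcomb R (Q 0) (carrier R) es"
begin

lemma Q_module: "module R (Q i)"
  using inj by (simp add: injective_module_def)

sublocale Q: module R "Q i" for i
  by (rule Q_module)

lemmas d_closed = module_homD(1)[OF d_hom]
  and d_add = module_homD(2)[OF d_hom]
  and d_smult = module_homD(3)[OF d_hom]
  and d_zero = module_hom_zero[OF Q_module Q_module d_hom]
  and d_minus = module_hom_minus[OF Q_module Q_module d_hom]

text \<open>Cocycles of the complex Hom(R/A, Q). Together with \<open>coboundaries\<close> they
  compute Ext of R/A with values in the resolved module when \<open>A\<close> is an ideal.\<close>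

definition cocycles :: "nat \<Rightarrow> 'r set \<Rightarrow> 'i set"
  where "cocycles i A = {z \<in> annihilated R (Q i) A. d i z = \<zero>\<^bsub>Q (Suc i)\<^esub>}"

definition coboundaries :: "nat \<Rightarrow> 'r set \<Rightarrow> 'i set"
  where "coboundaries i A = (case i of 0 \<Rightarrow> {\<zero>\<^bsub>Q 0\<^esub>} | Suc j \<Rightarrow> d j ` annihilated R (Q j) A)"

lemma submodule_kernel: "submodule {z \<in> carrier (Q i). d i z = \<zero>\<^bsub>Q (Suc i)\<^esub>} R (Q i)"
  by (rule Q.submoduleI2) (auto simp: d_add d_smult d_zero)

lemma submodule_cocycles:
  assumes "A \<subseteq> carrier R"
  shows "submodule (cocycles i A) R (Q i)"
proof -
  have "cocycles i A = annihilated R (Q i) A \<inter> {z \<in> carrier (Q i). d i z = \<zero>\<^bsub>Q (Suc i)\<^esub>}"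
    by (auto simp: cocycles_def annihilated_def)
  then show ?thesis
    using Q.submodule_Int[OF Q.submodule_annihilated[OF assms] submodule_kernel] by simp
qed

lemma submodule_coboundaries:
  assumes "A \<subseteq> carrier R"
  shows "submodule (coboundaries i A) R (Q i)"
proof (cases i)
  case 0
  show ?thesis unfolding 0 coboundaries_def by (rule Q.submoduleI2) auto
next
  case (Suc j)
  note sub = Q.submodule_annihilated[OF assms, of j]
  have "submodule (d j ` carrier ((Q j)\<lparr>carrier := annihilated R (Q j) A\<rparr>)) R (Q (Suc j))"
    by (rule module_hom_image_submodule[OF Q.submodule_module[OF sub] Q_module])
       (rule module_hom_restrict[OF d_hom Q.submoduleD(1)[OF sub]])
  then show ?thesis by (simp add: Suc coboundaries_def)
qed

text \<open>Finite generation of the quotient of cocycles by coboundaries, phrased with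
  representatives so that all arguments stay in \<open>Q i\<close>.\<close>

definition finite_Ext :: "nat \<Rightarrow> 'r set \<Rightarrow> bool"
  where "finite_Ext i A \<longleftrightarrow> (\<exists>fs. set fs \<subseteq> cocycles i A \<and>
    (\<forall>z\<in>cocycles i A. \<exists>v\<in>lcomb R (Q i) (carrier R) fs. \<exists>u\<in>coboundaries i A. z = v \<oplus>\<^bsub>Q i\<^esub> u))"

text \<open>In degree 0 the cocycles form a submodule of the kernel of \<open>d 0\<close>, which
  lies in a finitely generated module.\<close>

lemma finite_Ext_0:
  assumes "A \<subseteq> carrier R"
  shows "finite_Ext 0 A"
proof -
  obtain es where es: "set es \<subseteq> carrier (Q 0)"
    "{x \<in> carrier (Q 0). d 0 x = \<zero>\<^bsub>Q 1\<^esub>} \<subseteq> lcomb R (Q 0) (carrier R) es"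
    using finite_kernel by blast
  have "\<exists>fs. set fs \<subseteq> cocycles 0 A \<and> (\<forall>z\<in>cocycles 0 A.
      \<exists>v\<in>lcomb R (Q 0) (carrier R) fs. \<exists>u\<in>coboundaries 0 A \<inter> cocycles 0 A. z = v \<oplus>\<^bsub>Q 0\<^esub> u)"
  proof (rule Q.noetherian_relative[OF noetherian submodule_coboundaries[OF assms] es(1)
        submodule_cocycles[OF assms]])
    fix z assume "z \<in> cocycles 0 A"
    then have z: "z \<in> carrier (Q 0)" "d 0 z = \<zero>\<^bsub>Q 1\<^esub>" by (auto simp: cocycles_def annihilated_def)
    then have "z = z \<oplus>\<^bsub>Q 0\<^esub> \<zero>\<^bsub>Q 0\<^esub>" "z \<in> lcomb R (Q 0) (carrier R) es" using es(2) by auto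
    then show "\<exists>v\<in>lcomb R (Q 0) (carrier R) es. \<exists>d\<in>coboundaries 0 A. z = v \<oplus>\<^bsub>Q 0\<^esub> d"
      unfolding coboundaries_def by auto
  qed
  then show ?thesis unfolding finite_Ext_def by blast
qed

text \<open>The middle term of the exact sequence
  \<open>Ext\<^sup>i(R/((rs) : x), -) \<rightarrow> Ext\<^sup>i\<^sup>+\<^sup>1(R/(x, rs), -) \<rightarrow> Ext\<^sup>i\<^sup>+\<^sup>1(R/(rs), -)\<close> is finitely generated if the
  outer ones are.\<close>

lemma finite_Ext_step:
  assumes rs: "set rs \<subseteq> carrier R" and x: "x \<in> carrier R"
    and IH1: "finite_Ext (Suc j) (set rs)"
    and IH2: "finite_Ext j {r \<in> carrier R. r \<otimes> x \<in> lcomb R (regular_module R) (carrier R) rs}"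
  shows "finite_Ext (Suc j) (set (x # rs))"
proof -
  let ?A = "set (x # rs)" and ?A' = "set rs"
  define b where "b = {r \<in> carrier R. r \<otimes> x \<in> lcomb R (regular_module R) (carrier R) rs}"
  have A: "?A \<subseteq> carrier R" and bR: "b \<subseteq> carrier R" using rs x by (auto simp: b_def)
  have lift: "\<exists>w\<in>annihilated R (Q i) ?A'. x \<odot>\<^bsub>Q i\<^esub> w = u" if "u \<in> annihilated R (Q i) b" for i u
    using injective_module_colon[OF inj rs x] that unfolding b_def by blast
  obtain es where es: "set es \<subseteq> cocycles (Suc j) ?A'"
    "\<And>z. z \<in> cocycles (Suc j) ?A' \<Longrightarrow> \<exists>v\<in>lcomb R (Q (Suc j)) (carrier R) es.
      \<exists>u\<in>coboundaries (Suc j) ?A'. z = v \<oplus>\<^bsub>Q (Suc j)\<^esub> u"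
    using IH1 unfolding finite_Ext_def by meson
  obtain gs where gs: "set gs \<subseteq> cocycles j b"
    "\<And>z. z \<in> cocycles j b \<Longrightarrow> \<exists>v\<in>lcomb R (Q j) (carrier R) gs.
      \<exists>u\<in>coboundaries j b. z = v \<oplus>\<^bsub>Q j\<^esub> u"
    using IH2 unfolding finite_Ext_def b_def by meson
  have cocA: "cocycles (Suc j) ?A \<subseteq> cocycles (Suc j) ?A'"
    by (auto simp: cocycles_def annihilated_def)
  have es_c: "set es \<subseteq> carrier (Q (Suc j))"
    using es(1) by (auto simp: cocycles_def annihilated_def)
  \<comment> \<open>The \<open>fs\<close> represent generators of the image of Ext of R/(x, rs) in
    Ext of R/(rs), a submodule of a finitely generated module. What remains are cocycles that become
    coboundaries once \<open>x\<close> is dropped.\<close>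
  have "\<exists>fs. set fs \<subseteq> cocycles (Suc j) ?A \<and> (\<forall>z\<in>cocycles (Suc j) ?A.
      \<exists>v\<in>lcomb R (Q (Suc j)) (carrier R) fs. \<exists>u\<in>coboundaries (Suc j) ?A' \<inter> cocycles (Suc j) ?A.
        z = v \<oplus>\<^bsub>Q (Suc j)\<^esub> u)"
    by (rule Q.noetherian_relative[OF noetherian submodule_coboundaries[OF rs] es_c
        submodule_cocycles[OF A]]) (use es(2) cocA in blast)
  then obtain fs where fs: "set fs \<subseteq> cocycles (Suc j) ?A"
    "\<And>z. z \<in> cocycles (Suc j) ?A \<Longrightarrow> \<exists>v\<in>lcomb R (Q (Suc j)) (carrier R) fs.
      \<exists>u\<in>coboundaries (Suc j) ?A' \<inter> cocycles (Suc j) ?A. z = v \<oplus>\<^bsub>Q (Suc j)\<^esub> u"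
    by meson
  \<comment> \<open>The connecting homomorphism of the long exact sequence: lift the cocycle
    \<open>g\<close> along multiplication by \<open>x\<close> and apply the differential. The result
    is killed by \<open>x\<close> because \<open>d j g\<close> vanishes.\<close>
  have "\<exists>w. \<forall>g\<in>set gs. w g \<in> annihilated R (Q j) ?A' \<and> x \<odot>\<^bsub>Q j\<^esub> w g = g"
  proof (rule bchoice, rule ballI)
    fix g assume "g \<in> set gs"
    then have "g \<in> annihilated R (Q j) b" using gs(1) by (auto simp: cocycles_def)
    then show "\<exists>w. w \<in> annihilated R (Q j) ?A' \<and> x \<odot>\<^bsub>Q j\<^esub> w = g" using lift by blast
  qed
  then obtain w where w: "\<And>g. g \<in> set gs \<Longrightarrow> w g \<in> annihilated R (Q j) ?A'"
    "\<And>g. g \<in> set gs \<Longrightarrow> x \<odot>\<^bsub>Q j\<^esub> w g = g" by blast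
  define hs where "hs = map w gs"
  have hs: "set hs \<subseteq> annihilated R (Q j) ?A'" "map (\<lambda>y. x \<odot>\<^bsub>Q j\<^esub> y) hs = gs"
    using w by (auto simp: hs_def intro: map_idI)
  have hs_c: "set hs \<subseteq> carrier (Q j)" using hs(1) by (auto simp: annihilated_def)
  have xhom: "(\<lambda>y. x \<odot>\<^bsub>Q j\<^esub> y) \<in> module_hom R (Q j) (Q j)"
    using x by (intro module_homI) (auto simp: Q.smult_r_distr Q.smult_comm)
  have killed: "y \<in> annihilated R (Q i) ?A" if "y \<in> annihilated R (Q i) ?A'" "x \<odot>\<^bsub>Q i\<^esub> y = \<zero>\<^bsub>Q i\<^esub>" for i y
    using that by (auto simp: annihilated_def)
  have dhs: "set (map (d j) hs) \<subseteq> cocycles (Suc j) ?A"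
  proof
    fix y assume "y \<in> set (map (d j) hs)"
    then obtain g where g: "g \<in> set gs" "y = d j (w g)" by (auto simp: hs_def)
    have wc: "w g \<in> carrier (Q j)" using w(1)[OF g(1)] by (rule annihilatedD)
    have "x \<odot>\<^bsub>Q (Suc j)\<^esub> y = d j g" using d_smult[OF x wc] w(2)[OF g(1)] g(2) by simp
    also have "\<dots> = \<zero>\<^bsub>Q (Suc j)\<^esub>" using gs(1) g(1) by (auto simp: cocycles_def)
    finally have "y \<in> annihilated R (Q (Suc j)) ?A"
      using module_hom_annihilated[OF Q_module Q_module d_hom rs w(1)[OF g(1)]] g(2)
      by (intro killed) auto
    then show "y \<in> cocycles (Suc j) ?A" using d_d[OF wc] g(2) by (simp add: cocycles_def)
  qed
  show ?thesis
    unfolding finite_Ext_def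
  proof (intro exI[of _ "fs @ map (d j) hs"] conjI ballI)
    show "set (fs @ map (d j) hs) \<subseteq> cocycles (Suc j) ?A" using fs(1) dhs by auto
  next
    fix z assume z: "z \<in> cocycles (Suc j) ?A"
    from fs(2)[OF z] obtain v \<delta> where v: "v \<in> lcomb R (Q (Suc j)) (carrier R) fs"
      "\<delta> \<in> coboundaries (Suc j) ?A'" "\<delta> \<in> cocycles (Suc j) ?A" "z = v \<oplus>\<^bsub>Q (Suc j)\<^esub> \<delta>" by blast
    then obtain y where y: "y \<in> annihilated R (Q j) ?A'" "\<delta> = d j y" by (auto simp: coboundaries_def)
    have yc: "y \<in> carrier (Q j)" using y(1) by (rule annihilatedD)
    \<comment> \<open>The only obstacle to \<open>d j y\<close> being a coboundary for the larger
      list is that \<open>x\<close> need not kill \<open>y\<close>. The product of \<open>x\<close>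
      and \<open>y\<close> is a cocycle for the colon ideal, so the generators \<open>gs\<close>
      control it.\<close>
    have "x \<odot>\<^bsub>Q j\<^esub> y \<in> annihilated R (Q j) b"
    proof (rule annihilatedI)
      fix r assume r: "r \<in> b"
      then have "(r \<otimes> x) \<odot>\<^bsub>Q j\<^esub> y = \<zero>\<^bsub>Q j\<^esub>"
        using y(1) Q.annihilated_span[OF rs, of j] annihilatedD(2)[of y R "Q j"]
        unfolding b_def by blast
      then show "r \<odot>\<^bsub>Q j\<^esub> (x \<odot>\<^bsub>Q j\<^esub> y) = \<zero>\<^bsub>Q j\<^esub>"
        using r bR x yc by (simp add: Q.smult_assoc1 subset_iff)
    qed (use x yc in simp)
    moreover have "d j (x \<odot>\<^bsub>Q j\<^esub> y) = \<zero>\<^bsub>Q (Suc j)\<^esub>"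
      using d_smult[OF x yc] v(3) y(2) by (auto simp: cocycles_def annihilated_def)
    ultimately have "x \<odot>\<^bsub>Q j\<^esub> y \<in> cocycles j b" by (simp add: cocycles_def)
    from gs(2)[OF this] obtain u1 u2 where u: "u1 \<in> lcomb R (Q j) (carrier R) gs"
      "u2 \<in> coboundaries j b" "x \<odot>\<^bsub>Q j\<^esub> y = u1 \<oplus>\<^bsub>Q j\<^esub> u2" by blast
    obtain w1 where w1: "w1 \<in> lcomb R (Q j) (carrier R) hs" "u1 = x \<odot>\<^bsub>Q j\<^esub> w1"
      using lcomb_map(2)[OF Q_module xhom Q.R.oneideal hs_c Q_module] u(1) hs(2) by auto
    have w1a: "w1 \<in> annihilated R (Q j) ?A'"
      using Q.span_minimal[OF Q.submodule_annihilated[OF rs] hs(1)] w1(1) by blast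
    \<comment> \<open>A coboundary for the colon ideal must be lifted to something closed: its
      primitive is lifted along \<open>x\<close> first and the differential is applied afterwards.
      In degree 0 there is only zero to lift.\<close>
    obtain w2 where w2: "w2 \<in> annihilated R (Q j) ?A'" "u2 = x \<odot>\<^bsub>Q j\<^esub> w2" "d j w2 = \<zero>\<^bsub>Q (Suc j)\<^esub>"
    proof (cases j)
      case 0
      have "\<zero>\<^bsub>Q j\<^esub> \<in> annihilated R (Q j) ?A'"
        by (rule Q.submoduleD(3)[OF Q.submodule_annihilated[OF rs]])
      then show ?thesis using that[of "\<zero>\<^bsub>Q j\<^esub>"] u(2) d_zero x by (simp add: 0 coboundaries_def)
    next
      case (Suc k)
      then obtain p where p: "p \<in> annihilated R (Q k) b" "u2 = d k p"
        using u(2) by (auto simp: coboundaries_def)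
      obtain p' where p': "p' \<in> annihilated R (Q k) ?A'" "x \<odot>\<^bsub>Q k\<^esub> p' = p" using lift[OF p(1)] by blast
      have pc: "p' \<in> carrier (Q k)" using p'(1) by (rule annihilatedD)
      show ?thesis
        using that[of "d k p'"] module_hom_annihilated[OF Q_module Q_module d_hom rs p'(1)]
          d_smult[OF x pc] d_d[OF pc] p(2) p'(2) by (simp add: Suc)
    qed
    have c: "w1 \<in> carrier (Q j)" "w2 \<in> carrier (Q j)"
      using w1a w2(1) by (auto dest: annihilatedD(1))
    \<comment> \<open>Subtracting both lifts makes \<open>y\<close> killed by \<open>x\<close> as
      well. Its differential changes only by that of \<open>w1\<close>, which the new generators
      span.\<close>
    define w0 where "w0 = y \<ominus>\<^bsub>Q j\<^esub> (w1 \<oplus>\<^bsub>Q j\<^esub> w2)"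
    note sub = Q.submoduleD[OF Q.submodule_annihilated[OF rs]]
    have "x \<odot>\<^bsub>Q j\<^esub> w0 = \<zero>\<^bsub>Q j\<^esub>"
      unfolding w0_def using x yc c u(3) w1(2) w2(2)
      by (simp add: Q.smult_minus_right Q.smult_r_distr Q.M.minus_eq_zero_iff)
    then have w0: "w0 \<in> annihilated R (Q j) ?A"
      using y(1) w1a w2(1) unfolding w0_def by (intro killed sub)
    have w0c: "w0 \<in> carrier (Q j)" using w0 by (rule annihilatedD)
    have dw0: "\<delta> = d j w1 \<oplus>\<^bsub>Q (Suc j)\<^esub> d j w0"
    proof -
      have "y = w0 \<oplus>\<^bsub>Q j\<^esub> (w1 \<oplus>\<^bsub>Q j\<^esub> w2)"
        unfolding w0_def using yc c by (simp add: Q.M.minus_add_cancel)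
      then have "\<delta> = d j w0 \<oplus>\<^bsub>Q (Suc j)\<^esub> (d j w1 \<oplus>\<^bsub>Q (Suc j)\<^esub> d j w2)"
        using y(2) w0c c by (simp add: d_add)
      then show ?thesis using w2(3) w0c c by (simp add: d_closed Q.M.a_comm)
    qed
    have dw1: "d j w1 \<in> lcomb R (Q (Suc j)) (carrier R) (map (d j) hs)"
      using lcomb_map(1)[OF Q_module d_hom Q.R.oneideal hs_c Q_module] w1(1) by blast
    have cc: "set fs \<subseteq> carrier (Q (Suc j))" "set (map (d j) hs) \<subseteq> carrier (Q (Suc j))"
      using fs(1) dhs by (auto simp: cocycles_def annihilated_def)
    have vc: "v \<in> carrier (Q (Suc j))" by (rule Q.lcomb_closed[OF Q.R.oneideal cc(1) v(1)])
    have "z = (v \<oplus>\<^bsub>Q (Suc j)\<^esub> d j w1) \<oplus>\<^bsub>Q (Suc j)\<^esub> d j w0"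
      using v(4) dw0 vc c w0c by (simp add: d_closed Q.M.a_assoc)
    moreover have "v \<oplus>\<^bsub>Q (Suc j)\<^esub> d j w1 \<in> lcomb R (Q (Suc j)) (carrier R) (fs @ map (d j) hs)"
      by (rule Q.span_append[OF cc v(1) dw1])
    moreover have "d j w0 \<in> coboundaries (Suc j) ?A" using w0 by (simp add: coboundaries_def)
    ultimately show "\<exists>v\<in>lcomb R (Q (Suc j)) (carrier R) (fs @ map (d j) hs).
        \<exists>u\<in>coboundaries (Suc j) ?A. z = v \<oplus>\<^bsub>Q (Suc j)\<^esub> u"
      by blast
  qed
qed

lemma finite_Ext_span:
  assumes "set rs \<subseteq> carrier R"
  shows "finite_Ext i (lcomb R (regular_module R) (carrier R) rs) \<longleftrightarrow> finite_Ext i (set rs)"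
  unfolding finite_Ext_def cocycles_def coboundaries_def Q.annihilated_span[OF assms] ..

text \<open>The colon ideal may need more generators than the list has, but it occurs one degree
  lower. Hence the induction on the degree is the outer one and holds for all lists, with the
  induction on the list inside.\<close>

lemma finite_Ext_set: "set rs \<subseteq> carrier R \<Longrightarrow> finite_Ext i (set rs)"
proof (induction i arbitrary: rs)
  case 0
  then show ?case by (rule finite_Ext_0)
next
  case (Suc j)
  from Suc.prems show ?case
  proof (induction rs)
    \<comment> \<open>Without generators no annihilation condition is left, and exactness of the
      complex makes every cocycle a coboundary.\<close>
    case Nil
    have "\<exists>u\<in>coboundaries (Suc j) {}. z = \<zero>\<^bsub>Q (Suc j)\<^esub> \<oplus>\<^bsub>Q (Suc j)\<^esub> u"
      if "z \<in> cocycles (Suc j) {}" for z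
    proof -
      have z: "z \<in> carrier (Q (Suc j))" "d (Suc j) z = \<zero>\<^bsub>Q (Suc (Suc j))\<^esub>"
        using that by (auto simp: cocycles_def annihilated_def)
      obtain y where "y \<in> carrier (Q j)" "z = d j y" using exact[OF z] by blast
      then have "z \<in> coboundaries (Suc j) {}" by (auto simp: coboundaries_def annihilated_def)
      then show ?thesis using z(1) by (intro bexI[of _ z]) simp_all
    qed
    then show ?case unfolding finite_Ext_def by (intro exI[of _ "[]"]) auto
  next
    case (Cons x rs)
    let ?b = "{r \<in> carrier R. r \<otimes> x \<in> lcomb R (regular_module R) (carrier R) rs}"
    have x: "x \<in> carrier R" and rs: "set rs \<subseteq> carrier R" using Cons.prems by auto
    interpret reg: module R "regular_module R" by (rule Q.R.regular_module)
    have "ideal (reg.lspan rs) R"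
      unfolding Q.R.submodule_regular_iff[symmetric] using rs by (intro reg.span_submodule) simp
    note a = idealD[OF this]
    have "ideal ?b R"
      by (rule Q.R.idealI2) (use x a(2,3,5) in \<open>auto simp: Q.R.l_distr Q.R.m_assoc\<close>)
    then obtain bs where bs: "set bs \<subseteq> carrier R" "?b = reg.lspan bs"
      using Q.R.noetherian_ideal_span[OF noetherian] by blast
    have "finite_Ext j ?b"
      unfolding bs(2) finite_Ext_span[OF bs(1)] by (rule Suc.IH[OF bs(1)])
    then show ?case by (rule finite_Ext_step[OF rs x Cons.IH[OF rs]])
  qed
qed

lemma finite_Ext_ideal: "ideal a R \<Longrightarrow> finite_Ext i a"
  using Q.R.noetherian_ideal_span[OF noetherian] finite_Ext_span finite_Ext_set by metis

end

section \<open>Quotient modules\<close>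

lemma (in module) coset_eq_iff:
  assumes N: "submodule N R M" and x: "x \<in> carrier M" "y \<in> carrier M"
  shows "N +>\<^bsub>M\<^esub> x = N +>\<^bsub>M\<^esub> y \<longleftrightarrow> x \<ominus>\<^bsub>M\<^esub> y \<in> N"
proof -
  note N' = submoduleD[OF N]
  have mem: "u \<in> N +>\<^bsub>M\<^esub> v \<longleftrightarrow> u \<in> carrier M \<and> u \<ominus>\<^bsub>M\<^esub> v \<in> N" if "v \<in> carrier M" for u v
  proof
    assume "u \<in> N +>\<^bsub>M\<^esub> v"
    then obtain h where "h \<in> N" "u = h \<oplus>\<^bsub>M\<^esub> v" by (auto simp: a_r_coset_def')
    then show "u \<in> carrier M \<and> u \<ominus>\<^bsub>M\<^esub> v \<in> N" using that N'(2) by (simp add: M.add_minus_cancel)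
  next
    assume u: "u \<in> carrier M \<and> u \<ominus>\<^bsub>M\<^esub> v \<in> N"
    then have "u = (u \<ominus>\<^bsub>M\<^esub> v) \<oplus>\<^bsub>M\<^esub> v" using that by (simp add: M.minus_add_cancel)
    then show "u \<in> N +>\<^bsub>M\<^esub> v" using u by (auto simp: a_r_coset_def')
  qed
  show ?thesis
  proof
    assume "N +>\<^bsub>M\<^esub> x = N +>\<^bsub>M\<^esub> y"
    moreover have "x \<in> N +>\<^bsub>M\<^esub> x" using mem[OF x(1), of x] x N'(3) by (simp add: a_minus_def M.r_neg)
    ultimately show "x \<ominus>\<^bsub>M\<^esub> y \<in> N" using mem[OF x(2)] by simp
  next
    assume xy: "x \<ominus>\<^bsub>M\<^esub> y \<in> N"
    have "u \<ominus>\<^bsub>M\<^esub> x \<in> N \<longleftrightarrow> u \<ominus>\<^bsub>M\<^esub> y \<in> N" if u: "u \<in> carrier M" for u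
    proof -
      have 1: "(u \<ominus>\<^bsub>M\<^esub> x) \<oplus>\<^bsub>M\<^esub> (x \<ominus>\<^bsub>M\<^esub> y) = u \<ominus>\<^bsub>M\<^esub> y"
        using u x by (simp add: a_minus_def M.a_assoc) (simp add: M.r_neg1)
      then have 2: "(u \<ominus>\<^bsub>M\<^esub> y) \<ominus>\<^bsub>M\<^esub> (x \<ominus>\<^bsub>M\<^esub> y) = u \<ominus>\<^bsub>M\<^esub> x"
        using u x M.add_minus_cancel(1)[of "u \<ominus>\<^bsub>M\<^esub> x" "x \<ominus>\<^bsub>M\<^esub> y"] by simp
      show ?thesis using N'(4)[OF _ xy] N'(5)[OF _ xy] 1 2 by metis
    qed
    then show "N +>\<^bsub>M\<^esub> x = N +>\<^bsub>M\<^esub> y" using mem x by blast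
  qed
qed

lemma quotient_module_sel:
  "carrier (quotient_module M N) = (\<lambda>x. N +>\<^bsub>M\<^esub> x) ` carrier M"
  "zero (quotient_module M N) = N"
  "add (quotient_module M N) = set_add M"
  "smult (quotient_module M N) = (\<lambda>a X. \<Union>x\<in>X. N +>\<^bsub>M\<^esub> (a \<odot>\<^bsub>M\<^esub> x))"
  by (auto simp: quotient_module_def A_RCOSETS_def')

lemma quotient_module_add:
  assumes "module R M" "submodule N R M" "x \<in> carrier M" "y \<in> carrier M"
  shows "(N +>\<^bsub>M\<^esub> x) \<oplus>\<^bsub>quotient_module M N\<^esub> (N +>\<^bsub>M\<^esub> y) = N +>\<^bsub>M\<^esub> (x \<oplus>\<^bsub>M\<^esub> y)"
proof -
  interpret module R M by fact
  interpret N: abelian_subgroup N M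
    using assms(2) by (intro abelian_subgroupI3 additive_subgroup.intro M.abelian_group_axioms)
      (auto simp: submodule_def)
  show ?thesis using assms N.a_rcos_sum by (simp add: quotient_module_sel)
qed

text \<open>The union over representatives in the definition of the scalar action collapses, since
  multiples of congruent elements are congruent.\<close>

lemma quotient_module_smult:
  assumes "module R M" "submodule N R M" "a \<in> carrier R" "x \<in> carrier M"
  shows "a \<odot>\<^bsub>quotient_module M N\<^esub> (N +>\<^bsub>M\<^esub> x) = N +>\<^bsub>M\<^esub> (a \<odot>\<^bsub>M\<^esub> x)"
proof -
  interpret module R M by fact
  note N = submoduleD[OF assms(2)]
  have "N +>\<^bsub>M\<^esub> (a \<odot>\<^bsub>M\<^esub> y) = N +>\<^bsub>M\<^esub> (a \<odot>\<^bsub>M\<^esub> x)" if "y \<in> N +>\<^bsub>M\<^esub> x" for y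
  proof -
    from that obtain h where h: "h \<in> N" "y = h \<oplus>\<^bsub>M\<^esub> x" by (auto simp: a_r_coset_def')
    have hc: "h \<in> carrier M" by (rule N(2)[OF h(1)])
    then have yc: "y \<in> carrier M" using h(2) assms(4) by simp
    have "a \<odot>\<^bsub>M\<^esub> y \<ominus>\<^bsub>M\<^esub> a \<odot>\<^bsub>M\<^esub> x = a \<odot>\<^bsub>M\<^esub> h"
      unfolding h(2) using assms(3,4) hc by (simp add: smult_r_distr M.add_minus_cancel)
    then have "a \<odot>\<^bsub>M\<^esub> y \<ominus>\<^bsub>M\<^esub> a \<odot>\<^bsub>M\<^esub> x \<in> N" using N(6)[OF assms(3) h(1)] by simp
    then show ?thesis
      by (rule iffD2[OF coset_eq_iff[OF assms(2) smult_closed[OF assms(3) yc] smult_closed[OF assms(3,4)]]])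
  qed
  moreover have "x \<in> N +>\<^bsub>M\<^esub> x"
  proof -
    have "x = \<zero>\<^bsub>M\<^esub> \<oplus>\<^bsub>M\<^esub> x" using assms by simp
    then show ?thesis using N(3) by (auto simp: a_r_coset_def')
  qed
  ultimately have "(\<Union>y\<in>N +>\<^bsub>M\<^esub> x. N +>\<^bsub>M\<^esub> (a \<odot>\<^bsub>M\<^esub> y)) = N +>\<^bsub>M\<^esub> (a \<odot>\<^bsub>M\<^esub> x)"
    by blast
  then show ?thesis by (simp only: quotient_module_sel)
qed

lemma quotient_module_zero:
  assumes "module R M" "submodule N R M" "x \<in> carrier M"
  shows "N +>\<^bsub>M\<^esub> x = \<zero>\<^bsub>quotient_module M N\<^esub> \<longleftrightarrow> x \<in> N"
proof -
  interpret module R M by fact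
  note N = submoduleD[OF assms(2)]
  have "N +>\<^bsub>M\<^esub> \<zero>\<^bsub>M\<^esub> = N" by (rule M.a_coset_add_zero[OF N(1)])
  then show ?thesis
    using coset_eq_iff[OF assms(2,3) M.zero_closed] assms(3) M.add_minus_cancel(1)[OF assms(3) M.zero_closed]
    by (simp add: quotient_module_sel)
qed

lemma module_quotient_module:
  fixes R (structure)
  assumes "module R M" "submodule N R M"
  shows "module R (quotient_module M N)"
proof -
  interpret module R M by fact
  let ?q = "\<lambda>x. N +>\<^bsub>M\<^esub> x" and ?Q = "quotient_module M N"
  note add = quotient_module_add[OF assms] and smult = quotient_module_smult[OF assms]
  have car: "\<exists>x\<in>carrier M. X = ?q x" if "X \<in> carrier ?Q" for X
    using that by (auto simp: quotient_module_sel)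
  have q: "?q x \<in> carrier ?Q" if "x \<in> carrier M" for x
    using that by (auto simp: quotient_module_sel)
  have zero: "\<zero>\<^bsub>?Q\<^esub> = ?q \<zero>\<^bsub>M\<^esub>"
    using quotient_module_zero[OF assms M.zero_closed] submoduleD(3)[OF assms(2)] by simp
  show ?thesis
  proof (rule moduleI)
    show "cring R" by (rule R.cring_axioms)
    show "abelian_group ?Q"
    proof (rule abelian_groupI)
      show "\<zero>\<^bsub>?Q\<^esub> \<in> carrier ?Q" unfolding zero by (rule q) simp
      fix X assume "X \<in> carrier ?Q"
      then obtain x where x: "x \<in> carrier M" "X = ?q x" using car by blast
      show "\<zero>\<^bsub>?Q\<^esub> \<oplus>\<^bsub>?Q\<^esub> X = X" unfolding zero x(2) using x(1) by (simp add: add)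
      show "\<exists>Y\<in>carrier ?Q. Y \<oplus>\<^bsub>?Q\<^esub> X = \<zero>\<^bsub>?Q\<^esub>"
        unfolding zero x(2) using x(1)
        by (intro bexI[of _ "?q (\<ominus>\<^bsub>M\<^esub> x)"]) (simp_all add: add q M.l_neg)
      fix Y assume "Y \<in> carrier ?Q"
      then obtain y where y: "y \<in> carrier M" "Y = ?q y" using car by blast
      show "X \<oplus>\<^bsub>?Q\<^esub> Y \<in> carrier ?Q" using x y by (simp add: add q)
      show "X \<oplus>\<^bsub>?Q\<^esub> Y = Y \<oplus>\<^bsub>?Q\<^esub> X" using x y by (simp add: add M.a_comm)
      fix Z assume "Z \<in> carrier ?Q"
      then obtain z where z: "z \<in> carrier M" "Z = ?q z" using car by blast
      show "(X \<oplus>\<^bsub>?Q\<^esub> Y) \<oplus>\<^bsub>?Q\<^esub> Z = X \<oplus>\<^bsub>?Q\<^esub> (Y \<oplus>\<^bsub>?Q\<^esub> Z)"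
        using x y z by (simp add: add M.a_assoc)
    qed
  next
    fix X assume "X \<in> carrier ?Q"
    then obtain x where x: "x \<in> carrier M" "X = ?q x" using car by blast
    show "\<one> \<odot>\<^bsub>?Q\<^esub> X = X" using x by (simp add: smult)
    fix a assume a: "a \<in> carrier R"
    show "a \<odot>\<^bsub>?Q\<^esub> X \<in> carrier ?Q" using a x by (simp add: smult q)
    {
      fix b assume b: "b \<in> carrier R"
      show "(a \<oplus> b) \<odot>\<^bsub>?Q\<^esub> X = a \<odot>\<^bsub>?Q\<^esub> X \<oplus>\<^bsub>?Q\<^esub> b \<odot>\<^bsub>?Q\<^esub> X"
        using a b x by (simp add: smult add smult_l_distr)
      show "(a \<otimes> b) \<odot>\<^bsub>?Q\<^esub> X = a \<odot>\<^bsub>?Q\<^esub> (b \<odot>\<^bsub>?Q\<^esub> X)"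
        using a b x by (simp add: smult smult_assoc1)
    }
    fix Y assume "Y \<in> carrier ?Q"
    then obtain y where y: "y \<in> carrier M" "Y = ?q y" using car by blast
    show "a \<odot>\<^bsub>?Q\<^esub> (X \<oplus>\<^bsub>?Q\<^esub> Y) = a \<odot>\<^bsub>?Q\<^esub> X \<oplus>\<^bsub>?Q\<^esub> a \<odot>\<^bsub>?Q\<^esub> Y"
      using a x y by (simp add: smult add smult_r_distr)
  qed
qed

lemma quotient_map_hom:
  assumes "module R M" "submodule N R M"
  shows "(\<lambda>x. N +>\<^bsub>M\<^esub> x) \<in> module_hom R M (quotient_module M N)"
  by (rule module_homI)
     (simp_all add: quotient_module_add[OF assms] quotient_module_smult[OF assms],
      simp add: quotient_module_sel)

lemma lcomb_carrier_update [simp]: "lcomb R (M\<lparr>carrier := S\<rparr>) A es = lcomb R M A es"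
  by (induction es) simp_all

section \<open>Torsion with respect to a pair of ideals\<close>

text \<open>The ideals \<open>a\<close> such that \<open>R/a\<close> is \<open>(I, J)\<close>-torsion.\<close>

definition torsion_ideal :: "('r, 'q) ring_scheme \<Rightarrow> 'r set \<Rightarrow> 'r set \<Rightarrow> 'r set \<Rightarrow> bool"
  where "torsion_ideal R I J a \<longleftrightarrow>
    (\<exists>N. \<forall>n\<ge>N. \<forall>r\<in>ideal_pow R I n. \<exists>s\<in>J. r \<ominus>\<^bsub>R\<^esub> s \<in> a)"

lemma torsion_ideal_mono: "torsion_ideal R I J a \<Longrightarrow> a \<subseteq> b \<Longrightarrow> torsion_ideal R I J b"
  unfolding torsion_ideal_def by blast

section \<open>Powers of ideals and intersections of torsion ideals\<close>

context cring
begin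

lemma ideal_pow_ideal: "ideal I R \<Longrightarrow> ideal (ideal_pow R I n) R"
proof -
  interpret S: comm_monoid "ideals_set R" by (rule ideals_set_is_comm_monoid)
  assume "ideal I R"
  then have "I \<in> carrier (ideals_set R)" by (simp add: ideals_set_def)
  then have "ideal_pow R I n \<in> carrier (ideals_set R)" by (rule S.nat_pow_closed)
  then show ?thesis by (simp add: ideals_set_def)
qed

lemma ideal_pow_add: "ideal I R \<Longrightarrow> ideal_pow R I (m + n) = ideal_pow R I m \<cdot> ideal_pow R I n"
proof -
  interpret S: comm_monoid "ideals_set R" by (rule ideals_set_is_comm_monoid)
  assume "ideal I R"
  then have "I \<in> carrier (ideals_set R)" by (simp add: ideals_set_def)
  from S.nat_pow_mult[OF this, of m n]
  show ?thesis by (simp add: ideals_set_def)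
qed

lemma ideal_pow_0: "ideal_pow R I 0 = carrier R"
  by (simp add: ideals_set_def)

lemma ideal_pow_1: "ideal I R \<Longrightarrow> ideal_pow R I 1 = I"
proof -
  interpret S: comm_monoid "ideals_set R" by (rule ideals_set_is_comm_monoid)
  assume "ideal I R"
  then have "I \<in> carrier (ideals_set R)" by (simp add: ideals_set_def)
  then show ?thesis by (rule S.nat_pow_eone)
qed

text \<open>Split a high power of \<open>I\<close> into two factors, one approximated by
  \<open>J\<close> modulo \<open>a\<close> and the other modulo \<open>b\<close>. The product of the
  two errors lies in both ideals. This makes torsion elements closed under addition.\<close>

lemma torsion_ideal_Int:
  assumes I: "ideal I R" and J: "ideal J R" and a: "ideal a R" and b: "ideal b R"
    and "torsion_ideal R I J a" "torsion_ideal R I J b"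
  shows "torsion_ideal R I J (a \<inter> b)"
proof -
  note J' = idealD[OF J] and a' = idealD[OF a] and b' = idealD[OF b]
  obtain m where m: "\<And>r. r \<in> ideal_pow R I m \<Longrightarrow> \<exists>s\<in>J. r \<ominus> s \<in> a"
    using assms(5) unfolding torsion_ideal_def by blast
  obtain k where k: "\<And>n r. n \<ge> k \<Longrightarrow> r \<in> ideal_pow R I n \<Longrightarrow> \<exists>s\<in>J. r \<ominus> s \<in> b"
    using assms(6) unfolding torsion_ideal_def by blast
  have "\<exists>s\<in>J. r \<ominus> s \<in> a \<inter> b" if n: "n \<ge> m + k" and r: "r \<in> ideal_pow R I n" for n r
  proof -
    have "r \<in> ideal_pow R I m \<cdot> ideal_pow R I (n - m)"
      using r n ideal_pow_add[OF I, of m "n - m"] by simp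
    then show ?thesis
    proof (induction rule: ideal_prod.induct)
      case (prod x y)
      have kn: "k \<le> n - m" using n by simp
      obtain s where s: "s \<in> J" "x \<ominus> s \<in> a" using m[OF prod(1)] by blast
      obtain s' where s': "s' \<in> J" "y \<ominus> s' \<in> b" using k[OF kn prod(2)] by blast
      have c: "x \<in> carrier R" "y \<in> carrier R" "s \<in> carrier R" "s' \<in> carrier R"
        using prod s s' J'(1) idealD(1)[OF ideal_pow_ideal[OF I]] by blast+
      \<comment> \<open>Read off from the expansion of (x - s)(y - s'): it is what must be
        subtracted from the product of \<open>x\<close> and \<open>y\<close>, and each of its terms
        has a factor in \<open>J\<close>.\<close>
      let ?s = "s \<otimes> y \<oplus> (x \<ominus> s) \<otimes> s'"
      have "?s \<in> J"
        using J'(5)[OF c(2) s(1)] J'(5)[OF _ s'(1), of "x \<ominus> s"] c J'(3) m_comm by simp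
      moreover have "x \<otimes> y \<ominus> ?s = (x \<ominus> s) \<otimes> (y \<ominus> s')" using c by algebra
      moreover have "(x \<ominus> s) \<otimes> (y \<ominus> s') \<in> a"
        using a'(5)[OF _ s(2), of "y \<ominus> s'"] c m_comm by simp
      moreover have "(x \<ominus> s) \<otimes> (y \<ominus> s') \<in> b"
        using b'(5)[OF _ s'(2), of "x \<ominus> s"] c by simp
      ultimately show ?case by (intro bexI[of _ ?s]) simp_all
    next
      case (sum x y)
      then obtain s s' where s: "s \<in> J" "x \<ominus> s \<in> a \<inter> b" "s' \<in> J" "y \<ominus> s' \<in> a \<inter> b" by blast
      have c: "x \<in> carrier R" "y \<in> carrier R" "s \<in> carrier R" "s' \<in> carrier R"
        using sum(1,2) s J'(1) ideal_prod_in_carrier[OF ideal_pow_ideal[OF I] ideal_pow_ideal[OF I]]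
        by blast+
      have "(x \<oplus> y) \<ominus> (s \<oplus> s') = (x \<ominus> s) \<oplus> (y \<ominus> s')" using c by (rule add_minus_add)
      then show ?case using s J'(3) a'(3) b'(3) by (intro bexI[of _ "s \<oplus> s'"]) auto
    qed
  qed
  then show ?thesis unfolding torsion_ideal_def by blast
qed

end

section \<open>Annihilators of elements and the torsion submodule\<close>

definition annihilator :: "('r, 'q) ring_scheme \<Rightarrow> ('r, 'm, 'x) module_scheme \<Rightarrow> 'm \<Rightarrow> 'r set"
  where "annihilator R M x = {a \<in> carrier R. a \<odot>\<^bsub>M\<^esub> x = \<zero>\<^bsub>M\<^esub>}"

lemma annihilator_hom:
  assumes "module R A" "module R B" "f \<in> module_hom R A B" "x \<in> carrier A"
  shows "annihilator R A x \<subseteq> annihilator R B (f x)"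
  using module_homD(3)[OF assms(3) _ assms(4)] module_hom_zero[OF assms(1-3)]
  unfolding annihilator_def by fastforce

text \<open>Two scalars agree on \<open>x\<close> exactly when their difference kills
  \<open>x\<close>. Torsion of \<open>x\<close> is therefore a condition on its annihilator alone,
  and it is inherited by larger annihilators.\<close>

lemma pair_torsion_carrier:
  assumes "module R M" "ideal I R" "ideal J R"
  shows "carrier (pair_torsion R I J M) =
    {x \<in> carrier M. torsion_ideal R I J (annihilator R M x)}"
proof -
  interpret module R M by fact
  have "(\<lambda>a. a \<odot>\<^bsub>M\<^esub> x) ` ideal_pow R I n \<subseteq> (\<lambda>a. a \<odot>\<^bsub>M\<^esub> x) ` J \<longleftrightarrow>
      (\<forall>r\<in>ideal_pow R I n. \<exists>s\<in>J. r \<ominus>\<^bsub>R\<^esub> s \<in> annihilator R M x)" if x: "x \<in> carrier M" for x n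
  proof -
    have "r \<odot>\<^bsub>M\<^esub> x = s \<odot>\<^bsub>M\<^esub> x \<longleftrightarrow> r \<ominus>\<^bsub>R\<^esub> s \<in> annihilator R M x"
      if "r \<in> ideal_pow R I n" "s \<in> J" for r s
    proof -
      have "r \<in> carrier R" "s \<in> carrier R"
        using that idealD(1)[OF R.ideal_pow_ideal[OF assms(2)]] idealD(1)[OF assms(3)] by blast+
      then show ?thesis
        using x by (simp add: annihilator_def smult_minus_left M.minus_eq_zero_iff)
    qed
    then show ?thesis by (auto simp: image_subset_iff image_iff)
  qed
  then show ?thesis by (simp add: pair_torsion_def torsion_ideal_def cong: conj_cong)
qed

lemma submodule_pair_torsion:
  assumes "module R M" "ideal I R" "ideal J R"
  shows "submodule (carrier (pair_torsion R I J M)) R M"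
proof -
  interpret module R M by fact
  note car = pair_torsion_carrier[OF assms]
  have ann: "ideal (annihilator R M x) R" if "x \<in> carrier M" for x
    unfolding annihilator_def by (rule annihilator_ideal[OF that])
  show ?thesis
  proof (rule submoduleI2)
    show "carrier (pair_torsion R I J M) \<subseteq> carrier M" using car by auto
    have "r \<ominus>\<^bsub>R\<^esub> \<zero>\<^bsub>R\<^esub> \<in> annihilator R M \<zero>\<^bsub>M\<^esub>" if "r \<in> ideal_pow R I n" for r n
    proof -
      have "r \<in> carrier R" using that idealD(1)[OF R.ideal_pow_ideal[OF assms(2)]] by blast
      then show ?thesis by (simp add: annihilator_def)
    qed
    then have "torsion_ideal R I J (annihilator R M \<zero>\<^bsub>M\<^esub>)"
      unfolding torsion_ideal_def using idealD(2)[OF assms(3)] by blast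
    then show "\<zero>\<^bsub>M\<^esub> \<in> carrier (pair_torsion R I J M)" using car by auto
  next
    fix x y assume "x \<in> carrier (pair_torsion R I J M)" "y \<in> carrier (pair_torsion R I J M)"
    then have x: "x \<in> carrier M" "torsion_ideal R I J (annihilator R M x)"
      and y: "y \<in> carrier M" "torsion_ideal R I J (annihilator R M y)" using car by auto
    have "torsion_ideal R I J (annihilator R M x \<inter> annihilator R M y)"
      by (rule R.torsion_ideal_Int[OF assms(2,3) ann[OF x(1)] ann[OF y(1)] x(2) y(2)])
    then have "torsion_ideal R I J (annihilator R M (x \<oplus>\<^bsub>M\<^esub> y))"
      by (rule torsion_ideal_mono) (use x(1) y(1) in \<open>auto simp: annihilator_def smult_r_distr\<close>)
    then show "x \<oplus>\<^bsub>M\<^esub> y \<in> carrier (pair_torsion R I J M)" using car x y by auto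
  next
    fix a x assume a: "a \<in> carrier R" and "x \<in> carrier (pair_torsion R I J M)"
    then have x: "x \<in> carrier M" "torsion_ideal R I J (annihilator R M x)" using car by auto
    have "torsion_ideal R I J (annihilator R M (a \<odot>\<^bsub>M\<^esub> x))"
      by (rule torsion_ideal_mono[OF x(2)]) (use a x(1) in \<open>auto simp: annihilator_def smult_comm[of _ a]\<close>)
    then show "a \<odot>\<^bsub>M\<^esub> x \<in> carrier (pair_torsion R I J M)" using car a x by auto
  qed
qed

text \<open>A homomorphism can only enlarge annihilators. In particular, maps obtained by extension
  into an injective module still preserve torsion.\<close>

lemma pair_torsion_hom:
  assumes "module R A" "module R B" "f \<in> module_hom R A B" "ideal I R" "ideal J R"
    and "x \<in> carrier (pair_torsion R I J A)"
  shows "f x \<in> carrier (pair_torsion R I J B)"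
  using assms(6) module_homD(1)[OF assms(3)] torsion_ideal_mono[OF _ annihilator_hom[OF assms(1-3)]]
  unfolding pair_torsion_carrier[OF assms(1,4,5)] pair_torsion_carrier[OF assms(2,4,5)] by blast

section \<open>The lowest nonvanishing local cohomology module\<close>

locale pair_complex = injective_complex R Q d
  for R :: "('r, 'q) ring_scheme" (structure) and Q :: "nat \<Rightarrow> ('r, 'i) module" and d +
  fixes I J :: "'r set"
  assumes I: "ideal I R" and J: "ideal J R"
begin

abbreviation "T i \<equiv> carrier (pair_torsion R I J (Q i))"

lemmas T_eq = pair_torsion_carrier[OF Q_module I J]
  and submodule_T = submodule_pair_torsion[OF Q_module I J]
  and T_hom = pair_torsion_hom[OF Q_module Q_module _ I J]

lemmas T_D = Q.submoduleD[OF submodule_T]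

text \<open>This places the complex that computes Ext of R/a inside the torsion complex, so the
  cocycles of both can be compared directly.\<close>

lemma annihilated_T: "torsion_ideal R I J a \<Longrightarrow> ideal a R \<Longrightarrow> annihilated R (Q i) a \<subseteq> T i"
proof
  fix x assume a: "torsion_ideal R I J a" "ideal a R" and x: "x \<in> annihilated R (Q i) a"
  have "a \<subseteq> annihilator R (Q i) x"
    using idealD(1)[OF a(2)] x by (auto simp: annihilator_def annihilated_def)
  then show "x \<in> T i" using torsion_ideal_mono[OF a(1)] annihilatedD(1)[OF x] by (simp add: T_eq)
qed

definition Z :: "nat \<Rightarrow> 'i set"
  where "Z i = {x \<in> T i. d i x = \<zero>\<^bsub>Q (Suc i)\<^esub>}"

definition B :: "nat \<Rightarrow> 'i set"
  where "B i = (case i of 0 \<Rightarrow> {\<zero>\<^bsub>Q 0\<^esub>} | Suc j \<Rightarrow> d j ` T j)"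

lemma submodule_Z: "submodule (Z i) R (Q i)"
proof -
  have "Z i = T i \<inter> {z \<in> carrier (Q i). d i z = \<zero>\<^bsub>Q (Suc i)\<^esub>}"
    using T_D(2) by (auto simp: Z_def)
  then show ?thesis using Q.submodule_Int[OF submodule_T submodule_kernel] by simp
qed

lemma submodule_B: "submodule (B i) R (Q i)"
proof (cases i)
  case 0
  show ?thesis unfolding 0 B_def by (rule Q.submoduleI2) auto
next
  case (Suc j)
  have "submodule (d j ` carrier ((Q j)\<lparr>carrier := T j\<rparr>)) R (Q (Suc j))"
    by (rule module_hom_image_submodule[OF Q.submodule_module[OF submodule_T] Q_module])
       (rule module_hom_restrict[OF d_hom T_D(1)])
  then show ?thesis by (simp add: Suc B_def)
qed

lemma B_subset_Z: "B i \<subseteq> Z i"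
proof (cases i)
  case 0
  then show ?thesis using T_D(3) d_zero by (auto simp: B_def Z_def)
next
  case (Suc j)
  then show ?thesis using T_D(2) T_hom[OF d_hom] d_d by (auto simp: B_def Z_def)
qed

lemma pair_local_cohomology_eq:
  "pair_local_cohomology R I J Q d i = quotient_module ((Q i)\<lparr>carrier := Z i\<rparr>) (B i)"
proof -
  have "a_kernel (pair_torsion R I J (Q i)) (pair_torsion R I J (Q (Suc i))) (d i) = Z i"
    by (simp add: a_kernel_def' Z_def) (simp add: pair_torsion_def)
  moreover have "(case i of 0 \<Rightarrow> {\<zero>\<^bsub>pair_torsion R I J (Q 0)\<^esub>}
      | Suc j \<Rightarrow> d j ` carrier (pair_torsion R I J (Q j))) = B i"
    by (cases i) (simp_all add: B_def, simp add: pair_torsion_def)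
  ultimately show ?thesis
    by (simp add: pair_local_cohomology_def cochain_cohomology_def) (simp add: pair_torsion_def)
qed

text \<open>If the torsion complex is exact below degree \<open>t\<close>, its coboundaries up to degree \<open>t\<close> are
  direct summands: \<open>T i\<close> is injective relative to torsion modules, and hence so are
  \<open>B 0, \<dots>, B t\<close>.\<close>

lemma torsion_retraction:
  assumes "\<And>i. i < t \<Longrightarrow> Z i \<subseteq> B i" and "i \<le> t"
  shows "\<exists>\<rho>\<in>module_hom R ((Q i)\<lparr>carrier := T i\<rparr>) (Q i).
    (\<forall>x\<in>T i. \<rho> x \<in> B i) \<and> (\<forall>x\<in>B i. \<rho> x = x)"
  using assms(2)
proof (induction i)
  case 0
  have "(\<lambda>_. \<zero>\<^bsub>Q 0\<^esub>) \<in> module_hom R ((Q 0)\<lparr>carrier := T 0\<rparr>) (Q 0)"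
    by (rule module_homI) auto
  then show ?case by (rule bexI[rotated]) (auto simp: B_def)
next
  case (Suc i)
  then obtain \<rho> where \<rho>: "\<rho> \<in> module_hom R ((Q i)\<lparr>carrier := T i\<rparr>) (Q i)"
    "\<And>x. x \<in> T i \<Longrightarrow> \<rho> x \<in> B i" "\<And>x. x \<in> B i \<Longrightarrow> \<rho> x = x" by auto
  have ZB: "Z i \<subseteq> B i" using assms(1) Suc.prems by simp
  note \<rho>' = module_homD[OF \<rho>(1), simplified]
  \<comment> \<open>As \<open>Z i\<close> equals \<open>B i\<close>, the map \<open>\<delta>\<close>
    vanishes on the kernel of \<open>d i\<close>, and it has the same differential as the identity.
    It therefore factors through \<open>d i\<close>, and the factor \<open>\<sigma>\<close> is a
    section of \<open>d i\<close> over \<open>B (Suc i)\<close>.\<close>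
  define \<delta> where "\<delta> x = x \<ominus>\<^bsub>Q i\<^esub> \<rho> x" for x
  have T_module: "module R ((Q i)\<lparr>carrier := T i\<rparr>)" for i by (rule Q.submodule_module[OF submodule_T])
  have \<delta>: "\<delta> x \<in> carrier (Q i)" "d i (\<delta> x) = d i x" if "x \<in> T i" for x
  proof -
    have c: "x \<in> carrier (Q i)" "\<rho> x \<in> carrier (Q i)" using \<rho>'(1) T_D(2) that by auto
    then show "\<delta> x \<in> carrier (Q i)" by (simp add: \<delta>_def)
    have "d i (\<rho> x) = \<zero>\<^bsub>Q (Suc i)\<^esub>" using \<rho>(2)[OF that] B_subset_Z by (auto simp: Z_def)
    then show "d i (\<delta> x) = d i x" using c by (simp add: \<delta>_def d_minus) (simp add: a_minus_def d_closed)
  qed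
  have "\<delta> \<in> module_hom R ((Q i)\<lparr>carrier := T i\<rparr>) (Q i)"
    using \<delta>(1) T_D(2) \<rho>'
    by (intro module_homI) (simp_all add: \<delta>_def Q.M.add_minus_add Q.smult_minus_right)
  moreover have "\<delta> x = \<zero>\<^bsub>Q i\<^esub>" if "x \<in> T i" "d i x = \<zero>\<^bsub>Q (Suc i)\<^esub>" for x
    using that ZB \<rho>(3)[of x] T_D(2)[OF that(1)] by (auto simp: Z_def \<delta>_def Q.M.minus_eq_zero_iff)
  ultimately have "\<exists>\<sigma>\<in>module_hom R ((Q (Suc i))\<lparr>carrier := B (Suc i)\<rparr>) (Q i).
      \<forall>c\<in>T i. \<sigma> (d i c) = \<delta> c"
    using module_hom_factor[OF T_module Q_module Q_module module_hom_restrict[OF d_hom T_D(1)], of \<delta> i]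
    by (simp add: B_def)
  then obtain \<sigma> where \<sigma>_hom: "\<sigma> \<in> module_hom R ((Q (Suc i))\<lparr>carrier := B (Suc i)\<rparr>) (Q i)"
    and \<sigma>: "\<And>c. c \<in> T i \<Longrightarrow> \<sigma> (d i c) = \<delta> c" by blast
  have BE: "\<exists>c\<in>T i. y = d i c" if "y \<in> B (Suc i)" for y using that by (auto simp: B_def)
  \<comment> \<open>The extension has values in \<open>Q i\<close>, where injectivity is available.
    Its restriction to torsion elements lands in \<open>T i\<close>, so composing with
    \<open>d i\<close> gives a retraction onto \<open>B (Suc i)\<close>.\<close>
  from injective_module_extend[OF inj Q_module submodule_B \<sigma>_hom]
  obtain \<tau> where \<tau>: "\<tau> \<in> module_hom R (Q (Suc i)) (Q i)" "\<And>x. x \<in> B (Suc i) \<Longrightarrow> \<tau> x = \<sigma> x"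
    by blast
  note \<tau>' = module_homD[OF \<tau>(1)]
  have "(\<lambda>x. d i (\<tau> x)) \<in> module_hom R ((Q (Suc i))\<lparr>carrier := T (Suc i)\<rparr>) (Q (Suc i))"
    by (rule module_homI) (simp_all add: T_D(2) \<tau>' d_closed d_add d_smult)
  moreover have "d i (\<tau> x) \<in> B (Suc i)" if "x \<in> T (Suc i)" for x
    using T_hom[OF \<tau>(1) that] by (simp add: B_def)
  moreover have "d i (\<tau> x) = x" if x: "x \<in> B (Suc i)" for x
  proof -
    obtain c where c: "c \<in> T i" "x = d i c" using BE[OF x] by blast
    then show ?thesis using \<tau>(2)[OF x] \<sigma> \<delta>(2) by simp
  qed
  ultimately show ?case by (intro bexI[of _ "\<lambda>x. d i (\<tau> x)"]) auto
qed

lemma cohomology_vanishes: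
  assumes "carrier (pair_local_cohomology R I J Q d i) = {\<zero>\<^bsub>pair_local_cohomology R I J Q d i\<^esub>}"
  shows "Z i \<subseteq> B i"
proof
  let ?Z = "(Q i)\<lparr>carrier := Z i\<rparr>"
  have Zm: "module R ?Z" by (rule Q.submodule_module[OF submodule_Z])
  have Bsub: "submodule (B i) R ?Z"
    using B_subset_Z Q.submodule_module[OF submodule_B]
    by (intro module.module_incl_imp_submodule[OF Zm]) auto
  fix z assume z: "z \<in> Z i"
  then have "B i +>\<^bsub>?Z\<^esub> z = \<zero>\<^bsub>quotient_module ?Z (B i)\<^esub>"
    using assms unfolding pair_local_cohomology_eq by (auto simp: quotient_module_sel)
  then show "z \<in> B i" using quotient_module_zero[OF Zm Bsub] z by simp
qed

text \<open>Surjectivity of the map from Ext of R/a to the classes killed by \<open>a\<close>: the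
  retraction corrects a representative of such a class to a cocycle which is itself killed by
  \<open>a\<close>. Generators of Ext then give the required classes.\<close>

lemma cohomology_cofinite:
  fixes t :: nat
  defines "H \<equiv> pair_local_cohomology R I J Q d t"
  assumes "\<And>i. i < t \<Longrightarrow> Z i \<subseteq> B i"
  shows "module R H"
    and "\<And>X. X \<in> carrier H \<Longrightarrow> \<exists>ys. set ys \<subseteq> annihilated R H (annihilator R H X) \<and>
      annihilated R H (annihilator R H X) \<subseteq> lcomb R H (carrier R) ys"
proof -
  let ?Z = "(Q t)\<lparr>carrier := Z t\<rparr>"
  let ?p = "\<lambda>z. B t +>\<^bsub>?Z\<^esub> z"
  have H: "H = quotient_module ?Z (B t)" unfolding H_def by (rule pair_local_cohomology_eq)
  have Zm: "module R ?Z" by (rule Q.submodule_module[OF submodule_Z])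
  have Bsub: "submodule (B t) R ?Z"
    using B_subset_Z Q.submodule_module[OF submodule_B]
    by (intro module.module_incl_imp_submodule[OF Zm]) auto
  show Hm: "module R H" unfolding H by (rule module_quotient_module[OF Zm Bsub])
  interpret H: module R H by (rule Hm)
  have p: "?p \<in> module_hom R ?Z H" unfolding H by (rule quotient_map_hom[OF Zm Bsub])
  note pD = module_homD[OF p, simplified]
  have p0: "?p z = \<zero>\<^bsub>H\<^esub> \<longleftrightarrow> z \<in> B t" if "z \<in> Z t" for z
    using quotient_module_zero[OF Zm Bsub] that unfolding H by simp
  have pE: "\<exists>z\<in>Z t. X = ?p z" if "X \<in> carrier H" for X
    using that unfolding H by (auto simp: quotient_module_sel)
  note ZD = Q.submoduleD[OF submodule_Z[of t]] and BD = Q.submoduleD[OF submodule_B[of t]]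
  obtain \<rho> where \<rho>: "\<rho> \<in> module_hom R ((Q t)\<lparr>carrier := T t\<rparr>) (Q t)"
    "\<And>x. x \<in> T t \<Longrightarrow> \<rho> x \<in> B t" "\<And>x. x \<in> B t \<Longrightarrow> \<rho> x = x"
    using torsion_retraction[OF assms(2) order_refl] by blast
  note \<rho>' = module_homD[OF \<rho>(1), simplified]
  fix X assume X: "X \<in> carrier H"
  define a where "a = annihilator R H X"
  have a: "ideal a R" unfolding a_def annihilator_def by (rule H.annihilator_ideal[OF X])
  \<comment> \<open>\<open>X\<close> has a torsion representative, and passing to its class only
    enlarges the annihilator.\<close>
  have tors: "torsion_ideal R I J a"
  proof -
    obtain x where x: "x \<in> Z t" "X = ?p x" using pE[OF X] by blast
    have "torsion_ideal R I J (annihilator R (Q t) x)" using x(1) by (simp add: Z_def T_eq)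
    moreover have "annihilator R (Q t) x \<subseteq> a"
      using annihilator_hom[OF Zm Hm p, of x] x unfolding a_def by (simp add: annihilator_def)
    ultimately show ?thesis by (rule torsion_ideal_mono)
  qed
  obtain fs where fs: "set fs \<subseteq> cocycles t a"
    "\<And>z. z \<in> cocycles t a \<Longrightarrow> \<exists>v\<in>lcomb R (Q t) (carrier R) fs. \<exists>u\<in>coboundaries t a. z = v \<oplus>\<^bsub>Q t\<^esub> u"
    using finite_Ext_ideal[OF a, of t] unfolding finite_Ext_def by meson
  note aT = annihilated_T[OF tors a]
  have cocZ: "cocycles t a \<subseteq> Z t" using aT by (auto simp: cocycles_def Z_def)
  have cobB: "coboundaries t a \<subseteq> B t" using aT by (cases t) (auto simp: coboundaries_def B_def)
  have fsZ: "set fs \<subseteq> Z t" using fs(1) cocZ by blast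
  show "\<exists>ys. set ys \<subseteq> annihilated R H a \<and> annihilated R H a \<subseteq> lcomb R H (carrier R) ys"
  proof (intro exI[of _ "map ?p fs"] conjI subsetI)
    fix Y assume "Y \<in> set (map ?p fs)"
    then obtain f where f: "f \<in> set fs" "Y = ?p f" by auto
    have "f \<in> annihilated R ?Z a" using fs(1) f(1) fsZ by (auto simp: cocycles_def annihilated_def)
    then show "Y \<in> annihilated R H a"
      unfolding f(2) by (rule module_hom_annihilated[OF Zm Hm p idealD(1)[OF a]])
  next
    fix Y assume Y: "Y \<in> annihilated R H a"
    obtain z where z: "z \<in> Z t" "Y = ?p z" using pE[OF annihilatedD(1)[OF Y]] by blast
    have zT: "z \<in> T t" using z(1) by (simp add: Z_def)
    have zc: "z \<in> carrier (Q t)" "\<rho> z \<in> carrier (Q t)" using T_D(2) zT \<rho>'(1) by auto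
    \<comment> \<open>For \<open>r\<close> in \<open>a\<close> the multiple of \<open>z\<close> by
      \<open>r\<close> lies in \<open>B t\<close>, where \<open>\<rho>\<close> is the identity.
      Hence \<open>r\<close> acts alike on \<open>z\<close> and on \<open>\<rho> z\<close>, and it
      kills their difference.\<close>
    define z' where "z' = z \<ominus>\<^bsub>Q t\<^esub> \<rho> z"
    have "z' \<in> annihilated R (Q t) a"
    proof (rule annihilatedI)
      show "z' \<in> carrier (Q t)" using zc by (simp add: z'_def)
      fix r assume r: "r \<in> a"
      have rc: "r \<in> carrier R" using idealD(1)[OF a] r by blast
      have "?p (r \<odot>\<^bsub>Q t\<^esub> z) = \<zero>\<^bsub>H\<^esub>" using pD(3)[OF rc z(1)] annihilatedD(2)[OF Y r] z(2) by simp
      then have "r \<odot>\<^bsub>Q t\<^esub> z \<in> B t" using p0 ZD(6)[OF rc z(1)] by simp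
      then have "r \<odot>\<^bsub>Q t\<^esub> z = r \<odot>\<^bsub>Q t\<^esub> \<rho> z" using \<rho>(3) \<rho>'(3)[OF rc zT] by simp
      then show "r \<odot>\<^bsub>Q t\<^esub> z' = \<zero>\<^bsub>Q t\<^esub>"
        using rc zc by (simp add: z'_def Q.smult_minus_right Q.M.minus_eq_zero_iff)
    qed
    moreover have \<rho>z: "\<rho> z \<in> Z t" using \<rho>(2)[OF zT] B_subset_Z by blast
    have "z' \<in> Z t" unfolding z'_def by (rule ZD(5)[OF z(1) \<rho>z])
    ultimately have "z' \<in> cocycles t a" by (simp add: cocycles_def Z_def)
    from fs(2)[OF this] obtain v u where vu: "v \<in> lcomb R (Q t) (carrier R) fs" "u \<in> coboundaries t a"
      "z' = v \<oplus>\<^bsub>Q t\<^esub> u" by blast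
    have uB: "u \<in> B t" "u \<in> Z t" using vu(2) cobB B_subset_Z by blast+
    have vZ: "v \<in> Z t" using Q.span_minimal[OF submodule_Z fsZ] vu(1) by blast
    have "z = v \<oplus>\<^bsub>Q t\<^esub> (u \<oplus>\<^bsub>Q t\<^esub> \<rho> z)"
      using vu(3) zc ZD(2)[OF uB(2)] ZD(2)[OF vZ] Q.M.minus_add_cancel(1)[OF zc]
      by (simp add: z'_def Q.M.a_assoc)
    moreover have uz: "u \<oplus>\<^bsub>Q t\<^esub> \<rho> z \<in> B t" by (rule BD(4)[OF uB(1) \<rho>(2)[OF zT]])
    ultimately have "Y = ?p v \<oplus>\<^bsub>H\<^esub> ?p (u \<oplus>\<^bsub>Q t\<^esub> \<rho> z)"
      using z(2) pD(2)[OF vZ, of "u \<oplus>\<^bsub>Q t\<^esub> \<rho> z"] B_subset_Z by auto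
    also have "?p (u \<oplus>\<^bsub>Q t\<^esub> \<rho> z) = \<zero>\<^bsub>H\<^esub>" using p0 uz B_subset_Z by blast
    finally have "Y = ?p v" using pD(1)[OF vZ] by simp
    moreover have "?p v \<in> lcomb R H (carrier R) (map ?p fs)"
      using lcomb_map(1)[OF Zm p Q.R.oneideal _ Hm, of fs] fsZ vu(1) by simp
    ultimately show "Y \<in> lcomb R H (carrier R) (map ?p fs)" by simp
  qed
qed

end

section \<open>Hom modules and Matlis duals\<close>

lemma Hom_module_sel:
  "carrier (Hom_module R A B) = module_hom R A B \<inter> extensional (carrier A)"
  "zero (Hom_module R A B) = (\<lambda>x\<in>carrier A. \<zero>\<^bsub>B\<^esub>)"
  "add (Hom_module R A B) f g = (\<lambda>x\<in>carrier A. f x \<oplus>\<^bsub>B\<^esub> g x)"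
  "smult (Hom_module R A B) a f = (\<lambda>x\<in>carrier A. a \<odot>\<^bsub>B\<^esub> f x)"
  by (simp_all add: Hom_module_def)

lemma restrict_Hom_module:
  assumes "module R A" "f \<in> module_hom R A B"
  shows "restrict f (carrier A) \<in> carrier (Hom_module R A B)"
proof -
  interpret module R A by fact
  show ?thesis
    using module_homD[OF assms(2)] by (auto simp: Hom_module_sel intro!: module_homI)
qed

lemma Hom_module_eqI:
  assumes "f \<in> carrier (Hom_module R A B)" "g \<in> carrier (Hom_module R A B)"
    and "\<And>x. x \<in> carrier A \<Longrightarrow> f x = g x"
  shows "f = g"
  using assms by (auto simp: Hom_module_sel intro: extensionalityI)

lemma Hom_module_closed:
  fixes R (structure)
  assumes "module R A" "module R B"
  shows "f \<in> carrier (Hom_module R A B) \<Longrightarrow> g \<in> carrier (Hom_module R A B) \<Longrightarrow>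
      f \<oplus>\<^bsub>Hom_module R A B\<^esub> g \<in> carrier (Hom_module R A B)"
    and "a \<in> carrier R \<Longrightarrow> f \<in> carrier (Hom_module R A B) \<Longrightarrow>
      a \<odot>\<^bsub>Hom_module R A B\<^esub> f \<in> carrier (Hom_module R A B)"
    and "\<zero>\<^bsub>Hom_module R A B\<^esub> \<in> carrier (Hom_module R A B)"
proof -
  interpret A: module R A by fact
  interpret B: module R B by fact
  show "f \<oplus>\<^bsub>Hom_module R A B\<^esub> g \<in> carrier (Hom_module R A B)"
    if "f \<in> carrier (Hom_module R A B)" "g \<in> carrier (Hom_module R A B)"
  proof -
    have "(\<lambda>x. f x \<oplus>\<^bsub>B\<^esub> g x) \<in> module_hom R A B"
      using that module_homD[of f R A B] module_homD[of g R A B]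
      by (intro module_homI) (simp_all add: Hom_module_sel B.M.a_ac B.smult_r_distr)
    then show ?thesis
      using restrict_Hom_module[OF assms(1), of "\<lambda>x. f x \<oplus>\<^bsub>B\<^esub> g x" B] by (simp add: Hom_module_sel(3))
  qed
  show "a \<odot>\<^bsub>Hom_module R A B\<^esub> f \<in> carrier (Hom_module R A B)"
    if "a \<in> carrier R" "f \<in> carrier (Hom_module R A B)"
  proof -
    have "(\<lambda>x. a \<odot>\<^bsub>B\<^esub> f x) \<in> module_hom R A B"
      using that module_homD[of f R A B]
      by (intro module_homI) (simp_all add: Hom_module_sel B.smult_r_distr B.smult_comm[of a])
    then show ?thesis
      using restrict_Hom_module[OF assms(1), of "\<lambda>x. a \<odot>\<^bsub>B\<^esub> f x" B] by (simp add: Hom_module_sel(4))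
  qed
  have "(\<lambda>x. \<zero>\<^bsub>B\<^esub>) \<in> module_hom R A B" by (rule module_homI) auto
  then show "\<zero>\<^bsub>Hom_module R A B\<^esub> \<in> carrier (Hom_module R A B)"
    using restrict_Hom_module[OF assms(1), of "\<lambda>x. \<zero>\<^bsub>B\<^esub>" B] by (simp add: Hom_module_sel(2))
qed

lemma module_Hom_module:
  fixes R (structure)
  assumes "module R A" "module R B"
  shows "module R (Hom_module R A B)"
proof -
  interpret A: module R A by fact
  interpret B: module R B by fact
  let ?D = "Hom_module R A B"
  note cl = Hom_module_closed[OF assms]
  have val: "f x \<in> carrier B" if "f \<in> carrier ?D" "x \<in> carrier A" for f x
    using that module_homD(1)[of f R A B] by (simp add: Hom_module_sel)
  note sel = Hom_module_sel(2-)
  show ?thesis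
  proof (rule moduleI)
    show "cring R" by (rule A.R.cring_axioms)
    show "abelian_group ?D"
    proof (rule abelian_groupI)
      fix f assume f: "f \<in> carrier ?D"
      show "\<zero>\<^bsub>?D\<^esub> \<oplus>\<^bsub>?D\<^esub> f = f"
        by (rule Hom_module_eqI[OF cl(1)[OF cl(3) f] f]) (simp add: sel val f)
      have m: "(\<ominus> \<one>) \<odot>\<^bsub>?D\<^esub> f \<in> carrier ?D" using f by (intro cl) auto
      moreover have "(\<ominus> \<one>) \<odot>\<^bsub>?D\<^esub> f \<oplus>\<^bsub>?D\<^esub> f = \<zero>\<^bsub>?D\<^esub>"
        by (rule Hom_module_eqI[OF cl(1)[OF m f] cl(3)])
           (simp add: sel val f B.smult_l_minus B.M.l_neg)
      ultimately show "\<exists>g\<in>carrier ?D. g \<oplus>\<^bsub>?D\<^esub> f = \<zero>\<^bsub>?D\<^esub>" by blast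
      fix g assume g: "g \<in> carrier ?D"
      show "f \<oplus>\<^bsub>?D\<^esub> g = g \<oplus>\<^bsub>?D\<^esub> f"
        by (rule Hom_module_eqI[OF cl(1)[OF f g] cl(1)[OF g f]]) (simp add: sel val f g B.M.a_comm)
      fix h assume h: "h \<in> carrier ?D"
      show "(f \<oplus>\<^bsub>?D\<^esub> g) \<oplus>\<^bsub>?D\<^esub> h = f \<oplus>\<^bsub>?D\<^esub> (g \<oplus>\<^bsub>?D\<^esub> h)"
        by (rule Hom_module_eqI[OF cl(1)[OF cl(1)[OF f g] h] cl(1)[OF f cl(1)[OF g h]]])
           (simp add: sel val f g h B.M.a_assoc)
    qed (auto intro: cl)
  next
    fix f assume f: "f \<in> carrier ?D"
    show "\<one> \<odot>\<^bsub>?D\<^esub> f = f"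
      by (rule Hom_module_eqI[OF cl(2)[OF _ f] f]) (simp_all add: sel val f)
    fix a assume a: "a \<in> carrier R"
    show "a \<odot>\<^bsub>?D\<^esub> f \<in> carrier ?D" by (rule cl(2)[OF a f])
    {
      fix b assume b: "b \<in> carrier R"
      show "(a \<oplus> b) \<odot>\<^bsub>?D\<^esub> f = a \<odot>\<^bsub>?D\<^esub> f \<oplus>\<^bsub>?D\<^esub> b \<odot>\<^bsub>?D\<^esub> f"
        by (rule Hom_module_eqI[OF cl(2)[OF _ f] cl(1)[OF cl(2)[OF a f] cl(2)[OF b f]]])
           (use a b in \<open>simp_all add: sel val f B.smult_l_distr\<close>)
      show "(a \<otimes> b) \<odot>\<^bsub>?D\<^esub> f = a \<odot>\<^bsub>?D\<^esub> (b \<odot>\<^bsub>?D\<^esub> f)"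
        by (rule Hom_module_eqI[OF cl(2)[OF _ f] cl(2)[OF a cl(2)[OF b f]]])
           (use a b in \<open>simp_all add: sel val f B.smult_assoc1\<close>)
    }
    fix g assume g: "g \<in> carrier ?D"
    show "a \<odot>\<^bsub>?D\<^esub> (f \<oplus>\<^bsub>?D\<^esub> g) = a \<odot>\<^bsub>?D\<^esub> f \<oplus>\<^bsub>?D\<^esub> a \<odot>\<^bsub>?D\<^esub> g"
      by (rule Hom_module_eqI[OF cl(2)[OF a cl(1)[OF f g]] cl(1)[OF cl(2)[OF a f] cl(2)[OF a g]]])
         (use a in \<open>simp_all add: sel val f g B.smult_r_distr\<close>)
  qed
qed

section \<open>Complete local rings\<close>

context cring
begin

lemma ideal_pow_Suc: "ideal_pow R I (Suc n) = ideal_pow R I n \<cdot> I"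
  by (simp add: ideals_set_def)

lemma ideal_pow_antimono:
  assumes "ideal I R" "m \<le> n"
  shows "ideal_pow R I n \<subseteq> ideal_pow R I m"
proof -
  have "ideal_pow R I n = ideal_pow R I m \<cdot> ideal_pow R I (n - m)"
    using ideal_pow_add[OF assms(1), of m "n - m"] assms(2) by simp
  then show ?thesis using ideal_prod_inter ideal_pow_ideal[OF assms(1)] by auto
qed

text \<open>The binomial expansion: every product of n elements of a + (r) is a product of n
  elements of \<open>a\<close> plus terms with a factor \<open>r\<close>.\<close>

lemma ideal_pow_sum_principal:
  assumes a: "ideal a R" and r: "r \<in> carrier R" and c: "ideal c R"
    and dec: "\<And>s. s \<in> c \<Longrightarrow> \<exists>u\<in>a. \<exists>v\<in>carrier R. s = u \<oplus> v \<otimes> r"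
    and s: "s \<in> ideal_pow R c n"
  shows "\<exists>u\<in>ideal_pow R a n. \<exists>v\<in>carrier R. s = u \<oplus> v \<otimes> r"
  using s
proof (induction n arbitrary: s)
  case 0
  then have "s \<in> carrier R" by (simp only: ideal_pow_0)
  then show ?case unfolding ideal_pow_0 using r by (intro bexI[of _ s] bexI[of _ \<zero>]) simp_all
next
  case (Suc n)
  note an = idealD[OF ideal_pow_ideal[OF a, of "Suc n"]]
  from Suc.prems have "s \<in> ideal_pow R c n \<cdot> c" by (simp only: ideal_pow_Suc)
  then show ?case
  proof (induction rule: ideal_prod.induct)
    case (prod x y)
    obtain u v where x: "u \<in> ideal_pow R a n" "v \<in> carrier R" "x = u \<oplus> v \<otimes> r"
      using Suc.IH[OF prod(1)] by blast
    obtain u' v' where y: "u' \<in> a" "v' \<in> carrier R" "y = u' \<oplus> v' \<otimes> r"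
      using dec[OF prod(2)] by blast
    have cc: "u \<in> carrier R" "u' \<in> carrier R"
      using idealD(1)[OF ideal_pow_ideal[OF a]] idealD(1)[OF a] x y by blast+
    have "x \<otimes> y = u \<otimes> u' \<oplus> (u \<otimes> v' \<oplus> v \<otimes> (u' \<oplus> v' \<otimes> r)) \<otimes> r"
      unfolding x y using cc x(2) y(2) r by algebra
    moreover have "u \<otimes> u' \<in> ideal_pow R a (Suc n)"
      unfolding ideal_pow_Suc by (rule ideal_prod.prod[OF x(1) y(1)])
    moreover have "u \<otimes> v' \<oplus> v \<otimes> (u' \<oplus> v' \<otimes> r) \<in> carrier R" using cc x(2) y(2) r by simp
    ultimately show ?case by blast
  next
    case (sum x y)
    then obtain u v u' v' where *: "u \<in> ideal_pow R a (Suc n)" "v \<in> carrier R" "x = u \<oplus> v \<otimes> r"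
      "u' \<in> ideal_pow R a (Suc n)" "v' \<in> carrier R" "y = u' \<oplus> v' \<otimes> r" by metis
    have cc: "u \<in> carrier R" "u' \<in> carrier R" using an(1) * by blast+
    have "x \<oplus> y = (u \<oplus> u') \<oplus> (v \<oplus> v') \<otimes> r"
      unfolding * using cc *(2,5) r by algebra
    moreover have "u \<oplus> u' \<in> ideal_pow R a (Suc n)" by (rule an(3)[OF *(1,4)])
    moreover have "v \<oplus> v' \<in> carrier R" using * by simp
    ultimately show ?case by blast
  qed
qed

end

text \<open>Induction on the list and, for the new generator \<open>r\<close>, on the power of
  \<open>r\<close> killing \<open>x\<close>. If c^m kills the multiple of \<open>x\<close> by
  \<open>r\<close> and a^k kills \<open>x\<close>, then c^(m+k) kills \<open>x\<close>, because c^k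
  lies in a^k + (r).\<close>

lemma (in module) ideal_pow_kills:
  assumes rs: "set rs \<subseteq> carrier R"
    and nil: "\<And>r x. r \<in> set rs \<Longrightarrow> x \<in> carrier M \<Longrightarrow> \<exists>n. (r [^] (n::nat)) \<odot>\<^bsub>M\<^esub> x = \<zero>\<^bsub>M\<^esub>"
    and x: "x \<in> carrier M"
  shows "\<exists>n. \<forall>s\<in>ideal_pow R (lcomb R (regular_module R) (carrier R) rs) n. s \<odot>\<^bsub>M\<^esub> x = \<zero>\<^bsub>M\<^esub>"
  using assms
proof (induction rs arbitrary: x)
  case Nil
  have "s \<odot>\<^bsub>M\<^esub> x = \<zero>\<^bsub>M\<^esub>" if "s \<in> ideal_pow R {\<zero>} 1" for s
    using that Nil(3) by (simp only: R.ideal_pow_1[OF R.zeroideal]) simp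
  then show ?case by (intro exI[of _ 1]) simp
next
  case (Cons r rs)
  interpret reg: module R "regular_module R" by (rule R.regular_module)
  define a where "a = reg.lspan rs"
  define c where "c = reg.lspan (r # rs)"
  have r: "r \<in> carrier R" and rs: "set rs \<subseteq> carrier R" using Cons.prems by auto
  have a: "ideal a R" and c: "ideal c R"
    unfolding a_def c_def R.submodule_regular_iff[symmetric]
    using rs r by (intro reg.span_submodule; simp)+
  have IH: "\<exists>n. \<forall>s\<in>ideal_pow R a n. s \<odot>\<^bsub>M\<^esub> y = \<zero>\<^bsub>M\<^esub>" if "y \<in> carrier M" for y
    unfolding a_def using Cons.IH[OF rs Cons.prems(2) that] by simp
  have dec: "\<exists>u\<in>a. \<exists>v\<in>carrier R. s = u \<oplus> v \<otimes> r" if s: "s \<in> c" for s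
  proof -
    obtain v u where "v \<in> carrier R" "u \<in> a" "s = v \<otimes> r \<oplus> u"
      using s unfolding c_def a_def by auto
    then show ?thesis using idealD(1)[OF a] r R.a_comm[of "v \<otimes> r" u] by blast
  qed
  obtain p :: nat where p: "(r [^] p) \<odot>\<^bsub>M\<^esub> x = \<zero>\<^bsub>M\<^esub>" using Cons.prems(2)[of r x] Cons.prems(3) by auto
  have "\<exists>n. \<forall>s\<in>ideal_pow R c n. s \<odot>\<^bsub>M\<^esub> x = \<zero>\<^bsub>M\<^esub>"
    using p Cons.prems(3)
  proof (induction p arbitrary: x)
    case 0
    then have "x = \<zero>\<^bsub>M\<^esub>" by simp
    then show ?case using idealD(1)[OF R.ideal_pow_ideal[OF c]] by (auto simp: subset_iff)
  next
    case (Suc p)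
    have "(r [^] p) \<odot>\<^bsub>M\<^esub> (r \<odot>\<^bsub>M\<^esub> x) = \<zero>\<^bsub>M\<^esub>"
      using Suc.prems r by (simp add: smult_assoc1)
    with Suc.IH[of "r \<odot>\<^bsub>M\<^esub> x"] r Suc.prems(2) obtain m where
      m: "\<And>s. s \<in> ideal_pow R c m \<Longrightarrow> s \<odot>\<^bsub>M\<^esub> (r \<odot>\<^bsub>M\<^esub> x) = \<zero>\<^bsub>M\<^esub>" by auto
    obtain k where k: "\<And>s. s \<in> ideal_pow R a k \<Longrightarrow> s \<odot>\<^bsub>M\<^esub> x = \<zero>\<^bsub>M\<^esub>" using IH[OF Suc.prems(2)] by blast
    have "s \<odot>\<^bsub>M\<^esub> x = \<zero>\<^bsub>M\<^esub>" if "s \<in> ideal_pow R c (m + k)" for s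
    proof -
      from that have "s \<in> ideal_pow R c m \<cdot>\<^bsub>R\<^esub> ideal_pow R c k" by (simp only: R.ideal_pow_add[OF c])
      then have "s \<in> carrier R \<and> s \<odot>\<^bsub>M\<^esub> x = \<zero>\<^bsub>M\<^esub>"
      proof (induction rule: ideal_prod.induct)
        case (prod y z)
        obtain u v where z: "u \<in> ideal_pow R a k" "v \<in> carrier R" "z = u \<oplus> v \<otimes> r"
          using R.ideal_pow_sum_principal[OF a r c dec prod(2)] by blast
        have cc: "u \<in> carrier R" "y \<in> carrier R"
          using idealD(1)[OF R.ideal_pow_ideal[OF a]] idealD(1)[OF R.ideal_pow_ideal[OF c]] z prod by blast+
        have "z \<odot>\<^bsub>M\<^esub> x = u \<odot>\<^bsub>M\<^esub> x \<oplus>\<^bsub>M\<^esub> v \<odot>\<^bsub>M\<^esub> (r \<odot>\<^bsub>M\<^esub> x)"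
          unfolding z(3) using cc z(2) r Suc.prems(2) by (simp add: smult_l_distr smult_assoc1)
        then have "z \<odot>\<^bsub>M\<^esub> x = v \<odot>\<^bsub>M\<^esub> (r \<odot>\<^bsub>M\<^esub> x)" using k[OF z(1)] z(2) r Suc.prems(2) by simp
        moreover have "z \<in> carrier R" using z(2,3) cc r by simp
        ultimately show ?case
          using cc z(2) r Suc.prems(2) m[OF prod(1)]
          by (simp add: smult_assoc1 smult_comm[of y v])
      qed (use Suc.prems(2) in \<open>simp add: smult_l_distr\<close>)
      then show ?thesis by simp
    qed
    then show ?case by blast
  qed
  then show ?case by (simp only: c_def)
qed

text \<open>The first n terms only, so that for a series with n-th term in \<open>\<mm>\<close>^n
  the remainder begins with index n and lies in \<open>\<mm>\<close>^n. Only the additive structure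
  is used, so the function applies to modules as well.\<close>

primrec psum :: "('a, 'b) ring_scheme \<Rightarrow> (nat \<Rightarrow> 'a) \<Rightarrow> nat \<Rightarrow> 'a" where
  "psum G f 0 = \<zero>\<^bsub>G\<^esub>"
| "psum G f (Suc n) = psum G f n \<oplus>\<^bsub>G\<^esub> f n"

lemma (in abelian_group) psum_closed: "(\<And>n. f n \<in> carrier G) \<Longrightarrow> psum G f n \<in> carrier G"
  by (induction n) auto

section \<open>Units and convergent series in a complete local ring\<close>

locale complete_local_ring = local_ring R \<mm> for R (structure) and \<mm> +
  assumes noetherian: "noetherian_ring R" and complete: "adic_complete R \<mm>"
begin

lemma maximal_ideal: "ideal \<mm> R"
  using maximalideal by (rule maximalideal.axioms(1))

lemma maximal_ideal_proper: "\<one> \<notin> \<mm>"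
  using maximalideal.I_notcarr[OF maximalideal] ideal.one_imp_carrier[OF maximal_ideal] by blast

lemmas \<mm>D = idealD[OF maximal_ideal]

abbreviation "mp n \<equiv> ideal_pow R \<mm> n"

lemmas mp_ideal = ideal_pow_ideal[OF maximal_ideal]
lemmas mpD = idealD[OF mp_ideal]

text \<open>Zorn's lemma gives a maximal ideal above \<open>a\<close>, the Noetherian property
  putting the union of a chain into the chain itself. Uniqueness of the maximal ideal identifies it
  with \<open>\<mm>\<close>.\<close>

lemma proper_ideal_subset:
  assumes a: "ideal a R" "\<one> \<notin> a"
  shows "a \<subseteq> \<mm>"
proof -
  let ?A = "{b. ideal b R \<and> a \<subseteq> b \<and> \<one> \<notin> b}"
  have "\<exists>n\<in>?A. \<forall>X\<in>?A. n \<subseteq> X \<longrightarrow> X = n"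
  proof (rule subset_Zorn_nonempty)
    show "?A \<noteq> {}" using a by blast
    fix C assume C: "C \<noteq> {}" "subset.chain ?A C"
    then have "subset.chain {b. ideal b R} C" by (auto simp: subset.chain_def)
    then have "\<Union>C \<in> C" by (rule noetherian_ring.ideal_chain_is_trivial[OF noetherian C(1)])
    then show "\<Union>C \<in> ?A" using C(2) by (auto simp: subset.chain_def)
  qed
  then obtain n where nA: "n \<in> ?A" and max: "\<And>X. X \<in> ?A \<Longrightarrow> n \<subseteq> X \<Longrightarrow> X = n" by meson
  have n: "ideal n R" "a \<subseteq> n" "\<one> \<notin> n" using nA by auto
  have "maximalideal n R"
  proof (rule maximalidealI[OF n(1)])
    show "carrier R \<noteq> n" using n(3) by auto
    fix X assume X: "ideal X R" "n \<subseteq> X" "X \<subseteq> carrier R"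
    show "X = n \<or> X = carrier R"
    proof (cases "\<one> \<in> X")
      case True
      then show ?thesis using ideal.one_imp_carrier[OF X(1)] by blast
    next
      case False
      then have "X \<in> ?A" using X n(2) by blast
      then show ?thesis using max X(2) by blast
    qed
  qed
  then show ?thesis using maximalideal_unique n(2) by blast
qed

lemma unit_outside_maximal:
  assumes "r \<in> carrier R" "r \<notin> \<mm>"
  shows "\<exists>s\<in>carrier R. s \<otimes> r = \<one>"
proof -
  have "\<one> \<in> PIdl r"
    using proper_ideal_subset[OF cgenideal_ideal[OF assms(1)]] cgenideal_self[OF assms(1)] assms(2)
    by blast
  then show ?thesis by (auto simp: cgenideal_def)
qed

text \<open>Completeness yields a limit without a rate of convergence. All partial sums from the
  n-th on agree modulo \<open>\<mm>\<close>^n, so comparison with a sufficiently late one gives the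
  rate.\<close>

lemma series_converges:
  assumes c: "\<And>n. c n \<in> mp n"
  shows "\<exists>y\<in>carrier R. \<forall>n. y \<ominus> psum R c n \<in> mp n"
proof -
  have cc: "c n \<in> carrier R" for n using mpD(1) c by blast
  have pc: "psum R c n \<in> carrier R" for n by (rule psum_closed[OF cc])
  have diff: "psum R c (n + k) \<ominus> psum R c n \<in> mp n" for n k
  proof (induction k)
    case 0
    then show ?case using pc mpD(2) by (simp add: a_minus_def r_neg)
  next
    case (Suc k)
    have "psum R c (n + Suc k) \<ominus> psum R c n = (psum R c (n + k) \<ominus> psum R c n) \<oplus> c (n + k)"
      using pc[of n] pc[of "n + k"] cc[of "n + k"] by simp algebra
    moreover have "c (n + k) \<in> mp n"
      using c[of "n + k"] ideal_pow_antimono[OF maximal_ideal, of n "n + k"] by auto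
    ultimately show ?case using mpD(3)[OF Suc] by simp
  qed
  have "psum R c i \<ominus> psum R c j \<in> mp n" if "i \<ge> n" "j \<ge> n" for i j n
  proof -
    have "(psum R c i \<ominus> psum R c n) \<ominus> (psum R c j \<ominus> psum R c n) \<in> mp n"
      using mpD(4)[OF diff[of n "i - n"] diff[of n "j - n"]] that by simp
    moreover have "(psum R c i \<ominus> psum R c n) \<ominus> (psum R c j \<ominus> psum R c n) = psum R c i \<ominus> psum R c j"
      using pc[of i] pc[of j] pc[of n] by algebra
    ultimately show ?thesis by simp
  qed
  then have "\<forall>n. \<exists>N. \<forall>i\<ge>N. \<forall>j\<ge>N. psum R c i \<ominus> psum R c j \<in> mp n" by blast
  then obtain y where y: "y \<in> carrier R" "\<And>n. \<exists>N. \<forall>i\<ge>N. psum R c i \<ominus> y \<in> mp n"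
    using complete[unfolded adic_complete_def, THEN conjunct2, THEN spec, of "psum R c"] pc by blast
  have "y \<ominus> psum R c n \<in> mp n" for n
  proof -
    obtain N where N: "\<And>i. i \<ge> N \<Longrightarrow> psum R c i \<ominus> y \<in> mp n" using y(2) by blast
    have "(psum R c (n + N) \<ominus> psum R c n) \<ominus> (psum R c (n + N) \<ominus> y) \<in> mp n"
      by (rule mpD(4)[OF diff N]) simp
    moreover have "(psum R c (n + N) \<ominus> psum R c n) \<ominus> (psum R c (n + N) \<ominus> y) = y \<ominus> psum R c n"
      using pc[of n] pc[of "n + N"] y(1) by algebra
    ultimately show ?thesis by simp
  qed
  then show ?thesis using y(1) by blast
qed

text \<open>Coefficients of the n-th term can be chosen in \<open>\<mm>\<close>^n, so convergence is
  inherited from the ring one generator at a time.\<close>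

lemma series_converges_lcomb:
  assumes M: "module R M" and es: "set es \<subseteq> carrier M"
    and \<delta>: "\<And>n. \<delta> n \<in> lcomb R M (mp n) es"
  shows "\<exists>y\<in>lcomb R M (carrier R) es. \<forall>n. y \<ominus>\<^bsub>M\<^esub> psum M \<delta> n \<in> lcomb R M (mp n) es"
proof -
  interpret M: module R M by fact
  show ?thesis
    using es \<delta>
  proof (induction es arbitrary: \<delta>)
    case Nil
    have "psum M \<delta> n = \<zero>\<^bsub>M\<^esub>" for n
      using Nil by (induction n) auto
    then show ?case by (simp add: a_minus_def)
  next
    case (Cons e es)
    have e: "e \<in> carrier M" and es: "set es \<subseteq> carrier M" using Cons.prems by auto
    have "\<exists>cv. fst cv \<in> mp n \<and> snd cv \<in> lcomb R M (mp n) es \<and> \<delta> n = fst cv \<odot>\<^bsub>M\<^esub> e \<oplus>\<^bsub>M\<^esub> snd cv" for n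
      using Cons.prems(2)[of n] by auto
    then obtain cv where cv: "\<And>n. fst (cv n) \<in> mp n \<and> snd (cv n) \<in> lcomb R M (mp n) es \<and>
        \<delta> n = fst (cv n) \<odot>\<^bsub>M\<^esub> e \<oplus>\<^bsub>M\<^esub> snd (cv n)" by metis
    define c where "c n = fst (cv n)" for n
    define v where "v n = snd (cv n)" for n
    have c: "c n \<in> mp n" and v: "v n \<in> lcomb R M (mp n) es"
      and \<delta>: "\<delta> n = c n \<odot>\<^bsub>M\<^esub> e \<oplus>\<^bsub>M\<^esub> v n" for n
      using cv by (auto simp: c_def v_def)
    have cc: "c n \<in> carrier R" for n using mpD(1) c by blast
    have vc: "v n \<in> carrier M" for n by (rule M.lcomb_closed[OF mp_ideal es v])
    have pc: "psum R c n \<in> carrier R" "psum M v n \<in> carrier M" for n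
      by (rule psum_closed[OF cc], rule M.M.psum_closed[OF vc])
    have ps: "psum M \<delta> n = psum R c n \<odot>\<^bsub>M\<^esub> e \<oplus>\<^bsub>M\<^esub> psum M v n" for n
      using e by (induction n) (simp_all add: \<delta> M.smult_l_distr cc vc pc M.M.a_ac)
    obtain r where r: "r \<in> carrier R" "\<And>n. r \<ominus> psum R c n \<in> mp n"
      using series_converges[OF c] by blast
    obtain y where y: "y \<in> lcomb R M (carrier R) es" "\<And>n. y \<ominus>\<^bsub>M\<^esub> psum M v n \<in> lcomb R M (mp n) es"
      using Cons.IH[OF es v] by blast
    have yc: "y \<in> carrier M" by (rule M.lcomb_closed[OF oneideal es y(1)])
    show ?case
    proof (intro bexI allI)
      show "r \<odot>\<^bsub>M\<^esub> e \<oplus>\<^bsub>M\<^esub> y \<in> lcomb R M (carrier R) (e # es)" by (rule lcomb_ConsI[OF r(1) y(1)])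
      fix n
      have "(r \<odot>\<^bsub>M\<^esub> e \<oplus>\<^bsub>M\<^esub> y) \<ominus>\<^bsub>M\<^esub> psum M \<delta> n =
          (r \<ominus> psum R c n) \<odot>\<^bsub>M\<^esub> e \<oplus>\<^bsub>M\<^esub> (y \<ominus>\<^bsub>M\<^esub> psum M v n)"
        unfolding ps using r(1) e yc pc by (simp add: M.M.add_minus_add M.smult_minus_left)
      then show "(r \<odot>\<^bsub>M\<^esub> e \<oplus>\<^bsub>M\<^esub> y) \<ominus>\<^bsub>M\<^esub> psum M \<delta> n \<in> lcomb R M (mp n) (e # es)"
        using lcomb_ConsI[OF r(2) y(2)] by simp
    qed
  qed
qed

text \<open>The \<open>zs\<close> are products of generators of \<open>a\<close> with the
  \<open>es\<close>. For consecutive powers of \<open>\<mm>\<close> this exhibits the quotient of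
  two steps of the filtration as spanned by finitely many elements killed by
  \<open>\<mm>\<close>.\<close>

lemma ideal_multiple_generators:
  fixes M :: "('a, 'm) module"
  assumes M: "module R M" and es: "set es \<subseteq> carrier M"
    and a: "ideal a R" and a': "ideal a' R"
    and prod: "\<And>r s. r \<in> \<mm> \<Longrightarrow> s \<in> a \<Longrightarrow> r \<otimes> s \<in> a'"
  shows "\<exists>zs. set zs \<subseteq> lcomb R M a es \<and> lcomb R M a es \<subseteq> lcomb R M (carrier R) zs \<and>
    (\<forall>z\<in>set zs. \<forall>r\<in>\<mm>. r \<odot>\<^bsub>M\<^esub> z \<in> lcomb R M a' es)"
proof -
  interpret M: module R M by fact
  interpret reg: module R "regular_module R" by (rule regular_module)
  obtain rs where rs: "set rs \<subseteq> carrier R" "a = reg.lspan rs"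
    using noetherian_ideal_span[OF noetherian a] by blast
  have rsa: "set rs \<subseteq> a" using reg.span_gen[of rs] rs by auto
  show ?thesis
    using es
  proof (induction es)
    case Nil
    show ?case by (rule exI[of _ "[]"]) auto
  next
    case (Cons e es)
    have e: "e \<in> carrier M" and es: "set es \<subseteq> carrier M" using Cons.prems by auto
    obtain zs where zs: "set zs \<subseteq> lcomb R M a es" "lcomb R M a es \<subseteq> M.lspan zs"
      "\<And>z r. z \<in> set zs \<Longrightarrow> r \<in> \<mm> \<Longrightarrow> r \<odot>\<^bsub>M\<^esub> z \<in> lcomb R M a' es" using Cons.IH[OF es] by blast
    have zsc: "set zs \<subseteq> carrier M" using zs(1) M.lcomb_closed[OF a es] by blast
    let ?ws = "map (\<lambda>r. r \<odot>\<^bsub>M\<^esub> e) rs"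
    have wsc: "set ?ws \<subseteq> carrier M" using rs(1) e by auto
    have hom: "(\<lambda>r. r \<odot>\<^bsub>M\<^esub> e) \<in> module_hom R (regular_module R) M"
      using e by (intro module_homI) (simp_all add: M.smult_l_distr M.smult_assoc1)
    have gen: "r \<odot>\<^bsub>M\<^esub> e \<in> lcomb R M b (e # es)" if "r \<in> b" "ideal b R" for r b
    proof -
      have "r \<odot>\<^bsub>M\<^esub> e \<oplus>\<^bsub>M\<^esub> \<zero>\<^bsub>M\<^esub> \<in> lcomb R M b (e # es)"
        by (rule lcomb_ConsI[OF that(1) M.submoduleD(3)[OF M.lcomb_submodule[OF that(2) es]]])
      then show ?thesis using e that(1) idealD(1)[OF that(2)] by (simp add: subset_iff del: lcomb.simps)
    qed
    have incl: "v \<in> lcomb R M b (e # es)" if "v \<in> lcomb R M b es" "ideal b R" for v b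
    proof -
      have "\<zero> \<odot>\<^bsub>M\<^esub> e \<oplus>\<^bsub>M\<^esub> v \<in> lcomb R M b (e # es)"
        by (rule lcomb_ConsI[OF idealD(2)[OF that(2)] that(1)])
      then show ?thesis using e M.lcomb_closed[OF that(2) es that(1)] by (simp del: lcomb.simps)
    qed
    show ?case
    proof (intro exI[of _ "?ws @ zs"] conjI ballI subsetI)
      fix z assume "z \<in> set (?ws @ zs)"
      then show "z \<in> lcomb R M a (e # es)"
        using gen[OF _ a] incl[OF _ a] rsa zs(1) by (auto simp del: lcomb.simps)
    next
      fix v assume "v \<in> lcomb R M a (e # es)"
      then obtain c w where v: "c \<in> a" "w \<in> lcomb R M a es" "v = c \<odot>\<^bsub>M\<^esub> e \<oplus>\<^bsub>M\<^esub> w" by auto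
      have "c \<odot>\<^bsub>M\<^esub> e \<in> M.lspan ?ws"
        using lcomb_map(1)[OF regular_module hom oneideal _ M] rs v(1) by simp
      then show "v \<in> M.lspan (?ws @ zs)"
        unfolding v(3) using zs(2) v(2) by (intro M.span_append[OF wsc zsc]) auto
    next
      fix z r assume z: "z \<in> set (?ws @ zs)" and r: "r \<in> \<mm>"
      have rc: "r \<in> carrier R" using \<mm>D(1) r by blast
      from z consider s where "s \<in> set rs" "z = s \<odot>\<^bsub>M\<^esub> e" | "z \<in> set zs" by auto
      then show "r \<odot>\<^bsub>M\<^esub> z \<in> lcomb R M a' (e # es)"
      proof cases
        case (1 s)
        have "r \<odot>\<^bsub>M\<^esub> z = (r \<otimes> s) \<odot>\<^bsub>M\<^esub> e" using 1 rs(1) rc e by (auto simp: M.smult_assoc1)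
        moreover have "r \<otimes> s \<in> a'" using prod[OF r] rsa 1(1) by blast
        ultimately show ?thesis using gen[OF _ a'] by simp
      next
        case 2
        then show ?thesis by (intro incl[OF zs(3) a'] r)
      qed
    qed
  qed
qed

end

section \<open>Matlis duality\<close>

locale matlis = complete_local_ring R \<mm>
  for R :: "('r, 'q) ring_scheme" (structure) and \<mm> +
  fixes E :: "('r, 'e) module" and \<iota> :: "'r set \<Rightarrow> 'e"
  assumes hull: "injective_hull R (residue_field_module R \<mm>) E \<iota>"
begin

lemma E_injective: "injective_module R E"
  using hull by (simp add: injective_hull_def)

lemma E_module: "module R E"
  using E_injective by (simp add: injective_module_def)

sublocale E: module R E
  by (rule E_module)

abbreviation "k \<equiv> residue_field_module R \<mm>"

lemma maximal_submodule: "submodule \<mm> R (regular_module R)"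
  by (simp add: submodule_regular_iff maximal_ideal)

lemma k_module: "module R k"
  by (rule module_quotient_module[OF regular_module maximal_submodule])

text \<open>The composite R -> k -> E with kernel \<open>\<mm>\<close>. Working with it keeps the
  cosets of \<open>\<mm>\<close> out of later arguments.\<close>

definition residue_map :: "'r \<Rightarrow> 'e"
  where "residue_map r = \<iota> (\<mm> +>\<^bsub>regular_module R\<^esub> r)"

lemma residue_map_hom: "residue_map \<in> module_hom R (regular_module R) E"
proof -
  have \<iota>: "\<iota> \<in> module_hom R k E" using hull by (simp add: injective_hull_def)
  note \<iota>D = module_homD[OF \<iota>]
  note qD = module_homD[OF quotient_map_hom[OF regular_module maximal_submodule]]
  show ?thesis
    unfolding residue_map_def
  proof (rule module_homI)
    fix x assume x: "x \<in> carrier (regular_module R)"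
    show "\<iota> (\<mm> +>\<^bsub>regular_module R\<^esub> x) \<in> carrier E" by (rule \<iota>D(1)[OF qD(1)[OF x]])
    show "\<iota> (\<mm> +>\<^bsub>regular_module R\<^esub> (x \<oplus>\<^bsub>regular_module R\<^esub> y)) =
        \<iota> (\<mm> +>\<^bsub>regular_module R\<^esub> x) \<oplus>\<^bsub>E\<^esub> \<iota> (\<mm> +>\<^bsub>regular_module R\<^esub> y)"
      if y: "y \<in> carrier (regular_module R)" for y
      unfolding qD(2)[OF x y] by (rule \<iota>D(2)[OF qD(1)[OF x] qD(1)[OF y]])
    show "\<iota> (\<mm> +>\<^bsub>regular_module R\<^esub> (a \<odot>\<^bsub>regular_module R\<^esub> x)) =
        a \<odot>\<^bsub>E\<^esub> \<iota> (\<mm> +>\<^bsub>regular_module R\<^esub> x)"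
      if a: "a \<in> carrier R" for a
      unfolding qD(3)[OF a x] by (rule \<iota>D(3)[OF a qD(1)[OF x]])
  qed
qed

lemmas residue_mapD = module_homD[OF residue_map_hom, simplified]

lemma residue_map_zero_iff: "r \<in> carrier R \<Longrightarrow> residue_map r = \<zero>\<^bsub>E\<^esub> \<longleftrightarrow> r \<in> \<mm>"
proof -
  assume r: "r \<in> carrier R"
  have \<iota>: "\<iota> \<in> module_hom R k E" "inj_on \<iota> (carrier k)" using hull by (simp_all add: injective_hull_def)
  interpret k: module R k by (rule k_module)
  have "\<mm> +>\<^bsub>regular_module R\<^esub> r \<in> carrier k" using r by (simp add: quotient_module_sel)
  then have "residue_map r = \<zero>\<^bsub>E\<^esub> \<longleftrightarrow> \<mm> +>\<^bsub>regular_module R\<^esub> r = \<zero>\<^bsub>k\<^esub>"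
    using inj_on_eq_iff[OF \<iota>(2), of "\<mm> +>\<^bsub>regular_module R\<^esub> r" "\<zero>\<^bsub>k\<^esub>"]
      module_hom_zero[OF k_module E_module \<iota>(1)] by (simp add: residue_map_def)
  also have "\<dots> \<longleftrightarrow> r \<in> \<mm>"
    by (rule quotient_module_zero[OF regular_module maximal_submodule]) (simp add: r)
  finally show ?thesis .
qed

lemma residue_map_killed: "r \<in> \<mm> \<Longrightarrow> s \<in> carrier R \<Longrightarrow> r \<odot>\<^bsub>E\<^esub> residue_map s = \<zero>\<^bsub>E\<^esub>"
proof -
  assume r: "r \<in> \<mm>" and s: "s \<in> carrier R"
  have rc: "r \<in> carrier R" using \<mm>D(1) r by blast
  have "s \<otimes> r \<in> \<mm>" by (rule \<mm>D(5)[OF s r])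
  then show ?thesis using residue_mapD(3)[OF rc s] residue_map_zero_iff[of "r \<otimes> s"] rc s by (simp add: m_comm)
qed

text \<open>Essentiality is applied to the cyclic submodule generated by \<open>x\<close>, which
  must meet the image of the residue field outside zero.\<close>

lemma essential:
  assumes x: "x \<in> carrier E" "x \<noteq> \<zero>\<^bsub>E\<^esub>"
  shows "\<exists>s\<in>carrier R. \<exists>r\<in>carrier R. s \<odot>\<^bsub>E\<^esub> x = residue_map r \<and> residue_map r \<noteq> \<zero>\<^bsub>E\<^esub>"
proof -
  have sub: "submodule (E.lspan [x]) R E" using x by (intro E.span_submodule) simp
  have "E.lspan [x] \<noteq> {\<zero>\<^bsub>E\<^esub>}" using E.span_gen[of "[x]"] x by auto
  then have "E.lspan [x] \<inter> \<iota> ` carrier k \<noteq> {\<zero>\<^bsub>E\<^esub>}"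
    using hull sub unfolding injective_hull_def by blast
  moreover have "\<zero>\<^bsub>E\<^esub> \<in> E.lspan [x] \<inter> \<iota> ` carrier k"
  proof -
    have "\<zero>\<^bsub>E\<^esub> = residue_map \<zero>" using residue_map_zero_iff[OF zero_closed] \<mm>D(2) by simp
    then have "\<zero>\<^bsub>E\<^esub> \<in> \<iota> ` carrier k" by (auto simp: residue_map_def quotient_module_sel)
    then show ?thesis using E.submoduleD(3)[OF sub] by simp
  qed
  ultimately obtain e where e: "e \<in> E.lspan [x]" "e \<in> \<iota> ` carrier k" "e \<noteq> \<zero>\<^bsub>E\<^esub>" by blast
  obtain s where s: "s \<in> carrier R" "e = s \<odot>\<^bsub>E\<^esub> x" using e(1) x(1) by auto
  obtain r where r: "r \<in> carrier R" "e = residue_map r" using e(2) by (auto simp: residue_map_def quotient_module_sel)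
  show ?thesis using s r e(3) by metis
qed

text \<open>The socle of \<open>E\<close> is a one-dimensional vector space over the residue field.\<close>

lemma socle_multiple:
  assumes x: "x \<in> annihilated R E \<mm>" "x \<noteq> \<zero>\<^bsub>E\<^esub>" and y: "y \<in> annihilated R E \<mm>"
  shows "\<exists>c\<in>carrier R. y = c \<odot>\<^bsub>E\<^esub> x"
proof -
  have socle: "\<exists>r\<in>carrier R. z = residue_map r" if z: "z \<in> annihilated R E \<mm>" for z
  proof (cases "z = \<zero>\<^bsub>E\<^esub>")
    case True
    then show ?thesis using residue_map_zero_iff[OF zero_closed] \<mm>D(2) by (intro bexI[of _ \<zero>]) auto
  next
    case False
    have zc: "z \<in> carrier E" by (rule annihilatedD(1)[OF z])
    obtain s r where sr: "s \<in> carrier R" "r \<in> carrier R" "s \<odot>\<^bsub>E\<^esub> z = residue_map r" "residue_map r \<noteq> \<zero>\<^bsub>E\<^esub>"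
      using essential[OF zc False] by blast
    \<comment> \<open>Elements of \<open>\<mm>\<close> kill \<open>z\<close>, while \<open>s\<close>
      does not. So \<open>s\<close> is a unit, and \<open>z\<close> itself comes from the residue
      field.\<close>
    have "s \<notin> \<mm>" using annihilatedD(2)[OF z, of s] sr(3,4) by auto
    then obtain u where u: "u \<in> carrier R" "u \<otimes> s = \<one>" using unit_outside_maximal sr(1) by blast
    have "z = u \<odot>\<^bsub>E\<^esub> (s \<odot>\<^bsub>E\<^esub> z)" using E.smult_assoc1[OF u(1) sr(1) zc] u(2) zc by simp
    also have "\<dots> = residue_map (u \<otimes> r)" unfolding sr(3) using residue_mapD(3)[OF u(1) sr(2)] by simp
    finally show ?thesis using u(1) sr(2) by blast
  qed
  obtain r where r: "r \<in> carrier R" "x = residue_map r" using socle[OF x(1)] by blast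
  obtain s where s: "s \<in> carrier R" "y = residue_map s" using socle[OF y] by blast
  have "r \<notin> \<mm>" using x(2) r residue_map_zero_iff by blast
  then obtain u where u: "u \<in> carrier R" "u \<otimes> r = \<one>" using unit_outside_maximal r(1) by blast
  have "(s \<otimes> u) \<odot>\<^bsub>E\<^esub> x = residue_map ((s \<otimes> u) \<otimes> r)" using residue_mapD(3)[of "s \<otimes> u" r] s u r by simp
  also have "(s \<otimes> u) \<otimes> r = s" using s u r by (simp add: m_assoc)
  finally show ?thesis using s u(1) by (intro bexI[of _ "s \<otimes> u"]) auto
qed

text \<open>The annihilators of the elements r^n x increase and become stationary. If r^n x were
  nonzero at that stage, some multiple s r^n x would be a nonzero element of the residue field,
  hence killed by \<open>r\<close>; stationarity would force it to vanish.\<close>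

lemma maximal_element_nilpotent:
  assumes r: "r \<in> \<mm>" and x: "x \<in> carrier E"
  shows "\<exists>n. (r [^] (n::nat)) \<odot>\<^bsub>E\<^esub> x = \<zero>\<^bsub>E\<^esub>"
proof -
  have rc: "r \<in> carrier R" using \<mm>D(1) r by blast
  define A where "A n = annihilator R E ((r [^] (n::nat)) \<odot>\<^bsub>E\<^esub> x)" for n
  have A: "ideal (A n) R" for n
    unfolding A_def annihilator_def using rc x by (intro E.annihilator_ideal) simp
  have A_Suc: "A n \<subseteq> A (Suc n)" for n
  proof -
    have "(r [^] Suc n) \<odot>\<^bsub>E\<^esub> x = r \<odot>\<^bsub>E\<^esub> ((r [^] n) \<odot>\<^bsub>E\<^esub> x)"
      using rc x E.smult_assoc1[of r "r [^] n" x] by (simp add: m_comm)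
    then show ?thesis
      unfolding A_def annihilator_def using rc x by (auto simp: E.smult_comm[of _ r])
  qed
  have mono: "A m \<subseteq> A n" if "m \<le> n" for m n using lift_Suc_mono_le[of A, OF A_Suc that] .
  have "subset.chain {b. ideal b R} (range A)"
    unfolding subset_chain_def
  proof (intro conjI ballI)
    show "range A \<subseteq> {b. ideal b R}" using A by auto
    fix X Y assume "X \<in> range A" "Y \<in> range A"
    then obtain m n where "X = A m" "Y = A n" by blast
    then show "X \<subseteq> Y \<or> Y \<subseteq> X" using mono[of m n] mono[of n m] nat_le_linear[of m n] by blast
  qed
  then have "\<Union>(range A) \<in> range A"
    using noetherian_ring.ideal_chain_is_trivial[OF noetherian] by blast
  then obtain n where n: "\<Union>(range A) = A n" by blast
  have "(r [^] n) \<odot>\<^bsub>E\<^esub> x = \<zero>\<^bsub>E\<^esub>"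
  proof (rule ccontr)
    let ?y = "(r [^] n) \<odot>\<^bsub>E\<^esub> x"
    assume y0: "?y \<noteq> \<zero>\<^bsub>E\<^esub>"
    have yc: "?y \<in> carrier E" using rc x by simp
    obtain s u where s: "s \<in> carrier R" "u \<in> carrier R" "s \<odot>\<^bsub>E\<^esub> ?y = residue_map u" "residue_map u \<noteq> \<zero>\<^bsub>E\<^esub>"
      using essential[OF yc y0] by blast
    have "r \<odot>\<^bsub>E\<^esub> (s \<odot>\<^bsub>E\<^esub> ?y) = \<zero>\<^bsub>E\<^esub>" unfolding s(3) by (rule residue_map_killed[OF r s(2)])
    moreover have "(r [^] Suc n) \<odot>\<^bsub>E\<^esub> x = r \<odot>\<^bsub>E\<^esub> ?y"
      using rc x E.smult_assoc1[of r "r [^] n" x] by (simp add: m_comm)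
    ultimately have "s \<in> A (Suc n)"
      using s(1) rc yc E.smult_comm[of r s ?y] by (simp add: A_def annihilator_def del: nat_pow_Suc)
    then have "s \<in> A n" using n by blast
    then show False using s(3,4) by (simp add: A_def annihilator_def)
  qed
  then show ?thesis by blast
qed

text \<open>An element of \<open>E\<close> sees the ring only modulo some power of
  \<open>\<mm>\<close>. This is what later turns adic limits into exact equalities of
  values.\<close>

lemma maximal_power_kills:
  assumes "x \<in> carrier E"
  shows "\<exists>n. \<forall>s\<in>mp n. s \<odot>\<^bsub>E\<^esub> x = \<zero>\<^bsub>E\<^esub>"
proof -
  interpret reg: module R "regular_module R" by (rule regular_module)
  obtain rs where rs: "set rs \<subseteq> carrier R" "\<mm> = reg.lspan rs"
    using noetherian_ideal_span[OF noetherian maximal_ideal] by blast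
  have "set rs \<subseteq> \<mm>" using reg.span_gen[of rs] rs by auto
  then have "\<exists>n. \<forall>s\<in>ideal_pow R (reg.lspan rs) n. s \<odot>\<^bsub>E\<^esub> x = \<zero>\<^bsub>E\<^esub>"
    using maximal_element_nilpotent by (intro E.ideal_pow_kills[OF rs(1) _ assms]) blast
  then show ?thesis using rs(2) by simp
qed

end

section \<open>The dual module: separation, orthogonals and reflexivity\<close>

locale matlis_module = matlis R \<mm> E \<iota> + H: module R H
  for R :: "('r, 'q) ring_scheme" (structure) and \<mm>
    and E :: "('r, 'e) module" and \<iota> and H :: "('r, 'h) module"
begin

abbreviation "D \<equiv> matlis_dual R E H"

lemma D_module: "module R D"
  unfolding matlis_dual_def by (rule module_Hom_module[OF H.module_axioms E_module])

sublocale D: module R D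
  by (rule D_module)

lemma D_hom: "g \<in> carrier D \<Longrightarrow> g \<in> module_hom R H E"
  by (simp add: matlis_dual_def Hom_module_sel)

lemmas D_closed = module_homD(1)[OF D_hom]
  and D_add = module_homD(2)[OF D_hom]
  and D_smult = module_homD(3)[OF D_hom]
  and D_zero = module_hom_zero[OF H.module_axioms E_module D_hom]

lemma D_sel [simp]:
  "x \<in> carrier H \<Longrightarrow> (g \<oplus>\<^bsub>D\<^esub> h) x = g x \<oplus>\<^bsub>E\<^esub> h x"
  "x \<in> carrier H \<Longrightarrow> (a \<odot>\<^bsub>D\<^esub> g) x = a \<odot>\<^bsub>E\<^esub> g x"
  "x \<in> carrier H \<Longrightarrow> \<zero>\<^bsub>D\<^esub> x = \<zero>\<^bsub>E\<^esub>"
  by (simp_all add: matlis_dual_def Hom_module_sel)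

lemma D_eqI: "f \<in> carrier D \<Longrightarrow> g \<in> carrier D \<Longrightarrow> (\<And>x. x \<in> carrier H \<Longrightarrow> f x = g x) \<Longrightarrow> f = g"
  unfolding matlis_dual_def by (rule Hom_module_eqI)

lemma D_extend:
  assumes "submodule S R H" "f \<in> module_hom R (H\<lparr>carrier := S\<rparr>) E"
  shows "\<exists>g\<in>carrier D. \<forall>x\<in>S. g x = f x"
proof -
  obtain h where h: "h \<in> module_hom R H E" "\<And>x. x \<in> S \<Longrightarrow> h x = f x"
    using injective_module_extend[OF E_injective H.module_axioms assms] by blast
  have "restrict h (carrier H) \<in> carrier D"
    unfolding matlis_dual_def by (rule restrict_Hom_module[OF H.module_axioms h(1)])
  then show ?thesis
    using h(2) H.submoduleD(2)[OF assms(1)] by (intro bexI[of _ "restrict h (carrier H)"]) auto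
qed

text \<open>The annihilator of a nonzero \<open>x\<close> is proper and so lies in
  \<open>\<mm>\<close>. Hence \<open>residue_map\<close> factors through the cyclic module of
  \<open>x\<close>, and any extension to \<open>H\<close> takes the nonzero value
  \<open>residue_map \<one>\<close> at \<open>x\<close>.\<close>

lemma D_separates:
  assumes x: "x \<in> carrier H" "x \<noteq> \<zero>\<^bsub>H\<^esub>"
  shows "\<exists>g\<in>carrier D. g x \<noteq> \<zero>\<^bsub>E\<^esub>"
proof -
  let ?f = "\<lambda>r. r \<odot>\<^bsub>H\<^esub> x"
  have f: "?f \<in> module_hom R (regular_module R) H"
    using x by (intro module_homI) (simp_all add: H.smult_l_distr H.smult_assoc1)
  have "{a \<in> carrier R. a \<odot>\<^bsub>H\<^esub> x = \<zero>\<^bsub>H\<^esub>} \<subseteq> \<mm>"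
    using x by (intro proper_ideal_subset H.annihilator_ideal) auto
  then have "\<exists>h\<in>module_hom R (H\<lparr>carrier := ?f ` carrier R\<rparr>) E. \<forall>r\<in>carrier R. h (?f r) = residue_map r"
    using module_hom_factor[OF regular_module H.module_axioms E_module f residue_map_hom] residue_map_zero_iff by auto
  then obtain h where h: "h \<in> module_hom R (H\<lparr>carrier := ?f ` carrier R\<rparr>) E"
    "\<And>r. r \<in> carrier R \<Longrightarrow> h (?f r) = residue_map r" by blast
  have sub: "submodule (?f ` carrier R) R H"
    using module_hom_image_submodule[OF regular_module H.module_axioms f] by simp
  obtain g where g: "g \<in> carrier D" "\<And>y. y \<in> ?f ` carrier R \<Longrightarrow> g y = h y"
    using D_extend[OF sub h(1)] by blast
  have "g x = residue_map \<one>" using g(2)[OF imageI[OF one_closed, of ?f]] h(2)[OF one_closed] x by simp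
  then show ?thesis using g(1) residue_map_zero_iff[OF one_closed] maximal_ideal_proper by (intro bexI[of _ g]) auto
qed

lemma D_separates_eq:
  assumes "x \<in> carrier H" "y \<in> carrier H" "\<And>g. g \<in> carrier D \<Longrightarrow> g x = g y"
  shows "x = y"
proof (rule ccontr)
  assume "x \<noteq> y"
  then have "x \<ominus>\<^bsub>H\<^esub> y \<noteq> \<zero>\<^bsub>H\<^esub>" using assms by (simp add: H.M.minus_eq_zero_iff)
  then obtain g where g: "g \<in> carrier D" "g (x \<ominus>\<^bsub>H\<^esub> y) \<noteq> \<zero>\<^bsub>E\<^esub>"
    using D_separates[of "x \<ominus>\<^bsub>H\<^esub> y"] assms(1,2) by auto
  have "g (x \<ominus>\<^bsub>H\<^esub> y) = g x \<ominus>\<^bsub>E\<^esub> g y"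
    by (rule module_hom_minus[OF H.module_axioms E_module D_hom[OF g(1)] assms(1,2)])
  then show False
    using g assms D_closed[OF g(1)] by (simp add: E.M.minus_eq_zero_iff)
qed

text \<open>By injectivity of \<open>E\<close> the orthogonal of \<open>0 :\<^sub>H (as)\<close> in \<open>D\<close> is \<open>(as) D\<close>.\<close>

lemma annihilated_orthogonal:
  assumes \<psi>: "\<psi> \<in> module_hom R D E" and as: "set as \<subseteq> carrier R"
    and kill: "\<And>a g. a \<in> set as \<Longrightarrow> g \<in> carrier D \<Longrightarrow> a \<odot>\<^bsub>E\<^esub> \<psi> g = \<zero>\<^bsub>E\<^esub>"
    and g: "g \<in> carrier D" "\<And>x. x \<in> annihilated R H (set as) \<Longrightarrow> g x = \<zero>\<^bsub>E\<^esub>"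
  shows "\<psi> g = \<zero>\<^bsub>E\<^esub>"
  using as kill g
proof (induction as arbitrary: g)
  case Nil
  have "g = \<zero>\<^bsub>D\<^esub>" by (rule D_eqI) (use Nil in \<open>auto simp: annihilated_def\<close>)
  then show ?case using module_hom_zero[OF D_module E_module \<psi>] by simp
next
  case (Cons a as)
  note \<psi>D = module_homD[OF \<psi>]
  have a: "a \<in> carrier R" and as: "set as \<subseteq> carrier R" using Cons.prems(1) by auto
  let ?H = "annihilated R H (set as)"
  have sub: "submodule ?H R H" by (rule H.submodule_annihilated[OF as])
  have Hm: "module R (H\<lparr>carrier := ?H\<rparr>)" by (rule H.submodule_module[OF sub])
  have f: "(\<lambda>x. a \<odot>\<^bsub>H\<^esub> x) \<in> module_hom R (H\<lparr>carrier := ?H\<rparr>) H"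
    using a H.submoduleD(2)[OF sub] by (intro module_homI) (simp_all add: H.smult_r_distr H.smult_comm)
  have gr: "g \<in> module_hom R (H\<lparr>carrier := ?H\<rparr>) E"
    by (rule module_hom_restrict[OF D_hom[OF Cons.prems(3)] H.submoduleD(1)[OF sub]])
  \<comment> \<open>On the elements killed by \<open>as\<close>, the functional \<open>g\<close>
    vanishes wherever \<open>a\<close> does, so it factors through multiplication by
    \<open>a\<close>. With \<open>h\<close> an extension of the factor, \<open>g\<close> minus
    \<open>a\<close> times \<open>h\<close> falls under the induction hypothesis, while
    \<open>a\<close> kills the value of \<open>\<psi>\<close> at \<open>h\<close>.\<close>
  have "\<exists>h\<in>module_hom R (H\<lparr>carrier := (\<lambda>x. a \<odot>\<^bsub>H\<^esub> x) ` ?H\<rparr>) E. \<forall>x\<in>?H. h (a \<odot>\<^bsub>H\<^esub> x) = g x"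
  proof -
    have "g x = \<zero>\<^bsub>E\<^esub>" if "x \<in> ?H" "a \<odot>\<^bsub>H\<^esub> x = \<zero>\<^bsub>H\<^esub>" for x
      using that by (intro Cons.prems(4)) (auto simp: annihilated_def)
    then show ?thesis using module_hom_factor[OF Hm H.module_axioms E_module f gr] by simp
  qed
  then obtain h0 where h0: "h0 \<in> module_hom R (H\<lparr>carrier := (\<lambda>x. a \<odot>\<^bsub>H\<^esub> x) ` ?H\<rparr>) E"
    "\<And>x. x \<in> ?H \<Longrightarrow> h0 (a \<odot>\<^bsub>H\<^esub> x) = g x" by blast
  have "submodule ((\<lambda>x. a \<odot>\<^bsub>H\<^esub> x) ` ?H) R H"
    using module_hom_image_submodule[OF Hm H.module_axioms f] by simp
  from D_extend[OF this h0(1)] obtain h where h: "h \<in> carrier D"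
    "\<And>x. x \<in> ?H \<Longrightarrow> h (a \<odot>\<^bsub>H\<^esub> x) = g x" using h0(2) by auto
  define g1 where "g1 = g \<oplus>\<^bsub>D\<^esub> (\<ominus> a) \<odot>\<^bsub>D\<^esub> h"
  have c: "g \<in> carrier D" "(\<ominus> a) \<odot>\<^bsub>D\<^esub> h \<in> carrier D" using Cons.prems(3) h(1) a by auto
  have "\<psi> g1 = \<zero>\<^bsub>E\<^esub>"
  proof (rule Cons.IH[OF as])
    show "b \<odot>\<^bsub>E\<^esub> \<psi> g' = \<zero>\<^bsub>E\<^esub>" if "b \<in> set as" "g' \<in> carrier D" for b g'
      using Cons.prems(2)[of b g'] that by simp
    show "g1 \<in> carrier D" unfolding g1_def using c by simp
    show "g1 x = \<zero>\<^bsub>E\<^esub>" if x: "x \<in> ?H" for x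
    proof -
      have xc: "x \<in> carrier H" by (rule annihilatedD(1)[OF x])
      have "g x = a \<odot>\<^bsub>E\<^esub> h x" using h(2)[OF x] D_smult[OF h(1) a xc] by simp
      then show ?thesis
        unfolding g1_def using xc a D_closed[OF h(1) xc] by (simp add: E.smult_l_minus E.M.r_neg)
    qed
  qed
  moreover have "\<psi> g1 = \<psi> g \<oplus>\<^bsub>E\<^esub> (\<ominus> a) \<odot>\<^bsub>E\<^esub> \<psi> h"
    unfolding g1_def using \<psi>D(2)[OF c] \<psi>D(3)[of "\<ominus> a" h] a h(1) by simp
  moreover have "(\<ominus> a) \<odot>\<^bsub>E\<^esub> \<psi> h = \<zero>\<^bsub>E\<^esub>"
    using Cons.prems(2)[of a h] \<psi>D(1)[OF h(1)] h(1) a by (simp add: E.smult_l_minus)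
  ultimately show ?case using \<psi>D(1)[OF c(1)] by simp
qed

text \<open>For a submodule \<open>A\<close> this is the dual of the quotient H/A, viewed inside
  \<open>D\<close>. Shrinking \<open>A\<close> along the adic filtration enlarges it.\<close>

definition orthogonal :: "'h set \<Rightarrow> ('h \<Rightarrow> 'e) set"
  where "orthogonal A = {g \<in> carrier D. \<forall>x\<in>A. g x = \<zero>\<^bsub>E\<^esub>}"

lemma orthogonalI:
  "g \<in> carrier D \<Longrightarrow> (\<And>x. x \<in> A \<Longrightarrow> g x = \<zero>\<^bsub>E\<^esub>) \<Longrightarrow> g \<in> orthogonal A"
  by (simp add: orthogonal_def)

lemma orthogonalD: "g \<in> orthogonal A \<Longrightarrow> g \<in> carrier D" "g \<in> orthogonal A \<Longrightarrow> x \<in> A \<Longrightarrow> g x = \<zero>\<^bsub>E\<^esub>"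
  by (simp_all add: orthogonal_def)

text \<open>Since the socle of \<open>E\<close> is one-dimensional, enlarging the domain of a functional by the dual
  of the simple module \<open>(A + Rz)/A\<close> changes the evaluating element by a multiple of \<open>z\<close>.\<close>

lemma evaluation_simple_step:
  assumes \<psi>: "\<psi> \<in> module_hom R D E" and A: "submodule A R H"
    and z: "z \<in> carrier H" "\<And>r. r \<in> \<mm> \<Longrightarrow> r \<odot>\<^bsub>H\<^esub> z \<in> A" and y: "y \<in> carrier H"
    and ev: "\<And>g. g \<in> orthogonal A \<Longrightarrow> g z = \<zero>\<^bsub>E\<^esub> \<Longrightarrow> \<psi> g = g y"
  shows "\<exists>c\<in>carrier R. \<forall>g\<in>orthogonal A. \<psi> g = g (y \<oplus>\<^bsub>H\<^esub> c \<odot>\<^bsub>H\<^esub> z)"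
proof -
  note \<psi>D = module_homD[OF \<psi>]
  note AD = H.submoduleD[OF A]
  \<comment> \<open>The error of evaluation at \<open>y\<close>. It vanishes on functionals that are
    zero at \<open>z\<close>, so on the orthogonal of \<open>A\<close> it depends on the value at
    \<open>z\<close> only, and like that value it lies in the socle of \<open>E\<close>.\<close>
  define \<theta> where "\<theta> g = \<psi> g \<ominus>\<^bsub>E\<^esub> g y" for g
  have \<theta>c: "\<theta> g \<in> carrier E" if "g \<in> carrier D" for g
    using \<psi>D(1)[OF that] D_closed[OF that y] by (simp add: \<theta>_def)
  have \<theta>_add: "\<theta> (g \<oplus>\<^bsub>D\<^esub> h) = \<theta> g \<oplus>\<^bsub>E\<^esub> \<theta> h" if "g \<in> carrier D" "h \<in> carrier D" for g h
    using that \<psi>D(1,2) D_closed y by (simp add: \<theta>_def E.M.add_minus_add)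
  have \<theta>_smult: "\<theta> (a \<odot>\<^bsub>D\<^esub> g) = a \<odot>\<^bsub>E\<^esub> \<theta> g" if "a \<in> carrier R" "g \<in> carrier D" for a g
    using that \<psi>D(1,3) D_closed y by (simp add: \<theta>_def E.smult_minus_right)
  have \<theta>0: "\<theta> g = \<zero>\<^bsub>E\<^esub>" if g: "g \<in> orthogonal A" "g z = \<zero>\<^bsub>E\<^esub>" for g
    using ev[OF g] \<psi>D(1) D_closed[OF _ y] orthogonalD(1)[OF g(1)]
    by (simp add: \<theta>_def E.M.minus_eq_zero_iff)
  have \<theta>E: "\<psi> g = g y \<oplus>\<^bsub>E\<^esub> \<theta> g" if "g \<in> carrier D" for g
    using \<psi>D(1)[OF that] D_closed[OF that y] by (simp add: \<theta>_def E.M.minus_add_cancel)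
  have orth_smult: "a \<odot>\<^bsub>D\<^esub> g \<in> orthogonal A" if "a \<in> carrier R" "g \<in> orthogonal A" for a g
    using that AD(2) by (intro orthogonalI) (auto simp: orthogonal_def)
  have kill: "r \<odot>\<^bsub>E\<^esub> g z = \<zero>\<^bsub>E\<^esub>" if "r \<in> \<mm>" "g \<in> orthogonal A" for r g
  proof -
    have "r \<in> carrier R" using \<mm>D(1) that(1) by blast
    then have "r \<odot>\<^bsub>E\<^esub> g z = g (r \<odot>\<^bsub>H\<^esub> z)" using D_smult[OF orthogonalD(1)[OF that(2)] _ z(1)] by simp
    then show ?thesis using orthogonalD(2)[OF that(2) z(2)[OF that(1)]] by simp
  qed
  have gz: "g z \<in> annihilated R E \<mm>" if g: "g \<in> orthogonal A" for g
    using kill[OF _ g] D_closed[OF orthogonalD(1)[OF g] z(1)] by (intro annihilatedI)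
  have \<theta>g: "\<theta> g \<in> annihilated R E \<mm>" if g: "g \<in> orthogonal A" for g
  proof (rule annihilatedI)
    show "\<theta> g \<in> carrier E" by (rule \<theta>c[OF orthogonalD(1)[OF g]])
    fix r assume r: "r \<in> \<mm>"
    have rc: "r \<in> carrier R" using \<mm>D(1) r by blast
    have "\<theta> (r \<odot>\<^bsub>D\<^esub> g) = \<zero>\<^bsub>E\<^esub>" using kill[OF r g] z(1) by (intro \<theta>0 orth_smult[OF rc g]) simp
    then show "r \<odot>\<^bsub>E\<^esub> \<theta> g = \<zero>\<^bsub>E\<^esub>" using \<theta>_smult[OF rc orthogonalD(1)[OF g]] by simp
  qed
  show ?thesis
  proof (cases "\<forall>g\<in>orthogonal A. g z = \<zero>\<^bsub>E\<^esub>")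
    case True
    then show ?thesis using ev y z(1) by (intro bexI[of _ \<zero>]) auto
  next
    case False
    then obtain g0 where g0: "g0 \<in> orthogonal A" "g0 z \<noteq> \<zero>\<^bsub>E\<^esub>" by blast
    \<comment> \<open>A single \<open>g0\<close> that is nonzero at \<open>z\<close> fixes the
      correction: every other value at \<open>z\<close> is a multiple of \<open>g0 z\<close>, and
      the errors are the same multiples of \<open>\<theta> g0\<close>.\<close>
    obtain c where c: "c \<in> carrier R" "\<theta> g0 = c \<odot>\<^bsub>E\<^esub> g0 z"
      using socle_multiple[OF gz[OF g0(1)] g0(2) \<theta>g[OF g0(1)]] by blast
    have "\<psi> g = g (y \<oplus>\<^bsub>H\<^esub> c \<odot>\<^bsub>H\<^esub> z)" if g: "g \<in> orthogonal A" for g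
    proof -
      obtain b where b: "b \<in> carrier R" "g z = b \<odot>\<^bsub>E\<^esub> g0 z"
        using socle_multiple[OF gz[OF g0(1)] g0(2) gz[OF g]] by blast
      note gc = orthogonalD(1)[OF g] and g0c = orthogonalD(1)[OF g0(1)]
      define h where "h = g \<oplus>\<^bsub>D\<^esub> (\<ominus> b) \<odot>\<^bsub>D\<^esub> g0"
      have bc: "(\<ominus> b) \<odot>\<^bsub>D\<^esub> g0 \<in> carrier D" using b(1) g0c by simp
      have "h \<in> orthogonal A"
      proof (rule orthogonalI)
        show "h \<in> carrier D" unfolding h_def using gc bc by simp
        show "h x = \<zero>\<^bsub>E\<^esub>" if "x \<in> A" for x
          using orthogonalD(2)[OF g that] orthogonalD(2)[OF g0(1) that] AD(2)[OF that] b(1)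
          by (simp add: h_def)
      qed
      moreover have "h z = \<zero>\<^bsub>E\<^esub>"
        using z(1) b D_closed[OF g0c z(1)] by (simp add: h_def E.smult_l_minus E.M.r_neg)
      ultimately have "\<theta> h = \<zero>\<^bsub>E\<^esub>" by (rule \<theta>0)
      then have "\<theta> g \<ominus>\<^bsub>E\<^esub> b \<odot>\<^bsub>E\<^esub> \<theta> g0 = \<zero>\<^bsub>E\<^esub>"
        unfolding h_def \<theta>_add[OF gc bc] using \<theta>_smult[of "\<ominus> b" g0] b(1) g0c \<theta>c[OF g0c]
        by (simp add: E.smult_l_minus a_minus_def)
      then have "\<theta> g = b \<odot>\<^bsub>E\<^esub> \<theta> g0" using \<theta>c[OF gc] \<theta>c[OF g0c] b(1) by (simp add: E.M.minus_eq_zero_iff)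
      also have "\<dots> = c \<odot>\<^bsub>E\<^esub> g z"
        unfolding c(2) b(2) using b(1) c(1) D_closed[OF g0c z(1)] by (rule E.smult_comm)
      also have "\<dots> = g (c \<odot>\<^bsub>H\<^esub> z)" using D_smult[OF gc c(1) z(1)] by simp
      finally show ?thesis using \<theta>E[OF gc] D_add[OF gc y, of "c \<odot>\<^bsub>H\<^esub> z"] c(1) z(1) by simp
    qed
    then show ?thesis using c(1) by blast
  qed
qed

text \<open>One element \<open>z\<close> is added to \<open>A\<close> at a time. The induction
  hypothesis treats the larger submodule with the remaining elements, and the simple step then
  returns to \<open>A\<close> at the cost of a multiple of \<open>z\<close>.\<close>

lemma evaluation_step:
  assumes \<psi>: "\<psi> \<in> module_hom R D E" and A: "submodule A R H"
    and zs: "set zs \<subseteq> carrier H" "\<And>z r. z \<in> set zs \<Longrightarrow> r \<in> \<mm> \<Longrightarrow> r \<odot>\<^bsub>H\<^esub> z \<in> A"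
    and y: "y \<in> carrier H"
    and ev: "\<And>g. g \<in> orthogonal A \<Longrightarrow> (\<And>z. z \<in> set zs \<Longrightarrow> g z = \<zero>\<^bsub>E\<^esub>) \<Longrightarrow> \<psi> g = g y"
  shows "\<exists>c\<in>H.lspan zs. \<forall>g\<in>orthogonal A. \<psi> g = g (y \<oplus>\<^bsub>H\<^esub> c)"
  using A zs ev
proof (induction zs arbitrary: A)
  case Nil
  then show ?case using y by auto
next
  case (Cons z zs)
  have z: "z \<in> carrier H" and zs: "set zs \<subseteq> carrier H" using Cons.prems(2) by auto
  note AD = H.submoduleD[OF Cons.prems(1)]
  define A1 where "A1 = {a \<oplus>\<^bsub>H\<^esub> b | a b. a \<in> A \<and> b \<in> H.lspan [z]}"
  have sub1: "submodule A1 R H"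
    unfolding A1_def using z by (intro H.submodule_add Cons.prems(1) H.span_submodule) simp
  have A_A1: "A \<subseteq> A1"
  proof
    fix a assume "a \<in> A"
    moreover have "\<zero>\<^bsub>H\<^esub> \<in> H.lspan [z]" using z by (intro H.submoduleD(3) H.span_submodule) simp
    moreover have "a = a \<oplus>\<^bsub>H\<^esub> \<zero>\<^bsub>H\<^esub>" using AD(2)[OF \<open>a \<in> A\<close>] by simp
    ultimately show "a \<in> A1" unfolding A1_def by blast
  qed
  have z_A1: "z \<in> A1"
  proof -
    have "z = \<zero>\<^bsub>H\<^esub> \<oplus>\<^bsub>H\<^esub> z" "z \<in> H.lspan [z]" using z H.span_gen[of "[z]"] by auto
    then show ?thesis unfolding A1_def using AD(3) by blast
  qed
  have "\<exists>c\<in>H.lspan zs. \<forall>g\<in>orthogonal A1. \<psi> g = g (y \<oplus>\<^bsub>H\<^esub> c)"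
  proof (rule Cons.IH[OF sub1 zs])
    show "r \<odot>\<^bsub>H\<^esub> z' \<in> A1" if "z' \<in> set zs" "r \<in> \<mm>" for z' r
      using Cons.prems(3)[of z' r] that A_A1 by auto
    show "\<psi> g = g y" if g: "g \<in> orthogonal A1" "\<And>z'. z' \<in> set zs \<Longrightarrow> g z' = \<zero>\<^bsub>E\<^esub>" for g
    proof (rule Cons.prems(4))
      show "g \<in> orthogonal A" using g(1) A_A1 by (auto simp: orthogonal_def)
      show "g z' = \<zero>\<^bsub>E\<^esub>" if "z' \<in> set (z # zs)" for z'
        using that g(2) orthogonalD(2)[OF g(1) z_A1] by auto
    qed
  qed
  then obtain c1 where c1: "c1 \<in> H.lspan zs" "\<And>g. g \<in> orthogonal A1 \<Longrightarrow> \<psi> g = g (y \<oplus>\<^bsub>H\<^esub> c1)" by blast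
  have c1c: "c1 \<in> carrier H" by (rule H.lcomb_closed[OF oneideal zs c1(1)])
  have "\<exists>c\<in>carrier R. \<forall>g\<in>orthogonal A. \<psi> g = g ((y \<oplus>\<^bsub>H\<^esub> c1) \<oplus>\<^bsub>H\<^esub> c \<odot>\<^bsub>H\<^esub> z)"
  proof (rule evaluation_simple_step[OF \<psi> Cons.prems(1) z])
    show "r \<odot>\<^bsub>H\<^esub> z \<in> A" if "r \<in> \<mm>" for r using Cons.prems(3)[of z r] that by simp
    show "y \<oplus>\<^bsub>H\<^esub> c1 \<in> carrier H" using y c1c by simp
    fix g assume g: "g \<in> orthogonal A" "g z = \<zero>\<^bsub>E\<^esub>"
    note gc = orthogonalD(1)[OF g(1)]
    have "g \<in> orthogonal A1"
    proof (rule orthogonalI[OF gc])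
      fix x assume "x \<in> A1"
      then obtain a b where x: "x = a \<oplus>\<^bsub>H\<^esub> b" "a \<in> A" "b \<in> H.lspan [z]" unfolding A1_def by blast
      then obtain r where r: "r \<in> carrier R" "b = r \<odot>\<^bsub>H\<^esub> z" using z by auto
      show "g x = \<zero>\<^bsub>E\<^esub>"
        unfolding x(1) r(2) using D_add[OF gc AD(2)[OF x(2)], of "r \<odot>\<^bsub>H\<^esub> z"] D_smult[OF gc r(1) z]
          orthogonalD(2)[OF g(1) x(2)] g(2) r(1) z by simp
    qed
    then show "\<psi> g = g (y \<oplus>\<^bsub>H\<^esub> c1)" by (rule c1(2))
  qed
  then obtain c where c: "c \<in> carrier R"
    "\<And>g. g \<in> orthogonal A \<Longrightarrow> \<psi> g = g ((y \<oplus>\<^bsub>H\<^esub> c1) \<oplus>\<^bsub>H\<^esub> c \<odot>\<^bsub>H\<^esub> z)" by blast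
  have "(y \<oplus>\<^bsub>H\<^esub> c1) \<oplus>\<^bsub>H\<^esub> c \<odot>\<^bsub>H\<^esub> z = y \<oplus>\<^bsub>H\<^esub> (c \<odot>\<^bsub>H\<^esub> z \<oplus>\<^bsub>H\<^esub> c1)"
    using y c1c c(1) z by (simp add: H.M.a_ac)
  then show ?case using c(2) lcomb_ConsI[OF c(1) c1(1)] by metis
qed

text \<open>Each of the finitely many values of \<open>g\<close> on \<open>es\<close> is killed by a
  power of \<open>\<mm>\<close>; the sum of the exponents serves all of them.\<close>

lemma eventually_orthogonal:
  assumes g: "g \<in> carrier D" and es: "set es \<subseteq> carrier H"
  shows "\<exists>n. g \<in> orthogonal (lcomb R H (mp n) es)"
  using es
proof (induction es)
  case Nil
  then show ?case using g D_zero[OF g] by (auto simp: orthogonal_def)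
next
  case (Cons e es)
  have e: "e \<in> carrier H" and es: "set es \<subseteq> carrier H" using Cons.prems by auto
  obtain m where m: "g \<in> orthogonal (lcomb R H (mp m) es)" using Cons.IH[OF es] by blast
  obtain k where k: "\<And>s. s \<in> mp k \<Longrightarrow> s \<odot>\<^bsub>E\<^esub> g e = \<zero>\<^bsub>E\<^esub>"
    using maximal_power_kills[OF D_closed[OF g e]] by blast
  have "g \<in> orthogonal (lcomb R H (mp (m + k)) (e # es))"
  proof (rule orthogonalI[OF g])
    fix x assume "x \<in> lcomb R H (mp (m + k)) (e # es)"
    then obtain c v where x: "c \<in> mp (m + k)" "v \<in> lcomb R H (mp (m + k)) es" "x = c \<odot>\<^bsub>H\<^esub> e \<oplus>\<^bsub>H\<^esub> v"
      by auto
    have c: "c \<in> mp k" "c \<in> carrier R"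
      using x(1) ideal_pow_antimono[OF maximal_ideal, of k "m + k"] mpD(1) by auto
    have v: "v \<in> lcomb R H (mp m) es"
      using x(2) H.lcomb_mono[OF ideal_pow_antimono[OF maximal_ideal, of m "m + k"]] by auto
    have vc: "v \<in> carrier H" by (rule H.lcomb_closed[OF mp_ideal es v])
    show "g x = \<zero>\<^bsub>E\<^esub>"
      unfolding x(3) using D_add[OF g _ vc, of "c \<odot>\<^bsub>H\<^esub> e"] D_smult[OF g c(2) e] k[OF c(1)]
        orthogonalD(2)[OF m v] c(2) e by simp
  qed
  then show ?case by blast
qed

text \<open>The evaluating element is the \<open>\<mm>\<close>-adic limit of elements that work modulo \<open>\<mm>\<^sup>n\<close>.\<close>

lemma finitely_generated_reflexive:
  assumes \<psi>: "\<psi> \<in> module_hom R D E" and es: "set es \<subseteq> carrier H"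
    and vanish: "\<And>g. g \<in> orthogonal (H.lspan es) \<Longrightarrow> \<psi> g = \<zero>\<^bsub>E\<^esub>"
  shows "\<exists>y\<in>H.lspan es. \<forall>g\<in>carrier D. \<psi> g = g y"
proof -
  let ?A = "\<lambda>n. lcomb R H (mp n) es"
  \<comment> \<open>\<open>P n y\<close> says that \<open>y\<close> represents \<open>\<psi>\<close>
    on the functionals vanishing on the n-th step of the filtration of the span.\<close>
  define P where "P n y \<longleftrightarrow> y \<in> carrier H \<and> (\<forall>g\<in>orthogonal (?A n). \<psi> g = g y)" for n y
  have sub: "submodule (?A n) R H" for n by (rule H.lcomb_submodule[OF mp_ideal es])
  have step: "\<exists>c\<in>?A n. P (Suc n) (y \<oplus>\<^bsub>H\<^esub> c)" if y: "P n y" for n y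
  proof -
    have "\<exists>zs. set zs \<subseteq> ?A n \<and> ?A n \<subseteq> H.lspan zs \<and> (\<forall>z\<in>set zs. \<forall>r\<in>\<mm>. r \<odot>\<^bsub>H\<^esub> z \<in> ?A (Suc n))"
    proof (rule ideal_multiple_generators[OF H.module_axioms es mp_ideal mp_ideal])
      fix r s assume r: "r \<in> \<mm>" and s: "s \<in> mp n"
      have "s \<otimes> r \<in> mp (Suc n)" unfolding ideal_pow_Suc by (rule ideal_prod.prod[OF s r])
      moreover have "r \<in> carrier R" "s \<in> carrier R" using r s \<mm>D(1) mpD(1) by blast+
      ultimately show "r \<otimes> s \<in> mp (Suc n)" by (simp add: m_comm del: nat_pow_Suc)
    qed
    then obtain zs where zs: "set zs \<subseteq> ?A n" "?A n \<subseteq> H.lspan zs"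
      "\<And>z r. z \<in> set zs \<Longrightarrow> r \<in> \<mm> \<Longrightarrow> r \<odot>\<^bsub>H\<^esub> z \<in> ?A (Suc n)" by blast
    have zsc: "set zs \<subseteq> carrier H" using zs(1) H.submoduleD(1)[OF sub] by blast
    have yc: "y \<in> carrier H" using y by (simp add: P_def)
    have "\<exists>c\<in>H.lspan zs. \<forall>g\<in>orthogonal (?A (Suc n)). \<psi> g = g (y \<oplus>\<^bsub>H\<^esub> c)"
    proof (rule evaluation_step[OF \<psi> sub zsc zs(3) yc])
      fix g assume g: "g \<in> orthogonal (?A (Suc n))" "\<And>z. z \<in> set zs \<Longrightarrow> g z = \<zero>\<^bsub>E\<^esub>"
      note gc = orthogonalD(1)[OF g(1)]
      have "submodule {x \<in> carrier H. g x = \<zero>\<^bsub>E\<^esub>} R H"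
        by (rule H.submoduleI2) (auto simp: D_add[OF gc] D_smult[OF gc] D_zero[OF gc])
      then have "H.lspan zs \<subseteq> {x \<in> carrier H. g x = \<zero>\<^bsub>E\<^esub>}"
        using g(2) zsc by (intro H.span_minimal) auto
      then have "g \<in> orthogonal (?A n)" using zs(2) gc by (intro orthogonalI) auto
      then show "\<psi> g = g y" using y by (simp add: P_def)
    qed
    then obtain c where c: "c \<in> H.lspan zs" "\<forall>g\<in>orthogonal (?A (Suc n)). \<psi> g = g (y \<oplus>\<^bsub>H\<^esub> c)" by blast
    have "c \<in> ?A n" using H.span_minimal[OF sub zs(1)] c(1) by blast
    moreover have "P (Suc n) (y \<oplus>\<^bsub>H\<^esub> c)"
      unfolding P_def using c(2) yc H.submoduleD(2)[OF sub \<open>c \<in> ?A n\<close>] by simp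
    ultimately show ?thesis by blast
  qed
  \<comment> \<open>The zeroth power of \<open>\<mm>\<close> is the whole ring, so the zeroth step
    is the span itself, on whose orthogonal \<open>\<psi>\<close> vanishes by assumption.\<close>
  have "P 0 \<zero>\<^bsub>H\<^esub>"
    unfolding P_def
  proof (intro conjI ballI)
    fix g assume "g \<in> orthogonal (?A 0)"
    then have "g \<in> orthogonal (H.lspan es)" by (simp only: ideal_pow_0)
    then show "\<psi> g = g \<zero>\<^bsub>H\<^esub>" using vanish D_zero[OF orthogonalD(1)] by simp
  qed simp
  from step obtain C where C: "\<And>n y. P n y \<Longrightarrow> C n y \<in> ?A n \<and> P (Suc n) (y \<oplus>\<^bsub>H\<^esub> C n y)" by metis
  define Y where "Y = rec_nat \<zero>\<^bsub>H\<^esub> (\<lambda>n y. y \<oplus>\<^bsub>H\<^esub> C n y)"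
  have Y: "P n (Y n)" for n
    by (induction n) (use C \<open>P 0 \<zero>\<^bsub>H\<^esub>\<close> in \<open>simp_all add: Y_def\<close>)
  define \<delta> where "\<delta> n = C n (Y n)" for n
  have psum: "psum H \<delta> n = Y n" for n
    by (induction n) (simp_all add: Y_def \<delta>_def)
  have "\<delta> n \<in> ?A n" for n using C[OF Y] by (simp add: \<delta>_def)
  from series_converges_lcomb[OF H.module_axioms es this]
  obtain y where y: "y \<in> H.lspan es" "\<And>n. y \<ominus>\<^bsub>H\<^esub> Y n \<in> ?A n" unfolding psum by blast
  have yc: "y \<in> carrier H" by (rule H.lcomb_closed[OF oneideal es y(1)])
  \<comment> \<open>The limit and the n-th approximation differ by an element of the n-th step, and
    \<open>g\<close> vanishes there for suitable \<open>n\<close>.\<close>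
  have "\<psi> g = g y" if g: "g \<in> carrier D" for g
  proof -
    obtain n where n: "g \<in> orthogonal (?A n)" using eventually_orthogonal[OF g es] by blast
    have Yc: "Y n \<in> carrier H" using Y[of n] by (simp add: P_def)
    have "g (y \<ominus>\<^bsub>H\<^esub> Y n) = \<zero>\<^bsub>E\<^esub>" by (rule orthogonalD(2)[OF n y(2)])
    then have "g y = g (Y n)"
      using module_hom_minus[OF H.module_axioms E_module D_hom[OF g] yc Yc] D_closed[OF g yc] D_closed[OF g Yc]
      by (simp add: E.M.minus_eq_zero_iff)
    then show ?thesis using Y[of n] n by (simp add: P_def)
  qed
  then show ?thesis using y(1) by blast
qed

section \<open>The map induced by duality on endomorphisms\<close>

lemma dual_map_sel:
  "g \<in> carrier D \<Longrightarrow> x \<in> carrier H \<Longrightarrow> matlis_dual_map R E H H f g x = g (f x)"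
  by (simp add: matlis_dual_map_def compose_def)

lemma dual_map_closed:
  assumes "f \<in> module_hom R H H" "g \<in> carrier D"
  shows "matlis_dual_map R E H H f g \<in> carrier D"
proof -
  note fD = module_homD[OF assms(1)] and gD = module_homD[OF D_hom[OF assms(2)]]
  have "(\<lambda>x. g (f x)) \<in> module_hom R H E"
    by (rule module_homI) (simp_all add: fD gD)
  then show ?thesis
    using restrict_Hom_module[OF H.module_axioms] assms(2)
    by (simp add: matlis_dual_map_def compose_def matlis_dual_def)
qed

lemma dual_map_hom:
  "matlis_dual_map R E H H \<in> module_hom R (Hom_module R H H) (Hom_module R D D)"
proof -
  let ?d = "matlis_dual_map R E H H" and ?E = "Hom_module R H H" and ?F = "Hom_module R D D"
  have DD_sel: "(\<phi> \<oplus>\<^bsub>?F\<^esub> \<phi>') g = \<phi> g \<oplus>\<^bsub>D\<^esub> \<phi>' g" "(a \<odot>\<^bsub>?F\<^esub> \<phi>) g = a \<odot>\<^bsub>D\<^esub> \<phi> g"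
    if "g \<in> carrier D" for \<phi> \<phi>' g a
    using that by (simp_all add: Hom_module_sel)
  have hom: "f \<in> module_hom R H H" if "f \<in> carrier ?E" for f
    using that by (simp add: Hom_module_sel)
  note cl = dual_map_closed[OF hom]
  have d: "?d f \<in> carrier ?F" if f: "f \<in> carrier ?E" for f
  proof -
    note fD = module_homD[OF hom[OF f]]
    have "?d f \<in> module_hom R D D"
    proof (rule module_homI)
      fix g assume g: "g \<in> carrier D"
      show "?d f g \<in> carrier D" by (rule cl[OF f g])
      show "?d f (g \<oplus>\<^bsub>D\<^esub> h) = ?d f g \<oplus>\<^bsub>D\<^esub> ?d f h" if h: "h \<in> carrier D" for h
        by (rule D_eqI) (use f g h fD(1) cl in \<open>simp_all add: dual_map_sel\<close>)
      show "?d f (a \<odot>\<^bsub>D\<^esub> g) = a \<odot>\<^bsub>D\<^esub> ?d f g" if a: "a \<in> carrier R" for a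
        by (rule D_eqI) (use f g a fD(1) cl in \<open>simp_all add: dual_map_sel\<close>)
    qed
    moreover have "?d f \<in> extensional (carrier D)" by (simp add: matlis_dual_map_def)
    ultimately show ?thesis by (simp add: Hom_module_sel)
  qed
  note Ecl = Hom_module_closed[OF H.module_axioms H.module_axioms]
    and Fcl = Hom_module_closed[OF D_module D_module]
  show ?thesis
  proof (rule module_homI)
    fix f assume f: "f \<in> carrier ?E"
    note fD = module_homD[OF hom[OF f]]
    show "?d f \<in> carrier ?F" by (rule d[OF f])
    show "?d (f \<oplus>\<^bsub>?E\<^esub> f') = ?d f \<oplus>\<^bsub>?F\<^esub> ?d f'" if f': "f' \<in> carrier ?E" for f'
    proof (rule Hom_module_eqI[OF d[OF Ecl(1)[OF f f']] Fcl(1)[OF d[OF f] d[OF f']]])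
      fix g assume g: "g \<in> carrier D"
      note f'D = module_homD[OF hom[OF f']]
      have "?d (f \<oplus>\<^bsub>?E\<^esub> f') g = ?d f g \<oplus>\<^bsub>D\<^esub> ?d f' g"
      proof (rule D_eqI)
        show "?d (f \<oplus>\<^bsub>?E\<^esub> f') g \<in> carrier D" by (rule cl[OF Ecl(1)[OF f f'] g])
        show "?d f g \<oplus>\<^bsub>D\<^esub> ?d f' g \<in> carrier D" using cl[OF f g] cl[OF f' g] by simp
        fix x assume x: "x \<in> carrier H"
        then show "?d (f \<oplus>\<^bsub>?E\<^esub> f') g x = (?d f g \<oplus>\<^bsub>D\<^esub> ?d f' g) x"
          using g fD(1) f'D(1) D_add[OF g] by (simp add: dual_map_sel) (simp add: Hom_module_sel)
      qed
      then show "?d (f \<oplus>\<^bsub>?E\<^esub> f') g = (?d f \<oplus>\<^bsub>?F\<^esub> ?d f') g" using g by (simp add: DD_sel)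
    qed
    show "?d (a \<odot>\<^bsub>?E\<^esub> f) = a \<odot>\<^bsub>?F\<^esub> ?d f" if a: "a \<in> carrier R" for a
    proof (rule Hom_module_eqI[OF d[OF Ecl(2)[OF a f]] Fcl(2)[OF a d[OF f]]])
      fix g assume g: "g \<in> carrier D"
      have "?d (a \<odot>\<^bsub>?E\<^esub> f) g = a \<odot>\<^bsub>D\<^esub> ?d f g"
      proof (rule D_eqI)
        show "?d (a \<odot>\<^bsub>?E\<^esub> f) g \<in> carrier D" by (rule cl[OF Ecl(2)[OF a f] g])
        show "a \<odot>\<^bsub>D\<^esub> ?d f g \<in> carrier D" using cl[OF f g] a by simp
        fix x assume x: "x \<in> carrier H"
        then show "?d (a \<odot>\<^bsub>?E\<^esub> f) g x = (a \<odot>\<^bsub>D\<^esub> ?d f g) x"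
          using g a fD(1) D_smult[OF g a] by (simp add: dual_map_sel) (simp add: Hom_module_sel)
      qed
      then show "?d (a \<odot>\<^bsub>?E\<^esub> f) g = (a \<odot>\<^bsub>?F\<^esub> ?d f) g" using g by (simp add: DD_sel)
    qed
  qed
qed

lemma dual_map_iso:
  assumes cofinite: "\<And>x. x \<in> carrier H \<Longrightarrow> \<exists>ys. set ys \<subseteq> annihilated R H (annihilator R H x) \<and>
      annihilated R H (annihilator R H x) \<subseteq> H.lspan ys"
  shows "matlis_dual_map R E H H \<in> module_iso R (Hom_module R H H) (Hom_module R D D)"
proof -
  let ?d = "matlis_dual_map R E H H" and ?E = "Hom_module R H H" and ?F = "Hom_module R D D"
  have inj: "inj_on ?d (carrier ?E)"
  proof (rule inj_onI)
    fix f f' assume f: "f \<in> carrier ?E" "f' \<in> carrier ?E" and eq: "?d f = ?d f'"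
    show "f = f'"
    proof (rule Hom_module_eqI[OF f])
      fix x assume x: "x \<in> carrier H"
      have c: "f x \<in> carrier H" "f' x \<in> carrier H"
        using f x module_homD(1)[of f R H H] module_homD(1)[of f' R H H] by (simp_all add: Hom_module_sel)
      show "f x = f' x"
      proof (rule D_separates_eq[OF c])
        fix g assume g: "g \<in> carrier D"
        show "g (f x) = g (f' x)" using dual_map_sel[OF g x, of f] dual_map_sel[OF g x, of f'] eq by simp
      qed
    qed
  qed
  have surj: "\<exists>f\<in>carrier ?E. \<phi> = ?d f" if \<phi>: "\<phi> \<in> carrier ?F" for \<phi>
  proof -
    have \<phi>_hom: "\<phi> \<in> module_hom R D D" using \<phi> by (simp add: Hom_module_sel)
    note \<phi>D = module_homD[OF \<phi>_hom]
    have "\<exists>y\<in>carrier H. \<forall>g\<in>carrier D. \<phi> g x = g y" if x: "x \<in> carrier H" for x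
    proof -
      define \<psi> where "\<psi> g = \<phi> g x" for g
      have \<psi>: "\<psi> \<in> module_hom R D E"
        unfolding \<psi>_def using x by (intro module_homI) (simp_all add: \<phi>D D_closed)
      have a: "ideal (annihilator R H x) R" unfolding annihilator_def by (rule H.annihilator_ideal[OF x])
      obtain as where as: "set as \<subseteq> carrier R"
        "annihilator R H x = lcomb R (regular_module R) (carrier R) as"
        using noetherian_ideal_span[OF noetherian a] by blast
      interpret reg: module R "regular_module R" by (rule regular_module)
      have as_ann: "set as \<subseteq> annihilator R H x" using reg.span_gen[of as] as by simp
      have ann: "annihilated R H (annihilator R H x) = annihilated R H (set as)"
        unfolding as(2) by (rule H.annihilated_span[OF as(1)])
      obtain ys where ys: "set ys \<subseteq> annihilated R H (set as)" "annihilated R H (set as) \<subseteq> H.lspan ys"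
        using cofinite[OF x] unfolding ann by blast
      have ysc: "set ys \<subseteq> carrier H" using ys(1) by (auto simp: annihilated_def)
      \<comment> \<open>A scalar killing \<open>x\<close> also kills \<open>\<psi>\<close>, by
        linearity of each \<open>\<phi> h\<close>. So \<open>\<psi>\<close> sees only the
        restriction to elements killed by \<open>as\<close>, all of which lie in the span of
        \<open>ys\<close>.\<close>
      have "\<psi> g = \<zero>\<^bsub>E\<^esub>" if g: "g \<in> orthogonal (H.lspan ys)" for g
      proof (rule annihilated_orthogonal[OF \<psi> as(1) _ orthogonalD(1)[OF g]])
        show "g z = \<zero>\<^bsub>E\<^esub>" if "z \<in> annihilated R H (set as)" for z
          using orthogonalD(2)[OF g] ys(2) that by blast
        fix b h assume b: "b \<in> set as" and h: "h \<in> carrier D"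
        have bc: "b \<in> carrier R" "b \<odot>\<^bsub>H\<^esub> x = \<zero>\<^bsub>H\<^esub>" using as_ann b by (auto simp: annihilator_def)
        show "b \<odot>\<^bsub>E\<^esub> \<psi> h = \<zero>\<^bsub>E\<^esub>"
          unfolding \<psi>_def using D_smult[OF \<phi>D(1)[OF h] bc(1) x] bc(2) D_zero[OF \<phi>D(1)[OF h]] by simp
      qed
      from finitely_generated_reflexive[OF \<psi> ysc this]
      obtain y where y: "y \<in> H.lspan ys" "\<forall>g\<in>carrier D. \<psi> g = g y" by blast
      have "y \<in> carrier H" by (rule H.lcomb_closed[OF oneideal ysc y(1)])
      then show ?thesis using y(2) by (auto simp: \<psi>_def)
    qed
    then obtain f where f: "\<And>x. x \<in> carrier H \<Longrightarrow> f x \<in> carrier H"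
      "\<And>x g. x \<in> carrier H \<Longrightarrow> g \<in> carrier D \<Longrightarrow> g (f x) = \<phi> g x" by metis
    \<comment> \<open>The values of \<open>f\<close> were chosen point by point. Linearity is
      recovered by testing with \<open>D\<close>: each composite of \<open>g\<close> with
      \<open>f\<close> is the linear functional \<open>\<phi> g\<close>, and functionals separate
      points.\<close>
    have hom: "f \<in> module_hom R H H"
    proof (rule module_homI)
      fix x assume x: "x \<in> carrier H"
      show "f x \<in> carrier H" by (rule f(1)[OF x])
      show "f (x \<oplus>\<^bsub>H\<^esub> y) = f x \<oplus>\<^bsub>H\<^esub> f y" if y: "y \<in> carrier H" for y
      proof (rule D_separates_eq)
        fix g assume g: "g \<in> carrier D"
        show "g (f (x \<oplus>\<^bsub>H\<^esub> y)) = g (f x \<oplus>\<^bsub>H\<^esub> f y)"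
          using f(2)[OF _ g, of "x \<oplus>\<^bsub>H\<^esub> y"] f(2)[OF x g] f(2)[OF y g] x y
            D_add[OF g f(1)[OF x] f(1)[OF y]] D_add[OF \<phi>D(1)[OF g] x y] by simp
      qed (use x y f(1) in simp_all)
      show "f (a \<odot>\<^bsub>H\<^esub> x) = a \<odot>\<^bsub>H\<^esub> f x" if a: "a \<in> carrier R" for a
      proof (rule D_separates_eq)
        fix g assume g: "g \<in> carrier D"
        show "g (f (a \<odot>\<^bsub>H\<^esub> x)) = g (a \<odot>\<^bsub>H\<^esub> f x)"
          using f(2)[OF _ g, of "a \<odot>\<^bsub>H\<^esub> x"] f(2)[OF x g] x a
            D_smult[OF g a f(1)[OF x]] D_smult[OF \<phi>D(1)[OF g] a x] by simp
      qed (use x a f(1) in simp_all)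
    qed
    let ?f = "restrict f (carrier H)"
    have fE: "?f \<in> carrier ?E" by (rule restrict_Hom_module[OF H.module_axioms hom])
    have fhom: "?f \<in> module_hom R H H" using fE by (simp add: Hom_module_sel)
    have "\<phi> = ?d ?f"
    proof (rule Hom_module_eqI[OF \<phi>])
      show "?d ?f \<in> carrier ?F" by (rule module_homD(1)[OF dual_map_hom fE])
      fix g assume g: "g \<in> carrier D"
      show "\<phi> g = ?d ?f g"
        by (rule D_eqI[OF \<phi>D(1)[OF g] dual_map_closed[OF fhom g]]) (simp add: dual_map_sel g f(2)[OF _ g])
    qed
    then show ?thesis using fE by blast
  qed
  have "?d ` carrier ?E = carrier ?F"
    using module_homD(1)[OF dual_map_hom] surj by blast
  then show ?thesis using dual_map_hom inj by (simp add: module_iso_def bij_betw_def)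
qed

end

theorem theorem3p5:
  fixes R :: "('r, 'q) ring_scheme" and \<mm> I J :: "'r set"
    and M :: "('r, 'm) module"
    and E :: "('r, 'e) module" and \<iota> :: "'r set \<Rightarrow> 'e"
    and Q :: "nat \<Rightarrow> ('r, 'i) module" and d :: "nat \<Rightarrow> 'i \<Rightarrow> 'i" and \<epsilon> :: "'m \<Rightarrow> 'i"
    and H :: "('r, 'i set) module"
    and n t :: nat
  assumes "local_ring R \<mm>" and "noetherian_ring R" and "adic_complete R \<mm>"
    and "krull_dim R = enat n"
    and "ideal I R" and "ideal J R"
    and "module R M" and "finitely_generated R M"
    and "injective_hull R (residue_field_module R \<mm>) E \<iota>"
    and "injective_resolution R M Q d \<epsilon>"
    and "pair_depth R I J Q d = enat t"
    and "H = pair_local_cohomology R I J Q d t"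
  shows "matlis_dual_map R E H H \<in>
    module_iso R (Hom_module R H H)
      (Hom_module R (matlis_dual R E H) (matlis_dual R E H))"
proof -
  note res = assms(10)[unfolded injective_resolution_def]
  have inj: "injective_module R (Q i)" for i using conjunct1[OF res] by (rule spec)
  have d_hom: "d i \<in> module_hom R (Q i) (Q (Suc i))" for i
    using conjunct1[OF conjunct2[OF res]] by (rule spec)
  have \<epsilon>: "\<epsilon> \<in> module_hom R M (Q 0)" "\<epsilon> ` carrier M = a_kernel (Q 0) (Q 1) (d 0)"
    using conjunct2[OF conjunct2[OF res]] by simp_all
  have exact: "d i ` carrier (Q i) = a_kernel (Q (Suc i)) (Q (Suc (Suc i))) (d (Suc i))" for i
    using conjunct2[OF conjunct2[OF res]] by (elim conjE) (rule spec)
  have Q: "module R (Q i)" for i using inj by (simp add: injective_module_def)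
  interpret pair_complex R Q d I J
  proof (intro pair_complex.intro injective_complex.intro pair_complex_axioms.intro)
    show "noetherian_ring R" "ideal I R" "ideal J R" by fact+
    show "injective_module R (Q i)" for i by (rule inj)
    show "d i \<in> module_hom R (Q i) (Q (Suc i))" for i by (rule d_hom)
    show "d (Suc i) (d i w) = \<zero>\<^bsub>Q (Suc (Suc i))\<^esub>" if "w \<in> carrier (Q i)" for i w
      using exact[of i] that by (auto simp: a_kernel_def')
    show "\<exists>w\<in>carrier (Q i). z = d i w"
      if "z \<in> carrier (Q (Suc i))" "d (Suc i) z = \<zero>\<^bsub>Q (Suc (Suc i))\<^esub>" for i z
      using exact[of i] that by (auto simp: a_kernel_def')
    \<comment> \<open>Images under \<open>\<epsilon>\<close> of generators of \<open>M\<close> span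
      the kernel of \<open>d 0\<close>.\<close>
    obtain es where es: "set es \<subseteq> carrier M" "carrier M = lcomb R M (carrier R) es"
      using finitely_generated_span[OF assms(7,8)] by blast
    have "ideal (carrier R) R" using assms(7) by (intro ring.oneideal cring.axioms(1) module.axioms(1))
    from lcomb_map(1)[OF assms(7) \<epsilon>(1) this es(1) Q]
    have "a_kernel (Q 0) (Q 1) (d 0) \<subseteq> lcomb R (Q 0) (carrier R) (map \<epsilon> es)"
      unfolding \<epsilon>(2)[symmetric] es(2)[symmetric] by blast
    moreover have "set (map \<epsilon> es) \<subseteq> carrier (Q 0)" using es(1) module_homD(1)[OF \<epsilon>(1)] by auto
    ultimately show "\<exists>es. set es \<subseteq> carrier (Q 0) \<and>
        {x \<in> carrier (Q 0). d 0 x = \<zero>\<^bsub>Q 1\<^esub>} \<subseteq> lcomb R (Q 0) (carrier R) es"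
      by (intro exI[of _ "map \<epsilon> es"]) (simp add: a_kernel_def')
  qed
  \<comment> \<open>Nonzero cohomology in degree \<open>i\<close> would put \<open>i\<close> into
    the set whose infimum is \<open>t\<close>.\<close>
  have vanish: "Z i \<subseteq> B i" if "i < t" for i
  proof (rule cohomology_vanishes, rule ccontr)
    assume "carrier (pair_local_cohomology R I J Q d i) \<noteq> {\<zero>\<^bsub>pair_local_cohomology R I J Q d i\<^esub>}"
    then have "pair_depth R I J Q d \<le> enat i"
      unfolding pair_depth_def by (intro Inf_lower) blast
    then show False using assms(11) that by simp
  qed
  have "module R H"
    unfolding assms(12) by (rule cohomology_cofinite(1)) (rule vanish)
  then interpret matlis_module R \<mm> E \<iota> H
    by (intro matlis_module.intro matlis.intro complete_local_ring.intro complete_local_ring_axioms.intro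
        matlis_axioms.intro assms)
  show ?thesis
  proof (rule dual_map_iso)
    fix X assume "X \<in> carrier H"
    then show "\<exists>ys. set ys \<subseteq> annihilated R H (annihilator R H X) \<and>
        annihilated R H (annihilator R H X) \<subseteq> lcomb R H (carrier R) ys"
      unfolding assms(12) by (rule cohomology_cofinite(2)[rotated]) (rule vanish)
  qed
qed

end
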